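(* Let $(X,\omega,J,\Omega)$ be an almost Calabi-Yau manifold of real dimension $2n$, let $\mathcal O\subset\mathcal L^+(X,L)$ be a compactly supported exact isotopy class of positive Lagrangian submanifolds with its Riemannian metric $(\cdot,\cdot)$, and let $\Gamma\in\mathcal O$. For all $h,k,l\in\mathcal H_\Gamma\simeq T_\Gamma\mathcal O$, the Riemannian curvature $R$ of $(\cdot,\cdot)$ at $\Gamma$ satisfies \begin{align*} R(h,k)l ={}& -\sec^2\theta\left[\left(\triangle h-\frac{n}{2\rho}\langle dh,d\rho\rangle\right)\langle dk,dl\rangle-\left(\triangle k-\frac{n}{2\rho}\langle dk,d\rho\rangle\right)\langle dh,dl\rangle\right]\\ &+\sec^2\theta\left(\langle\nabla_{\nabla h}\nabla k,\nabla l\rangle-\langle\nabla_{\nabla k}\nabla h,\nabla l\rangle\right)\\ &+\tan\theta\,\sec^2\theta\left(\langle\nabla h,\nabla\theta\rangle\langle\nabla k,\nabla l\rangle-\langle\nabla k,\nabla\theta\rangle\langle\nabla h,\nabla l\rangle\right). \end{align*}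
   Context: **Almost Calabi-Yau manifold.** $(X,\omega)$ is a symplectic manifold of dimension $2n$, $J$ is an (integrable) complex structure compatible with $\omega$, and $\Omega$ is a nowhere vanishing holomorphic $n$-form. Put $g(\cdot,\cdot)=\omega(\cdot,J\cdot)$ and define $\rho:X\to\mathbb R_{>0}$ by $\rho^n\omega^n/n!=(-1)^{n(n-1)/2}(\sqrt{-1}/2)^n\,\Omega\wedge\overline\Omega$. **Space of Lagrangians.** $L$ is a connected oriented smooth $n$-manifold. $\mathcal L=\mathcal L(X,L)$ is the space of oriented Lagrangian submanifolds $\Gamma\subset X$ diffeomorphic to $L$, i.e. the quotient of the space of embeddings $f:L\to X$ with $f^*\omega=0$ by compactly supported orientation preserving diffeomorphisms of $L$. If $L$ is non-compact, all embeddings are required to agree with a given one outside a compact subset of $L$. A map $\Lambda$ from a manifold $\Theta$ to $\mathcal L$ is smooth if it lifts to a smooth family of embeddings $f_\theta:L\to X$ (smooth as a map $\Theta\times L\to X$). For a smooth path $\Lambda_t$ with lifting $f_t$ and $v_t=\frac{d}{dt}f_t$, the derivative $\frac{d}{dt}\Lambda_t$ is the closed compactly supported $1$-form $\alpha_t$ on $\Lambda_t$ with $f_t^*\alpha_t=i_{v_t}\omega$, where for a vector field $v$ along a map $f$ one sets $(i_v\tau)(\eta_1,\dots)=\tau(v,df(\eta_1),\dots)$. This form is independent of the lifting. The path is exact if $\frac{d}{dt}\Lambda_t=dh_t$ for a family of functions $h_t:\Lambda_t\to\mathbb R$, and compactly supported if the $h_t$ can be chosen with compact support. **Positive Lagrangians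 and the metric.** $\Gamma\in\mathcal L$ is positive if $\operatorname{Re}\Omega|_\Gamma$ is a positive volume form; $\mathcal L^+\subset\mathcal L$ is the set of these. A compactly supported exact isotopy class $\mathcal O\subset\mathcal L^+$ is the set of all $\Gamma\in\mathcal L^+$ that can be joined to a fixed element of $\mathcal L^+$ by an exact compactly supported path in $\mathcal L^+$. $T_\Gamma\mathcal O$ is the space of exact $1$-forms on $\Gamma$ with compactly supported primitive. $\mathcal H_\Gamma$ is the space of smooth $h:\Gamma\to\mathbb R$ with $\int_\Gamma h\operatorname{Re}\Omega=0$ if $\Gamma$ is compact, and with compact support if $\Gamma$ is non-compact. $\mathcal H_\Gamma\simeq T_\Gamma\mathcal O$ by $h\mapsto dh$. The Riemannian metric on $\mathcal O$ is $(h,k)=\int_\Gamma hk\operatorname{Re}\Omega$ for $h,k\in\mathcal H_\Gamma$. **Geometry of $\Gamma$.** $\langle\cdot,\cdot\rangle$ is the metric induced on $\Gamma$ by $g$, $\mathrm{vol}$ its volume form, and the Lagrangian angle $\theta:\Gamma\to S^1$ is determined by $\Omega|_\Gamma=e^{\sqrt{-1}\theta}\rho^{n/2}\mathrm{vol}$. $\nabla$ denotes both the Levi-Civita connection and the gradient on $\Gamma$ with respect to $\langle\cdot,\cdot\rangle$. $\triangle$ is the Laplace-Beltrami operator of $\langle\cdot,\cdot\rangle$ with the non-negative sign convention $\triangle h=d^*dh$, i.e. $d{*}dh=-\triangle h\,\mathrm{vol}$. In inner products on $\Gamma$, $d\rho$ means $d(\rho|_\Gamma)$. **Levi-Civita connection.**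 For a smooth path $\Lambda_t$ in $\mathcal O$ with parametrizations (lifting) $g_t:L\to\Lambda_t\subset X$, $u_t=\frac{d}{dt}g_t$, and a smooth family of functions $h_t:\Lambda_t\to\mathbb R$, let $w_t$ be the vector field on $L$ with $i_{w_t}\operatorname{Re}(g_t^*\Omega)=-i_{u_t}\operatorname{Re}\Omega$, and set $\frac{D}{dt}h_t=\bigl(\frac{d}{dt}(h_t\circ g_t)+w_t\cdot(h_t\circ g_t)\bigr)\circ g_t^{-1}$. This is independent of the choice of $g_t$, and $D$ is the Levi-Civita connection of $(\cdot,\cdot)$. **Curvature.** $R(h,k)l=D_hD_kl-D_kD_hl-D_{[h,k]}l$. Concretely, if $\Lambda_{s,t}$ is a smooth two-parameter family in $\mathcal O$ with $\Lambda_{0,0}=\Gamma$, $\partial_s\Lambda|_{(0,0)}=dh$, $\partial_t\Lambda|_{(0,0)}=dk$, and $l_{s,t}\in\mathcal H_{\Lambda_{s,t}}$ is a smooth family with $l_{0,0}=l$, then $R(h,k)l=\bigl(\frac{D}{ds}\frac{D}{dt}l_{s,t}-\frac{D}{dt}\frac{D}{ds}l_{s,t}\bigr)\big|_{(0,0)}$. *)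

theory Defs
  imports "HOL-Analysis.Analysis"
begin

section \<open>Smooth and complex differentiable maps on open subsets of Euclidean spaces\<close>

primrec Ck_on :: "nat \<Rightarrow> 'a::real_normed_vector set \<Rightarrow> ('a \<Rightarrow> 'b::real_normed_vector) \<Rightarrow> bool" where
  "Ck_on 0 S f \<longleftrightarrow> continuous_on S f"
| "Ck_on (Suc k) S f \<longleftrightarrow>
     (\<forall>x\<in>S. f differentiable (at x)) \<and> (\<forall>v. Ck_on k S (\<lambda>x. frechet_derivative f (at x) v))"

text \<open>Only used for open \<open>S\<close> in a finite-dimensional space.\<close>
definition smooth_on :: "'a::real_normed_vector set \<Rightarrow> ('a \<Rightarrow> 'b::real_normed_vector) \<Rightarrow> bool" where
  "smooth_on S f \<longleftrightarrow> (\<forall>k. Ck_on k S f)"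

text \<open>\<open>J\<close> is multiplication by the imaginary unit on the target.\<close>
definition holo_on :: "('b \<Rightarrow> 'b) \<Rightarrow> (complex^'n) set \<Rightarrow> (complex^'n::finite \<Rightarrow> 'b::real_normed_vector) \<Rightarrow> bool" where
  "holo_on J S f \<longleftrightarrow>
     (\<forall>x\<in>S. \<exists>D. (f has_derivative D) (at x) \<and> (\<forall>u. D (\<i> *s u) = J (D u)))"


section \<open>Manifolds\<close>

text \<open>
  A manifold is a type together with an atlas of charts \<open>(U, \<phi>)\<close> covering it; the Hausdorff and
  second countability axioms are imposed as type classes in the theorem.

  The tangent space at \<open>p\<close> is the model space \<open>'e\<close>, identified with the abstract one through the
  differential at \<open>p\<close> of the chart \<open>chart_at A p\<close>. All tensors, differentials and vector fields
  below are written with respect to these identifications; the functions \<open>tensor_in\<close>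
  and \<open>vector_in\<close> convert them to their components in a chart of the atlas.
\<close>

type_synonym ('m, 'e) chart = "'m set \<times> ('m \<Rightarrow> 'e)"

definition chart_inv :: "('m, 'e) chart \<Rightarrow> 'e \<Rightarrow> 'm" where
  "chart_inv c = inv_into (fst c) (snd c)"

definition chart_image :: "('m, 'e) chart \<Rightarrow> 'e set" where
  "chart_image c = snd c ` fst c"

definition is_chart :: "('m::topological_space, 'e::euclidean_space) chart \<Rightarrow> bool" where
  "is_chart c \<longleftrightarrow> open (fst c) \<and> open (chart_image c) \<and>
     homeomorphism (fst c) (chart_image c) (snd c) (chart_inv c)"

definition smooth_atlas :: "('m::topological_space, 'e::euclidean_space) chart set \<Rightarrow> bool" where
  "smooth_atlas A \<longleftrightarrow> (\<forall>c\<in>A. is_chart c) \<and> (\<Union>c\<in>A. fst c) = UNIV \<and>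
     (\<forall>c\<in>A. \<forall>d\<in>A. smooth_on (snd c ` (fst c \<inter> fst d)) (snd d \<circ> chart_inv c))"

text \<open>
  A complex structure: on each tangent space, \<open>J\<close> is then multiplication by \<open>\<i>\<close> on the model space,
  independently of the chart since the transition maps have complex linear differentials.
\<close>
definition complex_atlas :: "('m::topological_space, complex^'n::finite) chart set \<Rightarrow> bool" where
  "complex_atlas A \<longleftrightarrow> smooth_atlas A \<and>
     (\<forall>c\<in>A. \<forall>d\<in>A. holo_on (\<lambda>v. \<i> *s v) (snd c ` (fst c \<inter> fst d)) (snd d \<circ> chart_inv c))"

definition oriented_atlas :: "('m::topological_space, real^'n::finite) chart set \<Rightarrow> bool" where
  "oriented_atlas A \<longleftrightarrow> smooth_atlas A \<and>
     (\<forall>c\<in>A. \<forall>d\<in>A. \<forall>y\<in>snd c ` (fst c \<inter> fst d).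
        det (matrix (frechet_derivative (snd d \<circ> chart_inv c) (at y))) > 0)"

definition chart_at :: "('m, 'e) chart set \<Rightarrow> 'm \<Rightarrow> ('m, 'e) chart" where
  "chart_at A p = (SOME c. c \<in> A \<and> p \<in> fst c)"

abbreviation coord :: "('m, 'e) chart set \<Rightarrow> 'm \<Rightarrow> 'e" where
  "coord A p \<equiv> snd (chart_at A p) p"

definition mderiv :: "('m, 'e::real_normed_vector) chart set \<Rightarrow> ('k, 'f::real_normed_vector) chart set \<Rightarrow>
    ('m \<Rightarrow> 'k) \<Rightarrow> 'm \<Rightarrow> 'e \<Rightarrow> 'f" where
  "mderiv A B f p =
     frechet_derivative (snd (chart_at B (f p)) \<circ> f \<circ> chart_inv (chart_at A p)) (at (coord A p))"

definition fderiv :: "('m, 'e::real_normed_vector) chart set \<Rightarrow> ('m \<Rightarrow> 'b::real_normed_vector) \<Rightarrow>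
    'm \<Rightarrow> 'e \<Rightarrow> 'b" where
  "fderiv A \<phi> p = frechet_derivative (\<phi> \<circ> chart_inv (chart_at A p)) (at (coord A p))"

definition smooth_fun :: "('m, 'e::real_normed_vector) chart set \<Rightarrow> ('m \<Rightarrow> 'b::real_normed_vector) \<Rightarrow> bool" where
  "smooth_fun A \<phi> \<longleftrightarrow> (\<forall>c\<in>A. smooth_on (chart_image c) (\<phi> \<circ> chart_inv c))"

text \<open>Smoothness of \<open>\<Theta> \<times> M \<rightarrow> K\<close> and \<open>\<Theta> \<times> M \<rightarrow> V\<close>, for \<open>\<Theta>\<close> open in a Euclidean space.\<close>

definition smooth_family :: "('m::topological_space, 'e::real_normed_vector) chart set \<Rightarrow>
    ('k::topological_space, 'f::real_normed_vector) chart set \<Rightarrow>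
    't::real_normed_vector set \<Rightarrow> ('t \<Rightarrow> 'm \<Rightarrow> 'k) \<Rightarrow> bool" where
  "smooth_family A B \<Theta> F \<longleftrightarrow> continuous_on (\<Theta> \<times> UNIV) (\<lambda>(\<theta>, p). F \<theta> p) \<and>
     (\<forall>c\<in>A. \<forall>d\<in>B.
        smooth_on {(\<theta>, y). \<theta> \<in> \<Theta> \<and> y \<in> chart_image c \<and> F \<theta> (chart_inv c y) \<in> fst d}
          (\<lambda>(\<theta>, y). snd d (F \<theta> (chart_inv c y))))"

definition smooth_fun_family :: "('m, 'e::real_normed_vector) chart set \<Rightarrow>
    't::real_normed_vector set \<Rightarrow> ('t \<Rightarrow> 'm \<Rightarrow> 'b::real_normed_vector) \<Rightarrow> bool" where
  "smooth_fun_family A \<Theta> \<phi> \<longleftrightarrow>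
     (\<forall>c\<in>A. smooth_on (\<Theta> \<times> chart_image c) (\<lambda>(\<theta>, y). \<phi> \<theta> (chart_inv c y)))"

definition smooth_map :: "('m::topological_space, 'e::real_normed_vector) chart set \<Rightarrow>
    ('k::topological_space, 'f::real_normed_vector) chart set \<Rightarrow> ('m \<Rightarrow> 'k) \<Rightarrow> bool" where
  "smooth_map A B f \<longleftrightarrow> continuous_on UNIV f \<and>
     (\<forall>c\<in>A. \<forall>d\<in>B. smooth_on (snd c ` (fst c \<inter> f -` fst d)) (snd d \<circ> f \<circ> chart_inv c))"

definition embedding :: "('m::topological_space, 'e::real_normed_vector) chart set \<Rightarrow>
    ('k::topological_space, 'f::real_normed_vector) chart set \<Rightarrow> ('m \<Rightarrow> 'k) \<Rightarrow> bool" where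
  "embedding A B f \<longleftrightarrow> smooth_map A B f \<and> (\<forall>p. inj (mderiv A B f p)) \<and>
     homeomorphism UNIV (range f) f (inv f)"

text \<open>The velocity at time \<open>t\<close> of a path of maps, as a vector field along the map \<open>F t\<close>.\<close>
definition velocity :: "('k, 'f::real_normed_vector) chart set \<Rightarrow> (real \<Rightarrow> 'm \<Rightarrow> 'k) \<Rightarrow> real \<Rightarrow> 'm \<Rightarrow> 'f" where
  "velocity B F t p = vector_derivative (\<lambda>\<tau>. snd (chart_at B (F t p)) (F \<tau> p)) (at t)"


section \<open>Covariant tensors and differential forms\<close>

text \<open>
  A covariant \<open>k\<close>-tensor at \<open>p\<close> is a function of a sequence of tangent vectors that reads only the
  first \<open>k\<close> entries. In particular \<open>\<lambda>\<eta>. \<alpha> (case_nat v \<eta>)\<close> is the contraction of \<open>\<alpha>\<close> with \<open>v\<close> in its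
  first argument.
\<close>

type_synonym ('m, 'v, 's) tensor = "'m \<Rightarrow> (nat \<Rightarrow> 'v) \<Rightarrow> 's"

abbreviation vpair :: "'v \<Rightarrow> 'v \<Rightarrow> nat \<Rightarrow> 'v" where
  "vpair u v \<equiv> case_nat u (\<lambda>_. v)"

definition alternating :: "nat \<Rightarrow> ((nat \<Rightarrow> 'v::real_vector) \<Rightarrow> 's::real_vector) \<Rightarrow> bool" where
  "alternating k \<alpha> \<longleftrightarrow>
     (\<forall>v w. (\<forall>i<k. v i = w i) \<longrightarrow> \<alpha> v = \<alpha> w) \<and>
     (\<forall>v. \<forall>i<k. linear (\<lambda>x. \<alpha> (v(i := x)))) \<and>
     (\<forall>v. \<forall>i<k. \<forall>j<k. i \<noteq> j \<and> v i = v j \<longrightarrow> \<alpha> v = 0)"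

text \<open>Normalised so that \<open>(dx \<and> dy) (\<partial>x, \<partial>y) = 1\<close>.\<close>
definition wedge :: "nat \<Rightarrow> nat \<Rightarrow> ((nat \<Rightarrow> 'v) \<Rightarrow> 's) \<Rightarrow> ((nat \<Rightarrow> 'v) \<Rightarrow> 's) \<Rightarrow>
    (nat \<Rightarrow> 'v) \<Rightarrow> 's::real_normed_field" where
  "wedge k m \<alpha> \<beta> v = (\<Sum>\<sigma> | \<sigma> permutes {..<k + m}.
      of_int (sign \<sigma>) * \<alpha> (\<lambda>i. v (\<sigma> i)) * \<beta> (\<lambda>i. v (\<sigma> (k + i)))) / (fact k * fact m)"

primrec wedge_pow2 :: "((nat \<Rightarrow> 'v) \<Rightarrow> 's) \<Rightarrow> nat \<Rightarrow> (nat \<Rightarrow> 'v) \<Rightarrow> 's::real_normed_field" where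
  "wedge_pow2 \<alpha> 0 = (\<lambda>v. 1)"
| "wedge_pow2 \<alpha> (Suc m) = wedge 2 (2 * m) \<alpha> (wedge_pow2 \<alpha> m)"

definition pullback :: "('m, 'e::real_normed_vector) chart set \<Rightarrow> ('k, 'f::real_normed_vector) chart set \<Rightarrow>
    ('m \<Rightarrow> 'k) \<Rightarrow> ('k, 'f, 's) tensor \<Rightarrow> ('m, 'e, 's) tensor" where
  "pullback A B f \<alpha> p v = \<alpha> (f p) (\<lambda>i. mderiv A B f p (v i))"

definition tensor_in :: "('m, 'e::real_normed_vector) chart set \<Rightarrow> ('m, 'e) chart \<Rightarrow>
    ('m, 'e, 's) tensor \<Rightarrow> ('e, 'e, 's) tensor" where
  "tensor_in A c \<alpha> y v = (let p = chart_inv c y in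
     \<alpha> p (\<lambda>i. frechet_derivative (snd (chart_at A p) \<circ> chart_inv c) (at y) (v i)))"

definition vector_in :: "('m, 'e::real_normed_vector) chart set \<Rightarrow> ('m, 'e) chart \<Rightarrow>
    ('m \<Rightarrow> 'e) \<Rightarrow> 'e \<Rightarrow> 'e" where
  "vector_in A c Z y = (let p = chart_inv c y in
     frechet_derivative (snd c \<circ> chart_inv (chart_at A p)) (at (coord A p)) (Z p))"

definition smooth_tensor :: "('m, 'e::real_normed_vector) chart set \<Rightarrow>
    ('m, 'e, 's::real_normed_vector) tensor \<Rightarrow> bool" where
  "smooth_tensor A \<alpha> \<longleftrightarrow> (\<forall>c\<in>A. \<forall>v. smooth_on (chart_image c) (\<lambda>y. tensor_in A c \<alpha> y v))"

definition ext_deriv :: "nat \<Rightarrow> ('e, 'e, 's) tensor \<Rightarrow>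
    ('e::real_normed_vector, 'e, 's::real_normed_vector) tensor" where
  "ext_deriv k \<beta> y v = (\<Sum>i\<le>k. (-1) ^ i *\<^sub>R
     frechet_derivative (\<lambda>z. \<beta> z (\<lambda>j. if j < i then v j else v (Suc j))) (at y) (v i))"

definition closed_form :: "nat \<Rightarrow> ('m, 'e::real_normed_vector) chart set \<Rightarrow>
    ('m, 'e, 's::real_normed_vector) tensor \<Rightarrow> bool" where
  "closed_form k A \<alpha> \<longleftrightarrow> (\<forall>c\<in>A. \<forall>y\<in>chart_image c. \<forall>v. ext_deriv k (tensor_in A c \<alpha>) y v = 0)"


section \<open>Almost Calabi-Yau manifolds\<close>

text \<open>The complex dimension is \<open>CARD('n)\<close>; the complex structure is encoded in the atlas.\<close>
record ('x, 'n::finite) acy_data =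
  charts :: "('x, complex^'n) chart set"
  symp :: "('x, complex^'n, real) tensor"
  hol_form :: "('x, complex^'n, complex) tensor"

definition symplectic_form :: "('m, 'e::euclidean_space) chart set \<Rightarrow> ('m, 'e, real) tensor \<Rightarrow> bool" where
  "symplectic_form A \<omega> \<longleftrightarrow> (\<forall>p. alternating 2 (\<omega> p)) \<and> smooth_tensor A \<omega> \<and> closed_form 2 A \<omega> \<and>
     (\<forall>p u. u \<noteq> 0 \<longrightarrow> (\<exists>v. \<omega> p (vpair u v) \<noteq> 0))"

definition compatible :: "('m, complex^'n::finite, real) tensor \<Rightarrow> bool" where
  "compatible \<omega> \<longleftrightarrow> (\<forall>p u v. \<omega> p (vpair (\<i> *s u) (\<i> *s v)) = \<omega> p (vpair u v)) \<and>
     (\<forall>p u. u \<noteq> 0 \<longrightarrow> \<omega> p (vpair u (\<i> *s u)) > 0)"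

text \<open>Holomorphic forms of top degree: type \<open>(n,0)\<close> with holomorphic components in each chart.\<close>
definition holomorphic_top_form :: "('m, complex^'n::finite) chart set \<Rightarrow>
    ('m, complex^'n, complex) tensor \<Rightarrow> bool" where
  "holomorphic_top_form A \<Omega> \<longleftrightarrow>
     (\<forall>p. alternating CARD('n) (\<Omega> p) \<and>
          (\<forall>v. \<forall>i<CARD('n). \<Omega> p (v(i := \<i> *s v i)) = \<i> * \<Omega> p v)) \<and>
     smooth_tensor A \<Omega> \<and>
     (\<forall>c\<in>A. \<forall>v. holo_on ((*) \<i>) (chart_image c) (\<lambda>y. tensor_in A c \<Omega> y v))"

definition almost_calabi_yau :: "('x::topological_space, 'n::finite) acy_data \<Rightarrow> bool" where
  "almost_calabi_yau X \<longleftrightarrow> complex_atlas (charts X) \<and>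
     symplectic_form (charts X) (symp X) \<and> compatible (symp X) \<and>
     holomorphic_top_form (charts X) (hol_form X) \<and> (\<forall>p. \<exists>v. hol_form X p v \<noteq> 0)"

definition kmetric :: "('x, 'n::finite) acy_data \<Rightarrow> ('x, complex^'n, real) tensor" where
  "kmetric X p v = symp X p (vpair (v 0) (\<i> *s v 1))"

definition acy_rho :: "('x, 'n::finite) acy_data \<Rightarrow> 'x \<Rightarrow> real" where
  "acy_rho X p = (let n = CARD('n) in THE r. r > 0 \<and>
     (\<forall>v. of_real (r ^ n * wedge_pow2 (symp X p) n v / fact n) =
        (-1) ^ (n * (n - 1) div 2) * (\<i> / 2) ^ n *
        wedge n n (hol_form X p) (\<lambda>u. cnj (hol_form X p u)) v))"


section \<open>Integration and Riemannian geometry on an oriented manifold\<close>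

text \<open>
  The standard positive frame of \<open>\<real>\<^sup>n\<close>, numbered by \<open>0, \<dots>, n - 1\<close> along the order of the index type.
  A top degree form is determined by its value on it.
\<close>
definition std_frame :: "nat \<Rightarrow> real^'n::{finite,linorder}" where
  "std_frame i = (\<chi> a. if card {..<a} = i then 1 else 0)"

text \<open>\<open>\<eta>\<close> is a smooth partition of unity, on the set where \<open>\<beta>\<close> does not vanish, subordinate to finitely
  many charts.\<close>
definition has_form_integral :: "('m::topological_space, real^'n::{finite,linorder}) chart set \<Rightarrow>
    ('m, real^'n::{finite,linorder}, real) tensor \<Rightarrow> real \<Rightarrow> bool" where
  "has_form_integral A \<beta> I \<longleftrightarrow> (\<exists>C \<eta>. finite C \<and> C \<subseteq> A \<and>
     (\<forall>c\<in>C. smooth_fun A (\<eta> c) \<and> (\<exists>K. compact K \<and> K \<subseteq> fst c \<and> (\<forall>p. p \<notin> K \<longrightarrow> \<eta> c p = 0))) \<and>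
     (\<forall>p. \<beta> p std_frame \<noteq> 0 \<longrightarrow> (\<Sum>c\<in>C. \<eta> c p) = 1) \<and>
     I = (\<Sum>c\<in>C. integral (chart_image c)
            (\<lambda>y. \<eta> c (chart_inv c y) * tensor_in A c \<beta> y std_frame)))"

definition form_integral :: "('m::topological_space, real^'n::{finite,linorder}) chart set \<Rightarrow>
    ('m, real^'n::{finite,linorder}, real) tensor \<Rightarrow> real" where
  "form_integral A \<beta> = (THE I. has_form_integral A \<beta> I)"

text \<open>In the following \<open>G\<close> is a Riemannian metric, as a covariant 2-tensor.\<close>

text \<open>\<open>\<surd>det G dx\<^sub>1 \<and> \<dots> \<and> dx\<^sub>n\<close>\<close>
definition vol_form :: "('m, real^'n::{finite,linorder}, real) tensor \<Rightarrow>
    ('m, real^'n::{finite,linorder}, real) tensor" where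
  "vol_form G p v = sqrt (det (\<chi> a b. G p (vpair (axis a 1) (axis b 1)))) *
     det (\<chi> a b. v (card {..<b}) $ a)"

definition gradient :: "('m, 'e::real_normed_vector) chart set \<Rightarrow> ('m, 'e, real) tensor \<Rightarrow>
    ('m \<Rightarrow> real) \<Rightarrow> 'm \<Rightarrow> 'e" where
  "gradient A G \<phi> p = (THE v. \<forall>u. G p (vpair v u) = fderiv A \<phi> p u)"

text \<open>\<open>\<langle>d\<phi>, d\<psi>\<rangle> = \<langle>\<nabla>\<phi>, \<nabla>\<psi>\<rangle>\<close>\<close>
definition inner_d :: "('m, 'e::real_normed_vector) chart set \<Rightarrow> ('m, 'e, real) tensor \<Rightarrow>
    ('m \<Rightarrow> real) \<Rightarrow> ('m \<Rightarrow> real) \<Rightarrow> 'm \<Rightarrow> real" where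
  "inner_d A G \<phi> \<psi> p = G p (vpair (gradient A G \<phi> p) (gradient A G \<psi> p))"

text \<open>
  Levi-Civita connection: in the chart at \<open>p\<close>, \<open>\<nabla>\<^sub>u Z\<close> is the derivative of the components of \<open>Z\<close>
  plus the Christoffel term, the latter given by the Koszul formula for constant vector fields.
\<close>

definition christoffel :: "('m, 'e::real_normed_vector) chart set \<Rightarrow> ('m, 'e, real) tensor \<Rightarrow>
    'm \<Rightarrow> 'e \<Rightarrow> 'e \<Rightarrow> 'e" where
  "christoffel A G p u v =
     (let dG = (\<lambda>a b d. frechet_derivative
                  (\<lambda>y. tensor_in A (chart_at A p) G y (vpair b d)) (at (coord A p)) a)
      in THE x. \<forall>w. G p (vpair x w) = (dG u v w + dG v u w - dG w u v) / 2)"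

definition levi_civita :: "('m, 'e::real_normed_vector) chart set \<Rightarrow> ('m, 'e, real) tensor \<Rightarrow>
    'm \<Rightarrow> 'e \<Rightarrow> ('m \<Rightarrow> 'e) \<Rightarrow> 'e" where
  "levi_civita A G p u Z =
     frechet_derivative (vector_in A (chart_at A p) Z) (at (coord A p)) u + christoffel A G p u (Z p)"

text \<open>The Hodge star of \<open>d\<phi>\<close> is the contraction of the volume form with \<open>\<nabla>\<phi>\<close>.\<close>
definition hodge_star_d :: "('m, real^'n::{finite,linorder}) chart set \<Rightarrow>
    ('m, real^'n::{finite,linorder}, real) tensor \<Rightarrow>
    ('m \<Rightarrow> real) \<Rightarrow> ('m, real^'n::{finite,linorder}, real) tensor" where
  "hodge_star_d A G \<phi> p \<eta> = vol_form G p (case_nat (gradient A G \<phi> p) \<eta>)"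

text \<open>Non-negative sign convention: \<open>d * d\<phi> = - \<triangle>\<phi> vol\<close>.\<close>
definition laplace_beltrami :: "('m, real^'n::{finite,linorder}) chart set \<Rightarrow>
    ('m, real^'n::{finite,linorder}, real) tensor \<Rightarrow>
    ('m \<Rightarrow> real) \<Rightarrow> 'm \<Rightarrow> real" where
  "laplace_beltrami A G \<phi> p =
     - (ext_deriv (CARD('n) - 1) (tensor_in A (chart_at A p) (hodge_star_d A G \<phi>))
          (coord A p) std_frame / vol_form G p std_frame)"


section \<open>The space of Lagrangians\<close>

text \<open>
  \<open>X\<close> is an almost Calabi-Yau manifold, \<open>A\<close> the atlas of the oriented manifold \<open>L\<close> and \<open>f0\<close> the
  embedding with which all embeddings are required to agree outside a compact set. If \<open>L\<close> is compact
  this last condition is void.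
\<close>

definition lagrangian :: "('l, real^'n::finite) chart set \<Rightarrow> ('x, 'n) acy_data \<Rightarrow> ('l \<Rightarrow> 'x) \<Rightarrow> bool" where
  "lagrangian A X f \<longleftrightarrow> (\<forall>p v. pullback A (charts X) f (symp X) p v = 0)"

definition lag_embeddings :: "('l::topological_space, real^'n::finite) chart set \<Rightarrow>
    ('x::topological_space, 'n) acy_data \<Rightarrow> ('l \<Rightarrow> 'x) \<Rightarrow> ('l \<Rightarrow> 'x) set" where
  "lag_embeddings A X f0 = {f. embedding A (charts X) f \<and> lagrangian A X f \<and>
     (\<exists>K. compact K \<and> (\<forall>p. p \<notin> K \<longrightarrow> f p = f0 p))}"

definition diffeos :: "('l::topological_space, real^'n::finite) chart set \<Rightarrow> ('l \<Rightarrow> 'l) set" where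
  "diffeos A = {\<phi>. bij \<phi> \<and> smooth_map A A \<phi> \<and> smooth_map A A (inv \<phi>) \<and>
     (\<exists>K. compact K \<and> (\<forall>p. p \<notin> K \<longrightarrow> \<phi> p = p)) \<and> (\<forall>p. det (matrix (mderiv A A \<phi> p)) > 0)}"

text \<open>A Lagrangian submanifold is the set of its parametrizations.\<close>
definition lag_class :: "('l::topological_space, real^'n::finite) chart set \<Rightarrow> ('l \<Rightarrow> 'x) \<Rightarrow> ('l \<Rightarrow> 'x) set" where
  "lag_class A f = (\<lambda>\<phi>. f \<circ> \<phi>) ` diffeos A"

definition lag_space :: "('l::topological_space, real^'n::finite) chart set \<Rightarrow>
    ('x::topological_space, 'n) acy_data \<Rightarrow> ('l \<Rightarrow> 'x) \<Rightarrow> ('l \<Rightarrow> 'x) set set" where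
  "lag_space A X f0 = lag_class A ` lag_embeddings A X f0"

definition pos_lag_space :: "('l::topological_space, real^'n::{finite,linorder}) chart set \<Rightarrow>
    ('x::topological_space, 'n) acy_data \<Rightarrow> ('l \<Rightarrow> 'x) \<Rightarrow> ('l \<Rightarrow> 'x) set set" where
  "pos_lag_space A X f0 = {\<Gamma> \<in> lag_space A X f0. \<forall>f\<in>\<Gamma>. \<forall>p.
     Re (pullback A (charts X) f (hol_form X) p std_frame) > 0}"

text \<open>\<open>F\<close> lifts a smooth map from the open set \<open>\<Theta>\<close> of a Euclidean space to the space of Lagrangians.\<close>
definition lag_family :: "('l::topological_space, real^'n::finite) chart set \<Rightarrow>
    ('x::topological_space, 'n) acy_data \<Rightarrow> ('l \<Rightarrow> 'x) \<Rightarrow>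
    't::euclidean_space set \<Rightarrow> ('t \<Rightarrow> 'l \<Rightarrow> 'x) \<Rightarrow> bool" where
  "lag_family A X f0 \<Theta> F \<longleftrightarrow> open \<Theta> \<and> smooth_family A (charts X) \<Theta> F \<and>
     (\<forall>\<theta>\<in>\<Theta>. F \<theta> \<in> lag_embeddings A X f0)"

text \<open>The path of Lagrangians with lifting \<open>F\<close> has derivative \<open>dh\<close> at time \<open>t\<close>, where \<open>h\<close> is a smooth
  function on the Lagrangian parametrized by \<open>F t\<close>.\<close>
definition path_derivative :: "('l, real^'n::finite) chart set \<Rightarrow> ('x, 'n) acy_data \<Rightarrow>
    (real \<Rightarrow> 'l \<Rightarrow> 'x) \<Rightarrow> real \<Rightarrow> ('x \<Rightarrow> real) \<Rightarrow> bool" where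
  "path_derivative A X F t h \<longleftrightarrow> smooth_fun A (h \<circ> F t) \<and>
     (\<forall>p \<eta>. fderiv A (h \<circ> F t) p \<eta> =
        symp X (F t p) (vpair (velocity (charts X) F t p) (mderiv A (charts X) (F t) p \<eta>)))"

definition comp_supp :: "('l::topological_space \<Rightarrow> real) \<Rightarrow> bool" where
  "comp_supp \<phi> \<longleftrightarrow> (\<exists>K. compact K \<and> (\<forall>p. p \<notin> K \<longrightarrow> \<phi> p = 0))"

text \<open>The path is parametrized by an open neighbourhood of \<open>[0,1]\<close>; this is no restriction, since a path
  smooth up to the endpoints can be reparametrized to be constant near them.\<close>
definition exact_isotopic :: "('l::topological_space, real^'n::{finite,linorder}) chart set \<Rightarrow>
    ('x::topological_space, 'n) acy_data \<Rightarrow> ('l \<Rightarrow> 'x) \<Rightarrow> ('l \<Rightarrow> 'x) set \<Rightarrow> ('l \<Rightarrow> 'x) set \<Rightarrow> bool" where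
  "exact_isotopic A X f0 \<Gamma> \<Gamma>' \<longleftrightarrow> (\<exists>I F. {0..1::real} \<subseteq> I \<and> lag_family A X f0 I F \<and>
     (\<forall>t\<in>I. lag_class A (F t) \<in> pos_lag_space A X f0) \<and>
     lag_class A (F 0) = \<Gamma> \<and> lag_class A (F 1) = \<Gamma>' \<and>
     (\<forall>t\<in>I. \<exists>h. comp_supp (h \<circ> F t) \<and> path_derivative A X F t h))"

definition exact_isotopy_class :: "('l::topological_space, real^'n::{finite,linorder}) chart set \<Rightarrow>
    ('x::topological_space, 'n) acy_data \<Rightarrow> ('l \<Rightarrow> 'x) \<Rightarrow> ('l \<Rightarrow> 'x) set set \<Rightarrow> bool" where
  "exact_isotopy_class A X f0 \<O> \<longleftrightarrow> (\<exists>\<Gamma>0\<in>pos_lag_space A X f0.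
     \<O> = {\<Gamma> \<in> pos_lag_space A X f0. exact_isotopic A X f0 \<Gamma>0 \<Gamma>})"


section \<open>Tangent spaces, Levi-Civita connection and curvature of an exact isotopy class\<close>

text \<open>Functions on a Lagrangian are functions on the ambient space of which only the restriction to the
  image of the Lagrangian matters.\<close>

definition lag_integral :: "('l::topological_space, real^'n::{finite,linorder}) chart set \<Rightarrow>
    ('x, 'n) acy_data \<Rightarrow> ('l \<Rightarrow> 'x) \<Rightarrow> ('x \<Rightarrow> real) \<Rightarrow> real" where
  "lag_integral A X f h =
     form_integral A (\<lambda>p v. h (f p) * Re (pullback A (charts X) f (hol_form X) p v))"

text \<open>The space \<open>\<H>\<^sub>\<Gamma>\<close>, identified with the tangent space at \<open>\<Gamma>\<close> by \<open>h \<mapsto> dh\<close>.\<close>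
definition ham_functions :: "('l::topological_space, real^'n::{finite,linorder}) chart set \<Rightarrow>
    ('x, 'n) acy_data \<Rightarrow> ('l \<Rightarrow> 'x) set \<Rightarrow> ('x \<Rightarrow> real) set" where
  "ham_functions A X \<Gamma> = {h. \<forall>f\<in>\<Gamma>. smooth_fun A (h \<circ> f) \<and>
     (if compact (UNIV :: 'l set) then lag_integral A X f h = 0 else comp_supp (h \<circ> f))}"

text \<open>The Riemannian metric on \<open>\<H>\<^sub>\<Gamma>\<close>; \<open>cov_deriv\<close> below is its Levi-Civita connection.\<close>
definition lag_metric :: "('l::topological_space, real^'n::{finite,linorder}) chart set \<Rightarrow>
    ('x, 'n) acy_data \<Rightarrow> ('l \<Rightarrow> 'x) \<Rightarrow> ('x \<Rightarrow> real) \<Rightarrow> ('x \<Rightarrow> real) \<Rightarrow> real" where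
  "lag_metric A X f h k = lag_integral A X f (\<lambda>x. h x * k x)"

text \<open>The vector field \<open>w\<close> on \<open>L\<close> whose contraction with the pullback of \<open>Re \<Omega>\<close> is minus the
  contraction of \<open>Re \<Omega>\<close> with the velocity.\<close>
definition horizontal_field :: "('l, real^'n::finite) chart set \<Rightarrow> ('x, 'n) acy_data \<Rightarrow>
    (real \<Rightarrow> 'l \<Rightarrow> 'x) \<Rightarrow> real \<Rightarrow> 'l \<Rightarrow> real^'n" where
  "horizontal_field A X F t p = (THE w. \<forall>\<eta>.
     Re (pullback A (charts X) (F t) (hol_form X) p (case_nat w \<eta>)) =
     - Re (hol_form X (F t p)
         (case_nat (velocity (charts X) F t p) (\<lambda>i. mderiv A (charts X) (F t) p (\<eta> i)))))"

text \<open>The covariant derivative at time \<open>t\<close> of a family \<open>h\<close> of functions along the path of Lagrangians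
  with lifting \<open>F\<close>.\<close>
definition cov_deriv :: "('l, real^'n::finite) chart set \<Rightarrow> ('x, 'n) acy_data \<Rightarrow>
    (real \<Rightarrow> 'l \<Rightarrow> 'x) \<Rightarrow> (real \<Rightarrow> 'x \<Rightarrow> real) \<Rightarrow> real \<Rightarrow> 'x \<Rightarrow> real" where
  "cov_deriv A X F h t x = (let p = inv (F t) x in
     vector_derivative (\<lambda>\<tau>. h \<tau> (F \<tau> p)) (at t) +
     fderiv A (h t \<circ> F t) p (horizontal_field A X F t p))"

text \<open>\<open>D/ds D/dt l - D/dt D/ds l\<close> at the origin, as a function on the Lagrangian there, for a
  two-parameter family \<open>F\<close> and functions \<open>l\<close> along it.\<close>
definition curvature :: "('l, real^'n::finite) chart set \<Rightarrow> ('x, 'n) acy_data \<Rightarrow>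
    (real \<times> real \<Rightarrow> 'l \<Rightarrow> 'x) \<Rightarrow> (real \<times> real \<Rightarrow> 'x \<Rightarrow> real) \<Rightarrow> 'x \<Rightarrow> real" where
  "curvature A X F l x =
     cov_deriv A X (\<lambda>s. F (s, 0))
       (\<lambda>s. cov_deriv A X (\<lambda>t. F (s, t)) (\<lambda>t. l (s, t)) 0) 0 x -
     cov_deriv A X (\<lambda>t. F (0, t))
       (\<lambda>t. cov_deriv A X (\<lambda>s. F (s, t)) (\<lambda>s. l (s, t)) 0) 0 x"

text \<open>\<open>F\<close> is a smooth two-parameter family in \<open>\<O>\<close> through the Lagrangian parametrized by \<open>f\<close> with partial
  derivatives \<open>dh\<close> and \<open>dk\<close> there, and \<open>ll\<close> is a smooth family of functions along it
  extending \<open>l\<close>.\<close>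
definition curvature_family :: "('l::topological_space, real^'n::{finite,linorder}) chart set \<Rightarrow>
    ('x::topological_space, 'n) acy_data \<Rightarrow> ('l \<Rightarrow> 'x) \<Rightarrow> ('l \<Rightarrow> 'x) set set \<Rightarrow> ('l \<Rightarrow> 'x) \<Rightarrow>
    ('x \<Rightarrow> real) \<Rightarrow> ('x \<Rightarrow> real) \<Rightarrow> ('x \<Rightarrow> real) \<Rightarrow>
    (real \<times> real) set \<Rightarrow> (real \<times> real \<Rightarrow> 'l \<Rightarrow> 'x) \<Rightarrow> (real \<times> real \<Rightarrow> 'x \<Rightarrow> real) \<Rightarrow> bool" where
  "curvature_family A X f0 \<O> f h k l \<Theta> F ll \<longleftrightarrow> (0, 0) \<in> \<Theta> \<and> lag_family A X f0 \<Theta> F \<and>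
     (\<forall>\<theta>\<in>\<Theta>. lag_class A (F \<theta>) \<in> \<O>) \<and> F (0, 0) = f \<and>
     path_derivative A X (\<lambda>s. F (s, 0)) 0 h \<and> path_derivative A X (\<lambda>t. F (0, t)) 0 k \<and>
     smooth_fun_family A \<Theta> (\<lambda>\<theta>. ll \<theta> \<circ> F \<theta>) \<and>
     (\<forall>\<theta>\<in>\<Theta>. ll \<theta> \<in> ham_functions A X (lag_class A (F \<theta>))) \<and>
     (\<forall>p. ll (0, 0) (f p) = l (f p))"

text \<open>\<open>R\<close>, as a function on the Lagrangian \<open>\<Gamma>\<close>, is the value \<open>R(h,k)l\<close> of the curvature: it is obtained from
  each two-parameter family and extension of \<open>l\<close> representing \<open>h, k, l\<close>.\<close>
definition has_curvature :: "('l::topological_space, real^'n::{finite,linorder}) chart set \<Rightarrow>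
    ('x::topological_space, 'n) acy_data \<Rightarrow> ('l \<Rightarrow> 'x) \<Rightarrow> ('l \<Rightarrow> 'x) set set \<Rightarrow> ('l \<Rightarrow> 'x) \<Rightarrow>
    ('x \<Rightarrow> real) \<Rightarrow> ('x \<Rightarrow> real) \<Rightarrow> ('x \<Rightarrow> real) \<Rightarrow> ('l \<Rightarrow> real) \<Rightarrow> bool" where
  "has_curvature A X f0 \<O> f h k l R \<longleftrightarrow> (\<forall>\<Theta> F ll. curvature_family A X f0 \<O> f h k l \<Theta> F ll \<longrightarrow>
     (\<forall>p. curvature A X F ll (f p) = R p))"


section \<open>Geometry of a Lagrangian\<close>

definition lag_riem :: "('l, real^'n::finite) chart set \<Rightarrow> ('x, 'n) acy_data \<Rightarrow> ('l \<Rightarrow> 'x) \<Rightarrow>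
    ('l, real^'n, real) tensor" where
  "lag_riem A X f = pullback A (charts X) f (kmetric X)"

text \<open>The circle-valued Lagrangian angle is represented by its principal value; on a positive
  Lagrangian this lies in \<open>(-\<pi>/2, \<pi>/2)\<close> and is therefore smooth.\<close>
definition lag_angle :: "('l, real^'n::{finite,linorder}) chart set \<Rightarrow> ('x, 'n) acy_data \<Rightarrow>
    ('l \<Rightarrow> 'x) \<Rightarrow> 'l \<Rightarrow> real" where
  "lag_angle A X f p = (THE t. - pi < t \<and> t \<le> pi \<and>
     (\<forall>v. pullback A (charts X) f (hol_form X) p v =
        cis t * of_real (acy_rho X (f p) powr (real CARD('n) / 2) * vol_form (lag_riem A X f) p v)))"

end

theory Submission
  imports Defs
begin

text \<open>
  Near a point choose coordinates \<open>y\<close> on \<open>L\<close> and a complex chart of \<open>X\<close>, and let \<open>P\<close> be the matrix of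
  \<open>\<partial>F/\<partial>y\<close>. Since \<open>F\<close> is Lagrangian, \<open>P\<close> is invertible over the complex numbers, so the velocity in a
  parameter direction is \<open>P q\<close> for a complex vector field \<open>q\<close>, and \<open>F\<^sup>* \<Omega> = m dy\<^sub>1 \<and> \<dots> \<and> dy\<^sub>n\<close>. The
  horizontal field is the real field \<open>w\<close> with \<open>Re (m (q + w)) = 0\<close>, thus \<open>m (q + w) = \<i> r\<close> with \<open>r\<close> real.
  Equality of mixed derivatives of \<open>F\<close> says that the complex fields \<open>\<partial>\<^sub>s - q\<^sub>s\<close> and \<open>\<partial>\<^sub>t - q\<^sub>t\<close> commute, and
  closedness of \<open>\<Omega>\<close> says that \<open>\<partial>\<^sub>s m = div (m q\<^sub>s)\<close>. These two facts express the real part of \<open>m\<close> times the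
  curvature field \<open>\<partial>\<^sub>s w\<^sub>t - \<partial>\<^sub>t w\<^sub>s + [w\<^sub>s, w\<^sub>t]\<close> by \<open>r\<^sub>s\<close>, \<open>r\<^sub>t\<close>, \<open>\<psi> = Re (1 / m)\<close> and their \<open>y\<close>-derivatives
  alone. Finally \<open>- \<psi> r\<^sub>s\<close> and \<open>- \<psi> r\<^sub>t\<close> are the gradients of \<open>h\<close> and \<open>k\<close>, and
  \<open>1 / \<psi> = \<rho>\<^bsup>n/2\<^esup> \<surd>det G sec \<theta>\<close>, where \<open>\<bar>m\<bar>\<^sup>2 = \<rho>\<^sup>n det G\<close> comes from comparing \<open>\<omega>\<^sup>n\<close> with
  \<open>\<Omega> \<and> cnj \<Omega>\<close> on the complexification of a Lagrangian frame.
\<close>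

section \<open>Directional derivatives\<close>

text \<open>The Levi-Civita derivative differentiates functions along the horizontal lift of a
  parameter direction, so the curvature is the derivation given by the commutator of two lifts, and
  only first derivatives of \<open>l\<close> survive. The obstacle is regularity. Tangent spaces are
  identified through \<open>chart_at\<close>, a choice that may jump between neighbouring points,
  and \<open>acy_rho\<close>, \<open>lag_angle\<close>, \<open>gradient\<close> and
  \<open>horizontal_field\<close> are definite descriptions; none can be differentiated as defined.
  Near the point each is carried to one fixed pair of charts and replaced by an explicit expression:
  \<rho> is an n-th root of \<open>|m|\<^sup>2 / det G\<close>, the angle is
  \<open>Im (Ln m)\<close>. Positivity keeps \<open>m\<close> in the right half plane, which
  justifies both the principal branch and the division by \<open>Re m\<close>. The Laplacian, the
  \<open>n / (2 \<rho>)\<close> terms and the \<open>tan \<theta>\<close> terms have one common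
  source, the divergence with respect to the density \<open>1 / \<psi>\<close>. Christoffel symbols
  are never computed: they enter only through a difference in which they cancel by symmetry.\<close>

abbreviation dirderiv :: "'a::real_normed_vector \<Rightarrow> ('a \<Rightarrow> 'b::real_normed_vector) \<Rightarrow> 'a \<Rightarrow> 'b" where
  "dirderiv v f x \<equiv> frechet_derivative f (at x) v"

lemma smooth_on_differentiable:
  assumes "smooth_on S f" "x \<in> S"
  shows "f differentiable (at x)"
  using assms unfolding smooth_on_def by (meson Ck_on.simps(2))

lemma smooth_on_dirderiv:
  assumes "smooth_on S f"
  shows "smooth_on S (dirderiv v f)"
  unfolding smooth_on_def
proof
  fix k
  have "Ck_on (Suc k) S f" using assms unfolding smooth_on_def ..
  then show "Ck_on k S (dirderiv v f)" by simp
qed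

lemma smooth_on_continuous_on:
  assumes "smooth_on S f"
  shows "continuous_on S f"
  using assms unfolding smooth_on_def by (meson Ck_on.simps(1))

lemma has_derivative_frechet_derivative:
  "f differentiable (at x) \<Longrightarrow> (f has_derivative frechet_derivative f (at x)) (at x)"
  using frechet_derivative_works by blast

lemma dirderivI: "(f has_derivative D) (at x) \<Longrightarrow> dirderiv v f x = D v"
  using frechet_derivative_at by metis

lemma dirderiv_sum_dir:
  "f differentiable (at x) \<Longrightarrow> dirderiv (\<Sum>i\<in>I. c i *\<^sub>R v i) f x = (\<Sum>i\<in>I. c i *\<^sub>R dirderiv (v i) f x)"
  by (simp add: linear_sum linear_scale linear_frechet_derivative)

lemma dirderiv_cong:
  assumes "open S" "x \<in> S" "\<And>y. y \<in> S \<Longrightarrow> f y = g y"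
  shows "dirderiv v f x = dirderiv v g x"
proof (cases "f differentiable (at x)")
  case True
  have "(g has_derivative frechet_derivative f (at x)) (at x)"
    using has_derivative_transform_within_open[OF has_derivative_frechet_derivative[OF True] assms] by simp
  then show ?thesis by (simp add: dirderivI)
next
  \<comment> \<open>If \<open>f\<close> has no derivative at \<open>x\<close>, neither has
    \<open>g\<close>, and both Frechet derivatives are then the same choice from an unsatisfiable
    condition.\<close>
  case False
  have "\<not> (g has_derivative D) (at x)" for D
    using False has_derivative_transform_within_open[OF _ assms(1,2), of g D UNIV f] assms(3)
    by (metis differentiableI)
  moreover have "\<not> (f has_derivative D) (at x)" for D using False differentiableI by blast
  ultimately show ?thesis unfolding frechet_derivative_def by simp
qed

lemma differentiable_cong_open:
  assumes "open S" "x \<in> S" "\<And>y. y \<in> S \<Longrightarrow> f y = g y" "f differentiable (at x)"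
  shows "g differentiable (at x)"
  using has_derivative_transform_within_open[OF has_derivative_frechet_derivative[OF assms(4)] assms(1-3)]
  by (auto simp: differentiable_def)

lemma dirderiv_linear:
  assumes "bounded_linear L" "f differentiable (at x)"
  shows "dirderiv v (\<lambda>y. L (f y)) x = L (dirderiv v f x)"
  by (rule dirderivI) (rule bounded_linear.has_derivative[OF assms(1) has_derivative_frechet_derivative[OF assms(2)]])

lemma dirderiv_mult:
  fixes f g :: "'a::real_normed_vector \<Rightarrow> 'b::real_normed_algebra"
  assumes "f differentiable (at x)" "g differentiable (at x)"
  shows "dirderiv v (\<lambda>y. f y * g y) x = f x * dirderiv v g x + dirderiv v f x * g x"
  by (rule dirderivI) (rule has_derivative_mult[OF assms[THEN has_derivative_frechet_derivative]])

lemma dirderiv_add: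
  assumes "f differentiable (at x)" "g differentiable (at x)"
  shows "dirderiv v (\<lambda>y. f y + g y) x = dirderiv v f x + dirderiv v g x"
  by (rule dirderivI) (rule has_derivative_add[OF assms[THEN has_derivative_frechet_derivative]])

lemma dirderiv_sum:
  assumes "\<And>i. i \<in> I \<Longrightarrow> f i differentiable (at x)"
  shows "dirderiv v (\<lambda>y. \<Sum>i\<in>I. f i y) x = (\<Sum>i\<in>I. dirderiv v (f i) x)"
  by (rule dirderivI, rule has_derivative_sum) (simp add: assms has_derivative_frechet_derivative)

lemma dirderiv_real_line:
  assumes "f differentiable (at (x + t *\<^sub>R v))"
  shows "((\<lambda>\<tau>. f (x + \<tau> *\<^sub>R v)) has_vector_derivative dirderiv v f (x + t *\<^sub>R v)) (at t)"
proof -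
  have "((\<lambda>\<tau>. x + \<tau> *\<^sub>R v) has_vector_derivative v) (at t)"
    by (auto intro!: derivative_eq_intros)
  from vector_derivative_diff_chain_within[of _ _ _ UNIV, OF this
      has_derivative_at_withinI[OF has_derivative_frechet_derivative[OF assms]]]
  show ?thesis by (simp add: o_def)
qed

text \<open>The second difference \<open>\<Delta> t\<close> over the parallelogram spanned by
  \<open>t v\<close> and \<open>t w\<close> is symmetric in the two directions. Two mean value steps
  turn it into \<open>t * t\<close> times a mixed derivative at a nearby point, in either order, and
  continuity lets the points tend to \<open>x\<close>. Only iterated directional derivatives occur,
  matching the form of \<open>smooth_on\<close>.\<close>

lemma dirderiv_symmetric_real:
  fixes f :: "'a::real_normed_vector \<Rightarrow> real"
  assumes S: "open S" "x \<in> S"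
    and f: "\<And>y. y \<in> S \<Longrightarrow> f differentiable (at y)"
    and fv: "\<And>y. y \<in> S \<Longrightarrow> dirderiv v f differentiable (at y)"
    and fw: "\<And>y. y \<in> S \<Longrightarrow> dirderiv w f differentiable (at y)"
    and cvw: "continuous_on S (dirderiv w (dirderiv v f))"
    and cwv: "continuous_on S (dirderiv v (dirderiv w f))"
  shows "dirderiv w (dirderiv v f) x = dirderiv v (dirderiv w f) x"
proof -
  obtain r where r: "r > 0" "ball x r \<subseteq> S" using S openE by blast
  \<comment> \<open>Coefficients below \<open>e\<close> keep the parallelogram inside the ball; the
    summand 1 keeps the divisor positive when both directions vanish.\<close>
  define e where "e = r / (norm v + norm w + 1)"
  have npos: "norm v + norm w + 1 > 0" by (smt (verit) norm_ge_zero)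
  have e: "e > 0" unfolding e_def using r npos by simp
  have inS: "x + a *\<^sub>R v + b *\<^sub>R w \<in> S" if "\<bar>a\<bar> < e" "\<bar>b\<bar> < e" for a b
  proof -
    have "norm (a *\<^sub>R v + b *\<^sub>R w) \<le> \<bar>a\<bar> * norm v + \<bar>b\<bar> * norm w"
      by (metis norm_scaleR norm_triangle_ineq)
    also have "\<dots> \<le> e * norm v + e * norm w"
      using that by (intro add_mono mult_right_mono) auto
    also have "\<dots> < e * (norm v + norm w + 1)" using e by (simp add: algebra_simps)
    also have "\<dots> = r" unfolding e_def using npos by simp
    finally show ?thesis using r by (auto simp: dist_norm subset_iff norm_minus_commute add.assoc)
  qed
  define \<Delta> where "\<Delta> t = f (x + t *\<^sub>R v + t *\<^sub>R w) - f (x + t *\<^sub>R v) - f (x + t *\<^sub>R w) + f x" for t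
  have key: "\<exists>a b. 0 < a \<and> a < t \<and> 0 < b \<and> b < t \<and>
      g (x + t *\<^sub>R p + t *\<^sub>R q) - g (x + t *\<^sub>R p) - g (x + t *\<^sub>R q) + g x
      = t * t * dirderiv q (dirderiv p g) (x + a *\<^sub>R p + b *\<^sub>R q)"
    if t: "0 < t" "t < e"
      and inS: "\<And>a b. \<bar>a\<bar> < e \<Longrightarrow> \<bar>b\<bar> < e \<Longrightarrow> x + a *\<^sub>R p + b *\<^sub>R q \<in> S"
      and g: "\<And>y. y \<in> S \<Longrightarrow> g differentiable (at y)"
      and gp: "\<And>y. y \<in> S \<Longrightarrow> dirderiv p g differentiable (at y)" for t p q and g :: "'a \<Rightarrow> real"
  proof -
    have d1: "((\<lambda>\<tau>. g (x + \<tau> *\<^sub>R p + b *\<^sub>R q)) has_real_derivative dirderiv p g (x + a *\<^sub>R p + b *\<^sub>R q)) (at a)"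
      if "\<bar>a\<bar> < e" "\<bar>b\<bar> < e" for a b
      using dirderiv_real_line[of g "x + b *\<^sub>R q" a p] g[OF inS[OF that]]
      by (simp add: has_real_derivative_iff_has_vector_derivative algebra_simps)
    \<comment> \<open>The first mean value theorem is applied along \<open>p\<close> to the
      increment of \<open>g\<close> in direction \<open>q\<close>, the second along \<open>q\<close>
      to the derivative so obtained.\<close>
    have "\<exists>z. 0 < z \<and> z < t \<and> (g (x + t *\<^sub>R p + t *\<^sub>R q) - g (x + t *\<^sub>R p + 0 *\<^sub>R q)) - (g (x + 0 *\<^sub>R p + t *\<^sub>R q) - g (x + 0 *\<^sub>R p + 0 *\<^sub>R q))
      = (t - 0) * (dirderiv p g (x + z *\<^sub>R p + t *\<^sub>R q) - dirderiv p g (x + z *\<^sub>R p + 0 *\<^sub>R q))"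
      by (rule MVT2) (use t in \<open>auto intro!: DERIV_diff d1[of _ t] d1[of _ 0, simplified]\<close>)
    then obtain a where a: "0 < a" "a < t"
      "g (x + t *\<^sub>R p + t *\<^sub>R q) - g (x + t *\<^sub>R p) - g (x + t *\<^sub>R q) + g x
        = t * (dirderiv p g (x + a *\<^sub>R p + t *\<^sub>R q) - dirderiv p g (x + a *\<^sub>R p + 0 *\<^sub>R q))"
      by auto
    have d2: "((\<lambda>\<tau>. dirderiv p g (x + a *\<^sub>R p + \<tau> *\<^sub>R q)) has_real_derivative
         dirderiv q (dirderiv p g) (x + a *\<^sub>R p + b *\<^sub>R q)) (at b)" if "\<bar>b\<bar> < e" for b
      using dirderiv_real_line[of "dirderiv p g" "x + a *\<^sub>R p" b q] gp[OF inS[OF _ that]] a t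
      by (simp add: has_real_derivative_iff_has_vector_derivative)
    have "\<exists>z. 0 < z \<and> z < t \<and> dirderiv p g (x + a *\<^sub>R p + t *\<^sub>R q) - dirderiv p g (x + a *\<^sub>R p + 0 *\<^sub>R q)
      = (t - 0) * dirderiv q (dirderiv p g) (x + a *\<^sub>R p + z *\<^sub>R q)"
      by (rule MVT2) (use t in \<open>auto intro!: d2\<close>)
    then show ?thesis using a by auto
  qed
  have A: "\<exists>a b a' b'. \<bar>a\<bar> < t \<and> \<bar>b\<bar> < t \<and> \<bar>a'\<bar> < t \<and> \<bar>b'\<bar> < t \<and>
      dirderiv w (dirderiv v f) (x + a *\<^sub>R v + b *\<^sub>R w) = dirderiv v (dirderiv w f) (x + a' *\<^sub>R v + b' *\<^sub>R w)"
    if t: "0 < t" "t < e" for t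
  proof -
    obtain a b where 1: "0 < a" "a < t" "0 < b" "b < t" "\<Delta> t = t * t * dirderiv w (dirderiv v f) (x + a *\<^sub>R v + b *\<^sub>R w)"
      using key[OF t inS f fv] unfolding \<Delta>_def by blast
    have inS': "x + a *\<^sub>R w + b *\<^sub>R v \<in> S" if "\<bar>a\<bar> < e" "\<bar>b\<bar> < e" for a b
      using inS[OF that(2,1)] by (simp add: algebra_simps)
    obtain a' b' where 2: "0 < a'" "a' < t" "0 < b'" "b' < t" "\<Delta> t = t * t * dirderiv v (dirderiv w f) (x + a' *\<^sub>R w + b' *\<^sub>R v)"
      using key[OF t inS' f fw] unfolding \<Delta>_def by (auto simp: algebra_simps)
    show ?thesis using 1 2 t
      by (intro exI[of _ a] exI[of _ b] exI[of _ b'] exI[of _ a']) (auto simp: algebra_simps)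
  qed
  \<comment> \<open>The offset 2 makes \<open>t 0 = e / 2\<close>, so that every \<open>t n\<close>
    lies strictly below \<open>e\<close>.\<close>
  define t where "t n = e / (real n + 2)" for n :: nat
  have tn: "0 < t n" "t n < e" for n unfolding t_def using e by (auto simp: field_simps intro: add_pos_nonneg)
  have t0: "t \<longlonglongrightarrow> 0" unfolding t_def
    using LIMSEQ_ignore_initial_segment[OF tendsto_mult_left[OF lim_inverse_n', of e], of 2]
    by (simp add: field_simps)
  obtain a b a' b' where ab: "\<bar>a n\<bar> < t n" "\<bar>b n\<bar> < t n" "\<bar>a' n\<bar> < t n" "\<bar>b' n\<bar> < t n"
      "dirderiv w (dirderiv v f) (x + a n *\<^sub>R v + b n *\<^sub>R w) = dirderiv v (dirderiv w f) (x + a' n *\<^sub>R v + b' n *\<^sub>R w)" for n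
    using A[OF tn] by metis
  have lim0: "c \<longlonglongrightarrow> 0" if "\<And>n. \<bar>c n\<bar> < t n" for c
    by (rule Lim_null_comparison[OF _ t0]) (use that in \<open>auto simp: less_imp_le\<close>)
  have lim: "(\<lambda>n. x + c n *\<^sub>R v + d n *\<^sub>R w) \<longlonglongrightarrow> x" if "\<And>n. \<bar>c n\<bar> < t n" "\<And>n. \<bar>d n\<bar> < t n" for c d
    using tendsto_add[OF tendsto_add[OF tendsto_const[of x] tendsto_scaleR[OF lim0[OF that(1)] tendsto_const[of v]]]
       tendsto_scaleR[OF lim0[OF that(2)] tendsto_const[of w]]] by simp
  have cont: "(\<lambda>n. G (x + c n *\<^sub>R v + d n *\<^sub>R w)) \<longlonglongrightarrow> G x"
    if "\<And>n. \<bar>c n\<bar> < t n" "\<And>n. \<bar>d n\<bar> < t n" "continuous_on S G" for c d and G :: "'a \<Rightarrow> real"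
  proof -
    have "isCont G x" using that(3) S by (simp add: continuous_on_eq_continuous_at)
    then show ?thesis by (rule isCont_tendsto_compose[OF _ lim[OF that(1,2)]])
  qed
  from cont[OF ab(1,2) cvw] cont[OF ab(3,4) cwv] show ?thesis
    unfolding ab(5) using LIMSEQ_unique by blast
qed

text \<open>Reduced to the real case componentwise.\<close>
lemma smooth_on_dirderiv_symmetric:
  fixes f :: "'a::real_normed_vector \<Rightarrow> 'b::euclidean_space"
  assumes S: "open S" "x \<in> S" and f: "smooth_on S f"
  shows "dirderiv w (dirderiv v f) x = dirderiv v (dirderiv w f) x"
proof (rule euclidean_eqI)
  fix i :: 'b assume "i \<in> Basis"
  have bl: "bounded_linear (\<lambda>y::'b. y \<bullet> i)" by (rule bounded_linear_inner_left)
  have dd: "dirderiv u (\<lambda>y. g y \<bullet> i) y = dirderiv u g y \<bullet> i" if "smooth_on S g" "y \<in> S" for u y and g :: "'a \<Rightarrow> 'b"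
    by (rule dirderiv_linear[OF bl smooth_on_differentiable[OF that]])
  have d1: "(\<lambda>y. g y \<bullet> i) differentiable (at y)" if "smooth_on S g" "y \<in> S" for y and g :: "'a \<Rightarrow> 'b"
    by (rule differentiableI[OF bounded_linear.has_derivative[OF bl
          has_derivative_frechet_derivative[OF smooth_on_differentiable[OF that]]]])
  have d2: "dirderiv u (\<lambda>y. f y \<bullet> i) differentiable (at y)" if "y \<in> S" for y u
    by (rule differentiable_cong_open[OF S(1) that _ d1[OF smooth_on_dirderiv[OF f, of u] that]]) (simp add: dd f)
  have e: "dirderiv u' (dirderiv u (\<lambda>y. f y \<bullet> i)) y = dirderiv u' (dirderiv u f) y \<bullet> i" if "y \<in> S" for u u' y
    using dd[OF smooth_on_dirderiv[OF f, of u] that, of u'] dirderiv_cong[OF S(1) that dd[OF f], where v = u'] by simp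
  have c: "continuous_on S (dirderiv u' (dirderiv u (\<lambda>y. f y \<bullet> i)))" for u u'
  proof -
    have "continuous_on S (\<lambda>y. dirderiv u' (dirderiv u f) y \<bullet> i)"
      by (intro continuous_intros smooth_on_continuous_on smooth_on_dirderiv f)
    then show ?thesis by (rule continuous_on_eq) (simp add: e)
  qed
  have "dirderiv w (dirderiv v (\<lambda>y. f y \<bullet> i)) x = dirderiv v (dirderiv w (\<lambda>y. f y \<bullet> i)) x"
    by (rule dirderiv_symmetric_real[OF S d1[OF f] d2 d2 c c])
  then show "dirderiv w (dirderiv v f) x \<bullet> i = dirderiv v (dirderiv w f) x \<bullet> i"
    using e[OF S(2)] by simp
qed

section \<open>Alternating forms and determinants\<close>

text \<open>Unlike \<open>alternating\<close>, this asks for no linearity and no vector space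
  structure on the entries, so it also covers families of functionals as in
  \<open>alt_on_asymform\<close>. Multilinearity is supplied separately in
  \<open>alt_on_expand\<close>.\<close>

definition alt_on :: "nat \<Rightarrow> ((nat \<Rightarrow> 'v) \<Rightarrow> 's::field_char_0) \<Rightarrow> bool" where
  "alt_on N \<alpha> \<longleftrightarrow> (\<forall>v w. (\<forall>i<N. v i = w i) \<longrightarrow> \<alpha> v = \<alpha> w) \<and>
     (\<forall>v i j. i < N \<longrightarrow> j < N \<longrightarrow> i \<noteq> j \<longrightarrow> \<alpha> (v \<circ> Transposition.transpose i j) = - \<alpha> v)"

lemma alt_on_cong: "alt_on N \<alpha> \<Longrightarrow> (\<And>i. i < N \<Longrightarrow> v i = w i) \<Longrightarrow> \<alpha> v = \<alpha> w"
  unfolding alt_on_def by blast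

lemma alt_on_swap:
  "alt_on N \<alpha> \<Longrightarrow> i < N \<Longrightarrow> j < N \<Longrightarrow> i \<noteq> j \<Longrightarrow> \<alpha> (v \<circ> Transposition.transpose i j) = - \<alpha> v"
  unfolding alt_on_def by blast

lemma alt_on_permutes:
  assumes "alt_on N \<alpha>" "\<tau> permutes {..<N}"
  shows "\<alpha> (v \<circ> \<tau>) = of_int (sign \<tau>) * \<alpha> v"
  using assms(2) finite_lessThan
proof (induction arbitrary: v rule: permutes_induct)
  case id
  then show ?case by simp
next
  case (swap a b p)
  have "sign (Transposition.transpose a b \<circ> p) = - sign p"
    using swap by (subst sign_compose) (auto simp: sign_swap_id permutation_swap_id permutes_imp_permutation[OF finite_lessThan])
  moreover have "\<alpha> (v \<circ> (Transposition.transpose a b \<circ> p)) = of_int (sign p) * \<alpha> (v \<circ> Transposition.transpose a b)"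
    using swap.IH[of "v \<circ> Transposition.transpose a b"] by (simp add: o_def)
  moreover have "\<alpha> (v \<circ> Transposition.transpose a b) = - \<alpha> v"
    using alt_on_swap[OF assms(1)] swap.hyps by blast
  ultimately show ?case by (simp only:) simp
qed

lemma alt_on_repeat:
  assumes "alt_on N \<alpha>" "i < N" "j < N" "i \<noteq> j" "v i = v j"
  shows "\<alpha> v = 0"
proof -
  have "v \<circ> Transposition.transpose i j = v"
    using assms(5) by (auto simp: fun_eq_iff Transposition.transpose_def)
  then show ?thesis using alt_on_swap[OF assms(1-4), of v] by simp
qed

text \<open>The cyclic move of entry \<open>i\<close> to the front is a product of \<open>i\<close>
  transpositions; the induction performs them as swaps of position 0 with positions 1 to
  \<open>i\<close>.\<close>

lemma alt_on_shift:
  assumes "alt_on N \<alpha>" "i < N"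
  shows "\<alpha> (\<lambda>j. if j = 0 then v i else if j \<le> i then v (j - 1) else v j) = (-1) ^ i * \<alpha> v"
  using assms(2)
proof (induction i)
  case 0
  have "(\<lambda>j. if j = 0 then v 0 else if j \<le> 0 then v (j - 1) else v j) = v" by auto
  then show ?case by simp
next
  case (Suc i)
  let ?f = "\<lambda>i j. if j = 0 then v i else if j \<le> i then v (j - 1) else v j"
  have "?f (Suc i) = ?f i \<circ> Transposition.transpose 0 (Suc i)"
    by (auto simp: fun_eq_iff Transposition.transpose_def)
  then show ?case using alt_on_swap[OF assms(1), of 0 "Suc i" "?f i"] Suc by simp
qed

text \<open>Expanding slot by slot leaves a sum over choices of one \<open>e j\<close> per slot;
  alternation kills repeated choices and turns the others into signed permutations.
  \<open>comb\<close> is an arbitrary map from coefficients, so the same lemma expands real or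
  complex combinations of vectors and combinations of functionals.\<close>

lemma alt_on_expand:
  fixes \<alpha> :: "(nat \<Rightarrow> 'v) \<Rightarrow> 's::field_char_0"
  assumes alt: "alt_on N \<alpha>"
    and lin: "\<And>v i c. i < N \<Longrightarrow> \<alpha> (v(i := comb c)) = (\<Sum>j<N. c j * \<alpha> (v(i := e j)))"
  shows "\<alpha> (\<lambda>i. comb (z i)) = (\<Sum>\<tau> | \<tau> permutes {..<N}. of_int (sign \<tau>) * (\<Prod>i<N. z i (\<tau> i))) * \<alpha> e"
proof -
  \<comment> \<open>Choices for the first \<open>k\<close> slots, extended by the identity so that
    for \<open>k = N\<close> the injective ones are literally the permutations of
    \<open>{..<N}\<close>.\<close>
  let ?F = "\<lambda>k. {g. (\<forall>i<k. g i < N) \<and> (\<forall>i. \<not> i < k \<longrightarrow> g i = i)}"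
  have fin: "finite (?F k)" for k
  proof (rule finite_subset)
    let ?ext = "\<lambda>g i. if i < k then g i else i"
    show "?F k \<subseteq> ?ext ` (PiE {..<k} (\<lambda>_. {..<N}))"
    proof
      fix g assume g: "g \<in> ?F k"
      then have "restrict g {..<k} \<in> PiE {..<k} (\<lambda>_. {..<N})" "g = ?ext (restrict g {..<k})" by auto
      then show "g \<in> ?ext ` (PiE {..<k} (\<lambda>_. {..<N}))" by blast
    qed
    show "finite (?ext ` (PiE {..<k} (\<lambda>_. {..<N})))" by (intro finite_imageI finite_PiE) auto
  qed
  have *: "\<alpha> (\<lambda>i. comb (z i)) = (\<Sum>g\<in>?F k. (\<Prod>i<k. z i (g i)) * \<alpha> (\<lambda>i. if i < k then e (g i) else comb (z i)))"
    if "k \<le> N" for k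
    using that
  proof (induction k)
    case 0
    have "?F 0 = {\<lambda>i. i}" by auto
    then show ?case by simp
  next
    case (Suc k)
    let ?w = "\<lambda>k g i. if i < k then e (g i) else comb (z i)"
    have "(\<Prod>i<k. z i (g i)) * \<alpha> (?w k g) = (\<Sum>j<N. (\<Prod>i<k. z i (g i)) * z k j * \<alpha> ((?w k g)(k := e j)))" for g
    proof -
      have "\<alpha> (?w k g) = \<alpha> ((?w k g)(k := comb (z k)))" by (rule arg_cong[where f = \<alpha>]) auto
      also have "\<dots> = (\<Sum>j<N. z k j * \<alpha> ((?w k g)(k := e j)))"
        by (rule lin) (use Suc.prems in simp)
      finally show ?thesis by (simp only: sum_distrib_left mult.assoc)
    qed
    then have "\<alpha> (\<lambda>i. comb (z i)) = (\<Sum>(g, j)\<in>?F k \<times> {..<N}. (\<Prod>i<k. z i (g i)) * z k j * \<alpha> ((?w k g)(k := e j)))"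
      using Suc by (simp add: sum.cartesian_product)
    also have "\<dots> = (\<Sum>g\<in>?F (Suc k). (\<Prod>i<Suc k. z i (g i)) * \<alpha> (?w (Suc k) g))"
    proof (rule sum.reindex_bij_witness[where i = "\<lambda>g. (g(k := k), g k)" and j = "\<lambda>(g, j). g(k := j)"], goal_cases)
      case (1 a)
      then show ?case by (auto simp: fun_eq_iff)
    next
      case (2 a)
      then show ?case by (auto simp: less_Suc_eq)
    next
      case (3 g)
      then show ?case by simp
    next
      case (4 g)
      have "(g(k := k)) i = i" if "\<not> i < k" for i using 4 that by (cases "i = k") auto
      then show ?case using 4 by auto
    next
      case (5 a)
      obtain g j where a: "a = (g, j)" by force
      have "(?w k g)(k := e j) = ?w (Suc k) (g(k := j))" by (auto simp: fun_eq_iff)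
      then show ?case unfolding a by (simp cong: if_cong)
    qed
    finally show ?case .
  qed
  have "\<alpha> (\<lambda>i. comb (z i)) = (\<Sum>g\<in>?F N. (\<Prod>i<N. z i (g i)) * \<alpha> (e \<circ> g))"
    unfolding *[OF order_refl]
    by (intro sum.cong refl arg_cong2[where f = "(*)"] alt_on_cong[OF alt]) auto
  also have "\<dots> = (\<Sum>g | g permutes {..<N}. (\<Prod>i<N. z i (g i)) * \<alpha> (e \<circ> g))"
  proof (rule sum.mono_neutral_right[OF fin])
    show "{g. g permutes {..<N}} \<subseteq> ?F N"
    proof
      fix g assume "g \<in> {g. g permutes {..<N}}"
      then have g: "g permutes {..<N}" by simp
      have "g i < N" if "i < N" for i using permutes_in_image[OF g, of i] that by simp
      moreover have "g i = i" if "\<not> i < N" for i using permutes_not_in[OF g, of i] that by simp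
      ultimately show "g \<in> ?F N" by simp
    qed
    show "\<forall>g\<in>?F N - {g. g permutes {..<N}}. (\<Prod>i<N. z i (g i)) * \<alpha> (e \<circ> g) = 0"
    proof
      fix g assume g: "g \<in> ?F N - {g. g permutes {..<N}}"
      have "\<not> inj_on g {..<N}"
      proof
        assume inj: "inj_on g {..<N}"
        have "g ` {..<N} \<subseteq> {..<N}" using g by auto
        then have "bij_betw g {..<N} {..<N}" using inj by (simp add: bij_betw_def endo_inj_surj)
        then have "g permutes {..<N}" using g by (intro bij_imp_permutes) auto
        then show False using g by simp
      qed
      then obtain i j where "i < N" "j < N" "i \<noteq> j" "g i = g j" by (auto simp: inj_on_def)
      then have "\<alpha> (e \<circ> g) = 0" using alt_on_repeat[OF alt, of i j "e \<circ> g"] by simp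
      then show "(\<Prod>i<N. z i (g i)) * \<alpha> (e \<circ> g) = 0" by simp
    qed
  qed
  also have "\<dots> = (\<Sum>g | g permutes {..<N}. of_int (sign g) * (\<Prod>i<N. z i (g i)) * \<alpha> e)"
    by (intro sum.cong refl) (simp add: alt_on_permutes[OF alt] mult_ac)
  finally show ?thesis by (simp add: sum_distrib_right)
qed

text \<open>The exterior product of \<open>\<phi> 0\<close>, ..., \<open>\<phi> (N - 1)\<close>,
  that is, the determinant of the values \<open>\<phi> i (v j)\<close>.\<close>

definition asymform :: "nat \<Rightarrow> (nat \<Rightarrow> 'v \<Rightarrow> 's::field_char_0) \<Rightarrow> (nat \<Rightarrow> 'v) \<Rightarrow> 's" where
  "asymform N \<phi> v = (\<Sum>\<sigma> | \<sigma> permutes {..<N}. of_int (sign \<sigma>) * (\<Prod>i<N. \<phi> i (v (\<sigma> i))))"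

text \<open>The antisymmetry is in the functionals with the arguments fixed, which is what
  reordering and expanding the factors of a wedge product requires.\<close>

lemma alt_on_asymform: "alt_on N (\<lambda>\<phi>. asymform N \<phi> v)"
  unfolding alt_on_def
proof (intro conjI allI impI)
  fix \<phi> \<psi> :: "nat \<Rightarrow> 'a \<Rightarrow> 'b" assume "\<forall>i<N. \<phi> i = \<psi> i"
  then show "asymform N \<phi> v = asymform N \<psi> v" unfolding asymform_def by simp
next
  fix \<phi> :: "nat \<Rightarrow> 'a \<Rightarrow> 'b" and i j assume ij: "i < N" "j < N" "i \<noteq> j"
  let ?t = "Transposition.transpose i j"
  have t: "?t permutes {..<N}" using ij by (simp add: permutes_swap_id)
  have "asymform N (\<phi> \<circ> ?t) v = (\<Sum>\<sigma> | \<sigma> permutes {..<N}. of_int (sign (\<sigma> \<circ> ?t)) * (\<Prod>k<N. \<phi> (?t k) (v (\<sigma> (?t k)))))"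
    unfolding asymform_def by (subst sum_permutations_compose_right[OF t]) simp
  also have "\<dots> = (\<Sum>\<sigma> | \<sigma> permutes {..<N}. - (of_int (sign \<sigma>) * (\<Prod>k<N. \<phi> k (v (\<sigma> k)))))"
  proof (rule sum.cong[OF refl])
    fix \<sigma> assume "\<sigma> \<in> {\<sigma>. \<sigma> permutes {..<N}}"
    then have "sign (\<sigma> \<circ> ?t) = - sign \<sigma>"
      using ij by (subst sign_compose) (auto simp: sign_swap_id permutation_swap_id permutes_imp_permutation[OF finite_lessThan])
    moreover have "(\<Prod>k<N. \<phi> (?t k) (v (\<sigma> (?t k)))) = (\<Prod>k<N. \<phi> k (v (\<sigma> k)))"
      using prod.permute[OF t, of "\<lambda>k. \<phi> k (v (\<sigma> k))"] by (simp add: o_def)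
    ultimately show "of_int (sign (\<sigma> \<circ> ?t)) * (\<Prod>k<N. \<phi> (?t k) (v (\<sigma> (?t k)))) = - (of_int (sign \<sigma>) * (\<Prod>k<N. \<phi> k (v (\<sigma> k))))"
      by simp
  qed
  finally show "asymform N (\<phi> \<circ> ?t) v = - asymform N \<phi> v" by (simp add: asymform_def sum_negf)
qed

text \<open>The two inner permutations act on separate blocks and can be absorbed into the outer
  one, so all \<open>fact k * fact m\<close> pairs contribute the same sum; this cancels the
  normalisation of \<open>wedge\<close>.\<close>

lemma wedge_asymform:
  fixes \<phi> \<psi> :: "nat \<Rightarrow> 'v \<Rightarrow> 's::{real_normed_field, field_char_0}"
  shows "wedge k m (asymform k \<phi>) (asymform m \<psi>) v = asymform (k + m) (\<lambda>i. if i < k then \<phi> i else \<psi> (i - k)) v"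
proof -
  let ?\<chi> = "\<lambda>i. if i < k then \<phi> i else \<psi> (i - k)"
  let ?P = "\<lambda>n. {\<tau>. \<tau> permutes {..<n}}"
  define sh where "sh \<tau>' = map_permutation {..<m} ((+) k) \<tau>'" for \<tau>' :: "nat \<Rightarrow> nat"
  have img: "(+) k ` {..<m} = {k..<k + m}"
    using image_add_atLeastLessThan[of k 0 m] by (simp add: lessThan_atLeast0 add.commute)
  have sh: "sh \<tau>' permutes {k..<k + m}" "sign (sh \<tau>') = sign \<tau>'" "\<And>i. i < m \<Longrightarrow> sh \<tau>' (k + i) = k + \<tau>' i"
    if "\<tau>' permutes {..<m}" for \<tau>'
  proof -
    show "sh \<tau>' permutes {k..<k + m}" unfolding sh_def
      by (rule map_permutation_permutes[OF _ that]) (auto simp: bij_betw_def img)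
    show "sign (sh \<tau>') = sign \<tau>'" unfolding sh_def by (rule sign_map_permutation[OF _ that]) auto
    show "sh \<tau>' (k + i) = k + \<tau>' i" if "i < m" for i
      using that by (auto simp: sh_def map_permutation_def restrict_id_def img inv_into_f_f)
  qed
  have one: "(\<Sum>\<sigma>\<in>?P (k + m). of_int (sign \<sigma>) * (of_int (sign \<tau>) * (\<Prod>i<k. \<phi> i (v (\<sigma> (\<tau> i)))))
        * (of_int (sign \<tau>') * (\<Prod>i<m. \<psi> i (v (\<sigma> (k + \<tau>' i)))))) = asymform (k + m) ?\<chi> v"
    if t: "\<tau> permutes {..<k}" and t': "\<tau>' permutes {..<m}" for \<tau> \<tau>'
  proof -
    define \<pi> where "\<pi> = \<tau> \<circ> sh \<tau>'"
    have p1: "\<tau> permutes {..<k + m}" using t by (rule permutes_subset) auto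
    have p2: "sh \<tau>' permutes {..<k + m}" using sh(1)[OF t'] by (rule permutes_subset) auto
    have p: "\<pi> permutes {..<k + m}" unfolding \<pi>_def using p2 p1 by (rule permutes_compose)
    have s: "sign \<pi> = sign \<tau> * sign \<tau>'" unfolding \<pi>_def
      using p1 p2 sh(2)[OF t'] by (simp add: sign_compose permutes_imp_permutation[OF finite_lessThan])
    have pi1: "\<pi> i = \<tau> i" if "i < k" for i
      using that sh(1)[OF t'] by (simp add: \<pi>_def permutes_not_in)
    have pi2: "\<pi> (k + i) = k + \<tau>' i" if "i < m" for i
      using that sh(3)[OF t' that] t permutes_not_in[of \<tau> "{..<k}" "k + \<tau>' i"] by (simp add: \<pi>_def)
    have pr: "(\<Prod>i<k. \<phi> i (v (\<sigma> (\<tau> i)))) * (\<Prod>i<m. \<psi> i (v (\<sigma> (k + \<tau>' i)))) = (\<Prod>i<k+m. ?\<chi> i (v ((\<sigma> \<circ> \<pi>) i)))" for \<sigma> :: "nat \<Rightarrow> nat"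
    proof -
      have "{..<k + m} = {..<k} \<union> (+) k ` {..<m}" unfolding img by auto
      then have "(\<Prod>i<k+m. ?\<chi> i (v ((\<sigma> \<circ> \<pi>) i))) = (\<Prod>i<k. ?\<chi> i (v ((\<sigma> \<circ> \<pi>) i))) * (\<Prod>i\<in>(+) k ` {..<m}. ?\<chi> i (v ((\<sigma> \<circ> \<pi>) i)))"
        by (simp add: prod.union_disjoint img Int_def)
      also have "(\<Prod>i\<in>(+) k ` {..<m}. ?\<chi> i (v ((\<sigma> \<circ> \<pi>) i))) = (\<Prod>i<m. \<psi> i (v (\<sigma> (k + \<tau>' i))))"
        by (subst prod.reindex) (auto simp: pi2 intro!: prod.cong)
      finally show ?thesis by (simp add: pi1)
    qed
    have "asymform (k + m) ?\<chi> v = (\<Sum>\<sigma>\<in>?P (k + m). of_int (sign (\<sigma> \<circ> \<pi>)) * (\<Prod>i<k+m. ?\<chi> i (v ((\<sigma> \<circ> \<pi>) i))))"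
      unfolding asymform_def by (rule sum_permutations_compose_right[OF p])
    also have "\<dots> = (\<Sum>\<sigma>\<in>?P (k + m). of_int (sign \<sigma>) * (of_int (sign \<tau>) * (\<Prod>i<k. \<phi> i (v (\<sigma> (\<tau> i)))))
        * (of_int (sign \<tau>') * (\<Prod>i<m. \<psi> i (v (\<sigma> (k + \<tau>' i))))))"
    proof (rule sum.cong[OF refl])
      fix \<sigma> assume "\<sigma> \<in> ?P (k + m)"
      then have "sign (\<sigma> \<circ> \<pi>) = sign \<sigma> * (sign \<tau> * sign \<tau>')"
        using p s by (simp add: sign_compose permutes_imp_permutation[OF finite_lessThan])
      then show "of_int (sign (\<sigma> \<circ> \<pi>)) * (\<Prod>i<k+m. ?\<chi> i (v ((\<sigma> \<circ> \<pi>) i))) =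
         of_int (sign \<sigma>) * (of_int (sign \<tau>) * (\<Prod>i<k. \<phi> i (v (\<sigma> (\<tau> i)))))
        * (of_int (sign \<tau>') * (\<Prod>i<m. \<psi> i (v (\<sigma> (k + \<tau>' i)))))"
        unfolding pr[symmetric] by simp
    qed
    finally show ?thesis by simp
  qed
  have "(\<Sum>\<sigma>\<in>?P (k + m). of_int (sign \<sigma>) * asymform k \<phi> (\<lambda>i. v (\<sigma> i)) * asymform m \<psi> (\<lambda>i. v (\<sigma> (k + i))))
    = (\<Sum>\<sigma>\<in>?P (k + m). \<Sum>\<tau>'\<in>?P m. \<Sum>\<tau>\<in>?P k. of_int (sign \<sigma>) * (of_int (sign \<tau>) * (\<Prod>i<k. \<phi> i (v (\<sigma> (\<tau> i)))))
        * (of_int (sign \<tau>') * (\<Prod>i<m. \<psi> i (v (\<sigma> (k + \<tau>' i))))))"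
    unfolding asymform_def sum_distrib_left sum_distrib_right ..
  also have "\<dots> = (\<Sum>\<tau>'\<in>?P m. \<Sum>\<tau>\<in>?P k. \<Sum>\<sigma>\<in>?P (k + m). of_int (sign \<sigma>) * (of_int (sign \<tau>) * (\<Prod>i<k. \<phi> i (v (\<sigma> (\<tau> i)))))
        * (of_int (sign \<tau>') * (\<Prod>i<m. \<psi> i (v (\<sigma> (k + \<tau>' i))))))"
    by (subst sum.swap, rule sum.cong[OF refl], rule sum.swap)
  also have "\<dots> = (\<Sum>\<tau>'\<in>?P m. \<Sum>\<tau>\<in>?P k. asymform (k + m) ?\<chi> v)"
    by (intro sum.cong refl one) auto
  also have "\<dots> = fact k * fact m * asymform (k + m) ?\<chi> v"
    by (simp add: card_permutations)
  finally show ?thesis unfolding wedge_def by simp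
qed

section \<open>Numbering of coordinates and the determinant as a top degree form\<close>

definition index_of :: "'n::{finite,linorder} \<Rightarrow> nat" where
  "index_of a = card {..<a}"

lemma index_of_less: "index_of (a :: 'n::{finite,linorder}) < CARD('n)"
  unfolding index_of_def by (rule psubset_card_mono) auto

lemma index_of_mono: "(a :: 'n::{finite,linorder}) < b \<Longrightarrow> index_of a < index_of b"
  unfolding index_of_def by (rule psubset_card_mono) auto

lemma inj_index_of: "inj (index_of :: 'n::{finite,linorder} \<Rightarrow> nat)"
  by (rule injI) (metis index_of_mono less_irrefl linorder_neqE)

lemma index_of_eq_iff [simp]: "index_of a = index_of b \<longleftrightarrow> (a :: 'n::{finite,linorder}) = b"
  using inj_index_of by (auto dest: injD)

lemma bij_index_of: "bij_betw index_of (UNIV :: 'n::{finite,linorder} set) {..<CARD('n)}"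
proof -
  have "index_of ` (UNIV :: 'n set) = {..<CARD('n)}"
    by (rule card_subset_eq) (auto simp: index_of_less card_image[OF inj_index_of])
  then show ?thesis using inj_index_of by (simp add: bij_betw_def)
qed

definition of_index :: "nat \<Rightarrow> 'n::{finite,linorder}" where
  "of_index = inv index_of"

lemma of_index_index_of [simp]: "of_index (index_of a) = a"
  by (simp add: of_index_def inj_index_of)

lemma index_of_of_index [simp]:
  assumes "i < CARD('n)"
  shows "index_of (of_index i :: 'n::{finite,linorder}) = i"
proof -
  have "i \<in> range (index_of :: 'n \<Rightarrow> nat)" using bij_index_of[where 'n = 'n] assms by (simp add: bij_betw_def)
  then show ?thesis by (simp add: of_index_def f_inv_into_f)
qed

lemma sum_index_of: "(\<Sum>i<CARD('n). g i) = (\<Sum>a\<in>UNIV. g (index_of (a :: 'n::{finite,linorder})))"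
  by (rule sum.reindex_bij_betw[OF bij_index_of, symmetric])

text \<open>\<open>std_frame\<close> over arbitrary coefficients; the complex version is needed on
  the tangent spaces of \<open>X\<close>.\<close>

definition sframe :: "nat \<Rightarrow> ('a::zero_neq_one, 'n::{finite,linorder}) vec" where
  "sframe i = (\<chi> a. if index_of a = i then 1 else 0)"

lemma std_frame_eq: "std_frame = sframe"
  by (auto simp: std_frame_def sframe_def index_of_def fun_eq_iff)

lemma sframe_index_of: "sframe (index_of b) = axis b 1"
  by (auto simp: sframe_def axis_def vec_eq_iff)

definition detform :: "(nat \<Rightarrow> ('a::field_char_0, 'n::{finite,linorder}) vec) \<Rightarrow> 'a" where
  "detform v = det (\<chi> a b. v (index_of b) $ a)"

lemma detform_rows:
  "detform (v :: nat \<Rightarrow> ('a::field_char_0, 'n::{finite,linorder}) vec) = det (\<chi> b. v (index_of b))"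
  unfolding detform_def by (subst det_transpose[symmetric]) (simp add: transpose_def)

lemma detform_sframe: "detform (sframe :: nat \<Rightarrow> ('a::field_char_0, 'n::{finite,linorder}) vec) = 1"
proof -
  have "(\<chi> (b :: 'n). sframe (index_of b)) = (mat 1 :: (('a, 'n) vec, 'n) vec)"
    by (auto simp: vec_eq_iff mat_def sframe_def)
  then show ?thesis by (simp add: detform_rows)
qed

lemma alt_on_detform: "alt_on CARD('n) (detform :: (nat \<Rightarrow> ('a::field_char_0, 'n::{finite,linorder}) vec) \<Rightarrow> 'a)"
  unfolding alt_on_def
proof (intro conjI allI impI)
  fix v w :: "nat \<Rightarrow> ('a, 'n) vec" assume "\<forall>i<CARD('n). v i = w i"
  then show "detform v = detform w" unfolding detform_def by (simp add: index_of_less)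
next
  fix v :: "nat \<Rightarrow> ('a, 'n) vec" and i j assume ij: "i < CARD('n)" "j < CARD('n)" "i \<noteq> j"
  let ?p = "Transposition.transpose (of_index i) (of_index j :: 'n)"
  have "of_index i \<noteq> (of_index j :: 'n)" using ij by (metis index_of_of_index)
  then have s: "sign ?p = -1" by (simp add: sign_swap_id)
  have "index_of (?p b) = Transposition.transpose i j (index_of b)" for b
    using ij by (auto simp: Transposition.transpose_def)
  then have "detform (v \<circ> Transposition.transpose i j) = det (\<chi> a b. (\<chi> a b. v (index_of b) $ a) $ a $ ?p b)"
    by (simp add: detform_def)
  also have "\<dots> = of_int (sign ?p) * detform v"
    unfolding detform_def by (rule det_permute_columns) (simp add: permutes_swap_id)
  finally show "detform (v \<circ> Transposition.transpose i j) = - detform v" using s by simp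
qed

lemma detform_lincomb:
  fixes v :: "nat \<Rightarrow> ('a::field_char_0, 'n::{finite,linorder}) vec"
  assumes "i < CARD('n)" "finite S"
  shows "detform (v(i := (\<Sum>j\<in>S. c j *s e j))) = (\<Sum>j\<in>S. c j * detform (v(i := e j)))"
proof -
  let ?k = "of_index i :: 'n"
  have *: "detform (v(i := x)) = det (\<chi> b. if b = ?k then x else v (index_of b))" for x
    unfolding detform_rows using assms by (intro arg_cong[where f = det]) (auto simp: vec_eq_iff)
  show ?thesis unfolding *
    using det_linear_row_sum[OF assms(2), of ?k "\<lambda>_ j. c j *s e j" "\<lambda>b. v (index_of b)"]
    by (simp add: det_row_mul)
qed

lemma sframe_expansion: "(\<Sum>j<CARD('n). x $ of_index j *s sframe j) = (x :: ('a::field, 'n::{finite,linorder}) vec)"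
  unfolding sum_index_of of_index_index_of by (auto simp: vec_eq_iff sframe_def if_distrib cong: if_cong)

lemma detform_mult:
  fixes M :: "(('a::field_char_0, 'n) vec, 'n::{finite,linorder}) vec"
  shows "detform (\<lambda>i. M *v v i) = det M * detform v"
proof -
  have "(\<chi> a (b :: 'n). (M *v v (index_of b)) $ a) = M ** (\<chi> a b. v (index_of b) $ a)"
    by (simp add: vec_eq_iff matrix_matrix_mult_def matrix_vector_mult_def)
  then show ?thesis by (simp add: detform_def det_mul)
qed

lemma detform_case_nat_expand:
  fixes u :: "('a::field_char_0, 'n::{finite,linorder}) vec"
  shows "detform (case_nat u \<eta>) = (\<Sum>j<CARD('n). u $ of_index j * detform (case_nat (sframe j) \<eta>))"
proof -
  have e: "case_nat x \<eta> = (case_nat 0 \<eta>)(0 := x)" for x by (auto simp: fun_eq_iff split: nat.split)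
  have "detform (case_nat u \<eta>) = detform ((case_nat 0 \<eta>)(0 := (\<Sum>j<CARD('n). u $ of_index j *s sframe j)))"
    unfolding sframe_expansion by (rule arg_cong[OF e])
  also have "\<dots> = (\<Sum>j<CARD('n). u $ of_index j * detform ((case_nat 0 \<eta>)(0 := sframe j)))"
    by (rule detform_lincomb) auto
  finally show ?thesis unfolding e[symmetric] .
qed

text \<open>Only the coefficient of the omitted frame vector contributes, since any other one
  repeats an entry; restoring the order of the frame costs the sign. This is why the exterior
  derivative of a contracted volume form is a divergence.\<close>

lemma detform_contract_sframe:
  fixes u :: "('a::field_char_0, 'n::{finite,linorder}) vec"
  assumes i: "i < CARD('n)"
  shows "detform (case_nat u (\<lambda>j. sframe (if j < i then j else Suc j))) = (-1) ^ i * u $ of_index i"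
proof -
  let ?\<eta> = "\<lambda>j. sframe (if j < i then j else Suc j) :: ('a, 'n) vec"
  have "detform (case_nat u ?\<eta>) = (\<Sum>j<CARD('n). u $ of_index j * detform (case_nat (sframe j) ?\<eta>))"
    by (rule detform_case_nat_expand)
  also have "\<dots> = (\<Sum>j<CARD('n). if j = i then u $ of_index i * (-1) ^ i else 0)"
  proof (rule sum.cong[OF refl])
    fix j assume j: "j \<in> {..<CARD('n)}"
    show "u $ of_index j * detform (case_nat (sframe j) ?\<eta>) = (if j = i then u $ of_index i * (-1) ^ i else 0)"
    proof (cases "j = i")
      case True
      have "case_nat (sframe i) ?\<eta> = (\<lambda>p. if p = 0 then sframe i else if p \<le> i then sframe (p - 1) else sframe p)"
        by (auto simp: fun_eq_iff split: nat.split)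
      then show ?thesis using True alt_on_shift[OF alt_on_detform i, of "sframe :: nat \<Rightarrow> ('a, 'n) vec"] by (simp add: detform_sframe)
    next
      case False
      \<comment> \<open>The position of the second copy of \<open>sframe j\<close>: one is added for
        the entry in front, and entries after the gap are moved down by one.\<close>
      let ?p = "Suc (if j < i then j else j - 1)"
      have "?p < CARD('n)" using j i False by auto
      moreover have "case_nat (sframe j) ?\<eta> 0 = case_nat (sframe j) ?\<eta> ?p" using False by auto
      ultimately have "detform (case_nat (sframe j) ?\<eta>) = 0" by (intro alt_on_repeat[OF alt_on_detform, of 0 ?p]) auto
      then show ?thesis using False by simp
    qed
  qed
  also have "\<dots> = (-1) ^ i * u $ of_index i" using i by simp
  finally show ?thesis .
qed

text \<open>Bilinearity turns vanishing on repeated arguments into antisymmetry.\<close>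
lemma alternating_imp_alt_on:
  fixes \<alpha> :: "(nat \<Rightarrow> 'v::real_vector) \<Rightarrow> 's::real_normed_field"
  assumes "alternating N \<alpha>"
  shows "alt_on N \<alpha>"
  unfolding alt_on_def
proof (intro conjI allI impI)
  fix v w :: "nat \<Rightarrow> 'v" assume "\<forall>i<N. v i = w i"
  then show "\<alpha> v = \<alpha> w" using assms unfolding alternating_def by blast
next
  fix v :: "nat \<Rightarrow> 'v" and i j assume ij: "i < N" "j < N" "i \<noteq> j"
  have add: "\<alpha> (w(p := x + y)) = \<alpha> (w(p := x)) + \<alpha> (w(p := y))" if "p < N" for w p x y
  proof -
    have "linear (\<lambda>x. \<alpha> (w(p := x)))" using assms that unfolding alternating_def by blast
    from linear_add[OF this] show ?thesis .
  qed
  have zero: "\<alpha> (v(i := x, j := x)) = 0" for x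
    using assms ij unfolding alternating_def by (auto simp: fun_upd_def)
  let ?f = "\<lambda>x y. \<alpha> (v(i := x, j := y))"
  have a1: "?f x (y + z) = ?f x y + ?f x z" for x y z using add[OF ij(2), of "v(i := x)"] by simp
  have a2: "?f (x + y) z = ?f x z + ?f y z" for x y z
    using add[OF ij(1), of "v(j := z)" x y] ij(3) by (simp add: fun_upd_twist)
  have "?f (v i + v j) (v i + v j) = ?f (v i) (v i) + ?f (v j) (v i) + (?f (v i) (v j) + ?f (v j) (v j))"
    by (simp only: a1 a2)
  then have "?f (v i) (v j) + ?f (v j) (v i) = 0" unfolding zero by (simp only: add_0 add_0_right add.commute)
  moreover have "v(i := v i, j := v j) = v" by simp
  moreover have "v(i := v j, j := v i) = v \<circ> Transposition.transpose i j"
    using ij by (auto simp: fun_eq_iff Transposition.transpose_def)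
  ultimately show "\<alpha> (v \<circ> Transposition.transpose i j) = - \<alpha> v" by (simp add: add_eq_0_iff)
qed

lemma complex_scale_eq: "c *s v = Re c *\<^sub>R v + Im c *\<^sub>R (\<i> *s v)" for v :: "(complex, 'n::finite) vec"
  by (simp add: vec_eq_iff complex_eq_iff)

text \<open>Real linearity treats the real and imaginary parts of \<open>c\<close> separately, so
  commuting with \<i> at the single vector \<open>v\<close> is enough.\<close>

lemma linear_imp_complex_linear:
  fixes f :: "(complex, 'n::finite) vec \<Rightarrow> complex"
  assumes "linear f" "f (\<i> *s v) = \<i> * f v"
  shows "f (c *s v) = c * f v"
proof -
  have "f (c *s v) = Re c *\<^sub>R f v + Im c *\<^sub>R (\<i> * f v)"
    unfolding complex_scale_eq[of c] using assms by (simp only: linear_add linear_scale)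
  then show ?thesis by (simp add: complex_eq_iff)
qed

lemma alternating_complex_lincomb:
  fixes \<alpha> :: "(nat \<Rightarrow> (complex, 'n::finite) vec) \<Rightarrow> complex"
  assumes "alternating N \<alpha>" and I: "\<And>v i. i < N \<Longrightarrow> \<alpha> (v(i := \<i> *s v i)) = \<i> * \<alpha> v"
    and i: "i < N" and "finite S"
  shows "\<alpha> (v(i := (\<Sum>j\<in>S. c j *s e j))) = (\<Sum>j\<in>S. c j * \<alpha> (v(i := e j)))"
proof -
  have lin: "linear (\<lambda>x. \<alpha> (v(i := x)))" using assms(1) i unfolding alternating_def by blast
  have sm: "\<alpha> (v(i := a *s x)) = a * \<alpha> (v(i := x))" for a x
    by (rule linear_imp_complex_linear[OF lin]) (use I[OF i, of "v(i := x)"] in simp)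
  show ?thesis by (simp add: linear_sum[OF lin] sm)
qed

text \<open>Top degree forms are a line: the expansion coefficient \<open>S\<close> depends on
  \<open>v\<close> alone, so it is the same for \<open>\<alpha>\<close> and for
  \<open>detform\<close>, and \<open>detform\<close> is 1 on the frame.\<close>

lemma alt_on_eq_detform:
  fixes \<alpha> :: "(nat \<Rightarrow> ('a::field_char_0, 'n::{finite,linorder}) vec) \<Rightarrow> 'a"
  assumes alt: "alt_on CARD('n) \<alpha>"
    and lin: "\<And>v i c. i < CARD('n) \<Longrightarrow> \<alpha> (v(i := (\<Sum>j<CARD('n). c j *s sframe j))) = (\<Sum>j<CARD('n). c j * \<alpha> (v(i := sframe j)))"
  shows "\<alpha> v = detform v * \<alpha> sframe"
proof -
  define S where "S = (\<Sum>\<tau> | \<tau> permutes {..<CARD('n)}. of_int (sign \<tau>) * (\<Prod>i<CARD('n). v i $ (of_index (\<tau> i) :: 'n)))"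
  define comb where "comb c = (\<Sum>j<CARD('n). c j *s (sframe j :: ('a, 'n) vec))" for c
  have v: "comb (\<lambda>j. x $ of_index j) = x" for x by (simp add: comb_def sframe_expansion)
  have "\<beta> v = S * \<beta> sframe" if "alt_on CARD('n) \<beta>"
    "\<And>v i c. i < CARD('n) \<Longrightarrow> \<beta> (v(i := comb c)) = (\<Sum>j<CARD('n). c j * \<beta> (v(i := sframe j)))" for \<beta> :: "(nat \<Rightarrow> ('a, 'n) vec) \<Rightarrow> 'a"
    using alt_on_expand[where \<alpha> = \<beta> and comb = comb and e = sframe and z = "\<lambda>i j. v i $ of_index j", OF that]
    unfolding v S_def .
  note expand = this
  have "\<alpha> v = S * \<alpha> sframe" by (rule expand[OF alt]) (simp add: comb_def lin)
  moreover have "detform v = S * detform (sframe :: nat \<Rightarrow> ('a, 'n) vec)"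
    by (rule expand[OF alt_on_detform]) (simp add: comb_def detform_lincomb)
  ultimately show ?thesis by (simp only: detform_sframe mult_1_right)
qed

section \<open>Top degree forms on a Lagrangian frame\<close>

lemma asymform_transposed:
  "asymform N \<phi> v = (\<Sum>\<tau> | \<tau> permutes {..<N}. of_int (sign \<tau>) * (\<Prod>i<N. \<phi> (\<tau> i) (v i)))"
  unfolding asymform_def
proof (subst sum_permutations_inverse, rule sum.cong[OF refl])
  fix \<tau> assume "\<tau> \<in> {\<tau>. \<tau> permutes {..<N}}"
  then have t: "\<tau> permutes {..<N}" by simp
  have "(\<Prod>i<N. \<phi> i (v (inv \<tau> i))) = (\<Prod>i<N. \<phi> (\<tau> i) (v (inv \<tau> (\<tau> i))))"
    using prod.permute[OF t, of "\<lambda>i. \<phi> i (v (inv \<tau> i))"] by (simp add: o_def)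
  then show "of_int (sign (inv \<tau>)) * (\<Prod>i<N. \<phi> i (v (inv \<tau> i))) = of_int (sign \<tau>) * (\<Prod>i<N. \<phi> (\<tau> i) (v i))"
    using t by (simp add: sign_inverse permutes_imp_permutation[OF finite_lessThan] permutes_inverses)
qed

lemma asymform_lincomb:
  fixes \<phi> :: "nat \<Rightarrow> 'v \<Rightarrow> 's::field_char_0"
  assumes "i < N"
  shows "asymform N (\<phi>(i := (\<lambda>x. \<Sum>j<K. c j * \<psi> j x))) v = (\<Sum>j<K. c j * asymform N (\<phi>(i := \<psi> j)) v)"
proof -
  have P: "(\<Prod>k<N. (\<phi>(i := \<xi>)) k (v (\<sigma> k))) = \<xi> (v (\<sigma> i)) * (\<Prod>k\<in>{..<N} - {i}. \<phi> k (v (\<sigma> k)))" for \<xi> and \<sigma> :: "nat \<Rightarrow> nat"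
    using assms by (subst prod.remove[of _ i]) auto
  show ?thesis
    unfolding asymform_def P by (subst sum_distrib_left, subst sum.swap) (simp add: sum_distrib_left sum_distrib_right mult_ac)
qed

text \<open>If the functionals have a dual family of formal combinations \<open>\<Sum>b. \<mu> j b \<cdot> x j b\<close>, then expanding
  their antisymmetrization multilinearly on that family gives \<open>1\<close>.\<close>
lemma asymform_nonzero:
  fixes \<phi> :: "nat \<Rightarrow> 'v \<Rightarrow> 's::field_char_0"
  assumes "finite B" and dual: "\<And>i j. i < N \<Longrightarrow> j < N \<Longrightarrow> (\<Sum>b\<in>B. \<mu> j b * \<phi> i (x j b)) = (if i = j then 1 else 0)"
  shows "\<exists>v. asymform N \<phi> v \<noteq> 0"
proof (rule ccontr)
  assume "\<nexists>v. asymform N \<phi> v \<noteq> 0"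
  then have zero: "asymform N \<phi> v = 0" for v by simp
  let ?S = "{\<tau>. \<tau> permutes {..<N}}"
  have "0 = (\<Sum>c\<in>PiE {..<N} (\<lambda>_. B). (\<Prod>j<N. \<mu> j (c j)) * asymform N \<phi> (\<lambda>j. x j (c j)))"
    by (simp add: zero)
  also have "\<dots> = (\<Sum>\<tau>\<in>?S. of_int (sign \<tau>) * (\<Sum>c\<in>PiE {..<N} (\<lambda>_. B). \<Prod>j<N. \<mu> j (c j) * \<phi> (\<tau> j) (x j (c j))))"
    unfolding asymform_transposed sum_distrib_left by (subst sum.swap) (simp add: prod.distrib mult_ac)
  also have "\<dots> = (\<Sum>\<tau>\<in>?S. of_int (sign \<tau>) * (\<Prod>j<N. \<Sum>b\<in>B. \<mu> j b * \<phi> (\<tau> j) (x j b)))"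
    using assms(1) by (subst prod_sum_PiE) auto
  also have "\<dots> = (\<Sum>\<tau>\<in>?S. if \<tau> = id then 1 else 0)"
  proof (rule sum.cong[OF refl])
    fix \<tau> assume "\<tau> \<in> ?S"
    then have t: "\<tau> permutes {..<N}" by simp
    have "(\<Prod>j<N. \<Sum>b\<in>B. \<mu> j b * \<phi> (\<tau> j) (x j b)) = (\<Prod>j<N. if \<tau> j = j then 1 else 0)"
      using permutes_in_image[OF t] by (intro prod.cong refl dual) auto
    also have "\<dots> = (if \<tau> = id then 1 else 0)"
    proof (cases "\<tau> = id")
      case False
      then obtain j where "\<tau> j \<noteq> j" by (auto simp: fun_eq_iff)
      moreover then have "j < N" using permutes_not_in[OF t] by auto
      ultimately have "(\<Prod>j<N. if \<tau> j = j then 1 else (0 :: 's)) = 0" by (intro prod_zero) auto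
      then show ?thesis using False by simp
    qed simp
    finally show "of_int (sign \<tau>) * (\<Prod>j<N. \<Sum>b\<in>B. \<mu> j b * \<phi> (\<tau> j) (x j b)) = (if \<tau> = id then 1 else 0)" by simp
  qed
  also have "\<dots> = 1" using permutes_id[of "{..<N}"] by (simp add: finite_permutations)
  finally show False by simp
qed

lemma wedge_cong: "\<alpha> = \<alpha>' \<Longrightarrow> \<beta> = \<beta>' \<Longrightarrow> wedge k m \<alpha> \<beta> v = wedge k m \<alpha>' \<beta>' v"
  by simp

lemma wedge_scale:
  "wedge k m (\<lambda>u. c * \<alpha> u) (\<lambda>u. d * \<beta> u) v = c * d * wedge k m \<alpha> \<beta> v"
  unfolding wedge_def by (simp add: sum_distrib_left mult_ac)

lemma wedge_sums:
  assumes "finite I" "finite J"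
  shows "wedge k m (\<lambda>u. \<Sum>i\<in>I. \<alpha> i u) (\<lambda>u. \<Sum>j\<in>J. \<beta> j u) v = (\<Sum>i\<in>I. \<Sum>j\<in>J. wedge k m (\<alpha> i) (\<beta> j) v)"
proof -
  let ?S = "{\<sigma>. \<sigma> permutes {..<k + m}}"
  have "(\<Sum>\<sigma>\<in>?S. of_int (sign \<sigma>) * (\<Sum>i\<in>I. \<alpha> i (\<lambda>i. v (\<sigma> i))) * (\<Sum>j\<in>J. \<beta> j (\<lambda>i. v (\<sigma> (k + i)))))
    = (\<Sum>\<sigma>\<in>?S. \<Sum>i\<in>I. \<Sum>j\<in>J. of_int (sign \<sigma>) * \<alpha> i (\<lambda>i. v (\<sigma> i)) * \<beta> j (\<lambda>i. v (\<sigma> (k + i))))"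
    by (simp add: sum_distrib_left sum_distrib_right mult_ac sum.swap[of _ I J])
  also have "\<dots> = (\<Sum>i\<in>I. \<Sum>j\<in>J. \<Sum>\<sigma>\<in>?S. of_int (sign \<sigma>) * \<alpha> i (\<lambda>i. v (\<sigma> i)) * \<beta> j (\<lambda>i. v (\<sigma> (k + i))))"
    by (subst sum.swap) (intro sum.cong refl, subst sum.swap, rule refl)
  finally show ?thesis unfolding wedge_def by (simp only: sum_divide_distrib)
qed

lemma of_real_wedge_pow2:
  "of_real (wedge_pow2 \<alpha> k v) = wedge_pow2 (\<lambda>u. of_real (\<alpha> u) :: 'a::real_normed_field) k v"
  by (induction k arbitrary: v) (simp_all add: wedge_def)

text \<open>The power expands into a sum over lists of indices. Collecting all \<open>z\<close>
  before all \<open>\<zeta>\<close> moves, from stage \<open>k\<close> to the next, one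
  \<open>\<zeta>\<close> past \<open>k\<close> of the \<open>z\<close>; these signs accumulate to
  the exponent \<open>k * (k - 1) div 2\<close>.\<close>

lemma wedge_pow2_asymform:
  fixes z \<zeta> :: "nat \<Rightarrow> 'v \<Rightarrow> 's::{real_normed_field, field_char_0}"
  assumes \<omega>: "\<And>v. \<omega> v = c * (\<Sum>a<n. asymform 2 (case_nat (z a) (\<lambda>_. \<zeta> a)) v)"
  shows "wedge_pow2 \<omega> k v = c ^ k * (-1) ^ (k * (k - 1) div 2) *
    (\<Sum>xs | set xs \<subseteq> {..<n} \<and> length xs = k. asymform (2 * k) (\<lambda>i. if i < k then z (xs ! i) else \<zeta> (xs ! (i - k))) v)"
proof (induction k arbitrary: v)
  case 0
  have "{xs. set xs \<subseteq> {..<n} \<and> length xs = 0} = {[]}" by auto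
  then show ?case by (simp add: asymform_def)
next
  case (Suc k)
  let ?L = "\<lambda>k. {xs. set xs \<subseteq> {..<n} \<and> length xs = k}"
  let ?R = "\<lambda>k xs i. if i < k then z (xs ! i) else \<zeta> (xs ! (i - k))"
  let ?s = "\<lambda>k. (-1) ^ (k * (k - 1) div 2) :: 's"
  have one: "wedge 2 (2 * k) (asymform 2 (case_nat (z a) (\<lambda>_. \<zeta> a))) (asymform (2 * k) (?R k xs)) v
     = (-1) ^ k * asymform (2 * Suc k) (?R (Suc k) (a # xs)) v" for a xs
  proof -
    let ?W = "?R (Suc k) (a # xs)"
    \<comment> \<open>\<open>?w\<close> brings the \<open>\<zeta>\<close> at position
      \<open>Suc k\<close> to the front, at the cost of \<open>(-1) ^ Suc k\<close>; exchanging it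
      with \<open>z a\<close> gives one more sign and leaves \<open>(-1) ^ k\<close>.\<close>
    let ?w = "\<lambda>j. if j = 0 then ?W (Suc k) else if j \<le> Suc k then ?W (j - 1) else ?W j"
    have alt: "alt_on (2 * Suc k) (\<lambda>\<phi>. asymform (2 * Suc k) \<phi> v)" by (rule alt_on_asymform)
    have "wedge 2 (2 * k) (asymform 2 (case_nat (z a) (\<lambda>_. \<zeta> a))) (asymform (2 * k) (?R k xs)) v =
        asymform (2 * Suc k) (\<lambda>i. if i < 2 then (case_nat (z a) (\<lambda>_. \<zeta> a)) i else ?R k xs (i - 2)) v"
      by (simp only: wedge_asymform mult_Suc_right)
    also have "(\<lambda>i. if i < 2 then (case_nat (z a) (\<lambda>_. \<zeta> a)) i else ?R k xs (i - 2)) = ?w \<circ> Transposition.transpose 0 1"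
    proof
      fix i :: nat
      consider "i = 0" | "i = 1" | j where "i = Suc (Suc j)" by (metis One_nat_def not0_implies_Suc)
      then show "(if i < 2 then (case_nat (z a) (\<lambda>_. \<zeta> a)) i else ?R k xs (i - 2)) = (?w \<circ> Transposition.transpose 0 1) i"
        by cases (auto simp: Transposition.transpose_def)
    qed
    also have "asymform (2 * Suc k) (?w \<circ> Transposition.transpose 0 1) v = - asymform (2 * Suc k) ?w v"
      by (rule alt_on_swap[OF alt]) auto
    also have "asymform (2 * Suc k) ?w v = (-1) ^ Suc k * asymform (2 * Suc k) ?W v"
      by (rule alt_on_shift[OF alt]) simp
    finally show ?thesis by simp
  qed
  have sg: "?s (Suc k) = ?s k * (-1) ^ k"
  proof -
    have "Suc k * (Suc k - 1) = k * (k - 1) + 2 * k" by (cases k) (auto simp: algebra_simps)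
    then have "Suc k * (Suc k - 1) div 2 = k * (k - 1) div 2 + k" by simp
    then show ?thesis by (simp only: power_add)
  qed
  have L: "?L (Suc k) = (\<lambda>(a, xs). a # xs) ` ({..<n} \<times> ?L k)"
    by (auto simp: length_Suc_conv image_iff)
  have "wedge_pow2 \<omega> (Suc k) v = wedge 2 (2 * k) (\<lambda>u. c * (\<Sum>a<n. asymform 2 (case_nat (z a) (\<lambda>_. \<zeta> a)) u))
      (\<lambda>u. (c ^ k * ?s k) * (\<Sum>xs\<in>?L k. asymform (2 * k) (?R k xs) u)) v"
    unfolding wedge_pow2.simps by (rule wedge_cong) (rule ext, simp only: \<omega> Suc.IH)+
  also have "\<dots> = c * (c ^ k * ?s k) * (\<Sum>a<n. \<Sum>xs\<in>?L k. (-1) ^ k * asymform (2 * Suc k) (?R (Suc k) (a # xs)) v)"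
    unfolding wedge_scale by (subst wedge_sums) (auto simp: one finite_lists_length_eq)
  also have "\<dots> = c ^ Suc k * ?s (Suc k) * (\<Sum>(a, xs)\<in>{..<n} \<times> ?L k. asymform (2 * Suc k) (?R (Suc k) (a # xs)) v)"
    unfolding sg by (simp add: sum_distrib_left[symmetric] sum.cartesian_product mult_ac del: mult_Suc_right)
  also have "(\<Sum>(a, xs)\<in>{..<n} \<times> ?L k. asymform (2 * Suc k) (?R (Suc k) (a # xs)) v) = (\<Sum>xs\<in>?L (Suc k). asymform (2 * Suc k) (?R (Suc k) xs) v)"
    unfolding L by (subst sum.reindex) (auto simp: inj_on_def case_prod_unfold o_def simp del: mult_Suc_right)
  finally show ?case .
qed

text \<open>For \<open>k = n\<close> only lists without repetition survive. Each is a permutation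
  acting on the \<open>z\<close> and the \<open>\<zeta>\<close> simultaneously, so its sign enters
  squared and all \<open>fact n\<close> lists contribute equally.\<close>

lemma wedge_pow2_top:
  fixes z \<zeta> :: "nat \<Rightarrow> 'v \<Rightarrow> 's::{real_normed_field, field_char_0}"
  assumes \<omega>: "\<And>v. \<omega> v = c * (\<Sum>a<n. asymform 2 (case_nat (z a) (\<lambda>_. \<zeta> a)) v)"
  shows "wedge_pow2 \<omega> n v = c ^ n * (-1) ^ (n * (n - 1) div 2) * fact n * wedge n n (asymform n z) (asymform n \<zeta>) v"
proof -
  let ?L = "{xs. set xs \<subseteq> {..<n} \<and> length xs = n}"
  let ?D = "{xs. length xs = n \<and> distinct xs \<and> set xs \<subseteq> {..<n}}"
  let ?R = "\<lambda>xs i. if i < n then z (xs ! i) else \<zeta> (xs ! (i - n))"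
  have "(\<Sum>xs\<in>?L. asymform (2 * n) (?R xs) v) = (\<Sum>xs\<in>?D. asymform (2 * n) (?R xs) v)"
  proof (rule sum.mono_neutral_right)
    show "\<forall>xs\<in>?L - ?D. asymform (2 * n) (?R xs) v = 0"
    proof
      fix xs assume "xs \<in> ?L - ?D"
      then obtain i j where "i < n" "j < n" "i \<noteq> j" "xs ! i = xs ! j" by (auto simp: distinct_conv_nth)
      then show "asymform (2 * n) (?R xs) v = 0"
        by (intro alt_on_repeat[OF alt_on_asymform, of i "2 * n" j "?R xs"]) auto
    qed
  qed (auto simp: finite_lists_length_eq)
  also have "\<dots> = (\<Sum>xs\<in>?D. wedge n n (asymform n z) (asymform n \<zeta>) v)"
  proof (rule sum.cong[OF refl])
    fix xs assume xs: "xs \<in> ?D"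
    define \<tau> where "\<tau> i = (if i < n then xs ! i else i)" for i
    have "inj_on \<tau> {..<n}" using xs by (auto simp: inj_on_def \<tau>_def nth_eq_iff_index_eq)
    moreover have "\<tau> ` {..<n} \<subseteq> {..<n}" using xs by (auto simp: \<tau>_def subset_iff)
    ultimately have "bij_betw \<tau> {..<n} {..<n}" by (simp add: bij_betw_def endo_inj_surj)
    then have t: "\<tau> permutes {..<n}" by (rule bij_imp_permutes) (simp add: \<tau>_def)
    have p: "asymform n (\<phi> \<circ> \<tau>) = (\<lambda>u. of_int (sign \<tau>) * asymform n \<phi> u)" for \<phi> :: "nat \<Rightarrow> 'v \<Rightarrow> 's"
      by (rule ext, rule alt_on_permutes[OF alt_on_asymform t])
    have "asymform (2 * n) (?R xs) v = asymform (n + n) (\<lambda>i. if i < n then (z \<circ> \<tau>) i else (\<zeta> \<circ> \<tau>) (i - n)) v"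
      unfolding mult_2 by (rule alt_on_cong[OF alt_on_asymform]) (auto simp: \<tau>_def)
    also have "\<dots> = wedge n n (asymform n (z \<circ> \<tau>)) (asymform n (\<zeta> \<circ> \<tau>)) v" by (rule wedge_asymform[symmetric])
    also have "\<dots> = wedge n n (asymform n z) (asymform n \<zeta>) v"
      unfolding p wedge_scale by (simp flip: of_int_mult)
    finally show "asymform (2 * n) (?R xs) v = wedge n n (asymform n z) (asymform n \<zeta>) v" .
  qed
  also have "\<dots> = fact n * wedge n n (asymform n z) (asymform n \<zeta>) v"
    using card_lists_distinct_length_eq[of "{..<n}" n] by (simp add: fact_prod)
  finally show ?thesis unfolding wedge_pow2_asymform[OF \<omega>] by simp
qed

text \<open>Along the segment from the identity to \<open>G\<close> the matrices stay positive
  definite, hence invertible, so the determinant keeps the sign of its initial value 1.\<close>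

lemma det_pos_definite:
  fixes G :: "((real, 'n::finite) vec, 'n) vec"
  assumes pd: "\<And>x. x \<noteq> 0 \<Longrightarrow> x \<bullet> (G *v x) > 0"
  shows "det G > 0"
proof -
  define M where "M t = (1 - t) *\<^sub>R mat 1 + t *\<^sub>R G" for t :: real
  have nz: "det (M t) \<noteq> 0" if "0 \<le> t" "t \<le> 1" for t
  proof
    assume "det (M t) = 0"
    then have "\<not> invertible (M t)" by (simp add: invertible_det_nz)
    then obtain x where x: "x \<noteq> 0" "M t *v x = 0"
      using matrix_left_invertible_ker invertible_left_inverse by blast
    have Mx: "M t *v x = (1 - t) *\<^sub>R x + t *\<^sub>R (G *v x)"
      by (simp add: M_def matrix_vector_mult_add_rdistrib scaleR_matrix_vector_assoc[symmetric])
    have "0 = x \<bullet> (M t *v x)" using x by simp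
    also have "\<dots> = (1 - t) * (x \<bullet> x) + t * (x \<bullet> (G *v x))" unfolding Mx by (simp add: inner_add_right)
    also have "\<dots> > 0"
    proof (cases "t = 0")
      case False
      then have "t * (x \<bullet> (G *v x)) > 0" using that pd[OF x(1)] by simp
      moreover have "(1 - t) * (x \<bullet> x) \<ge> 0" using that by simp
      ultimately show ?thesis by linarith
    qed (use x in simp)
    finally show False by simp
  qed
  have cont: "continuous_on {0..1} (\<lambda>t. det (M t))"
    unfolding det_def M_def by (intro continuous_intros)
  show ?thesis
  proof (rule ccontr)
    assume "\<not> det G > 0"
    then have "det (M 1) \<le> 0" by (simp add: M_def)
    moreover have "det (M 0) = 1" by (simp add: M_def)
    ultimately obtain t where "0 \<le> t" "t \<le> 1" "det (M t) = 0"
      using IVT2'[of "\<lambda>t. det (M t)" 1 0 0] cont by auto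
    then show False using nz by blast
  qed
qed

lemma of_real_det:
  "(of_real (det A) :: 'a::{real_algebra_1, comm_ring_1}) = det (\<chi> i j. of_real (A $ i $ j))"
  by (simp add: det_def)

lemma asymform_2: "asymform 2 \<phi> v = \<phi> 0 (v 0) * \<phi> 1 (v 1) - \<phi> 0 (v 1) * \<phi> 1 (v 0)"
proof -
  have "{\<sigma>. \<sigma> permutes {..<2::nat}} = {id, Transposition.transpose 0 1}"
    using permutes_doubleton_iff[of _ 0 "1::nat"] by (auto simp: lessThan_Suc numeral_2_eq_2 insert_commute)
  moreover have "id \<noteq> Transposition.transpose 0 (1::nat)" by (metis id_apply transpose_apply_first zero_neq_one)
  ultimately show ?thesis
    by (simp add: asymform_def sign_swap_id numeral_2_eq_2)
qed

section \<open>Two-forms compatible with multiplication by \<i>\<close>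

context
  fixes \<omega> :: "(nat \<Rightarrow> 'v::real_vector) \<Rightarrow> real"
  assumes alt: "alternating 2 \<omega>"
begin

lemma two_form_vpair: "\<omega> v = \<omega> (vpair (v 0) (v 1))"
proof -
  have "\<forall>i<2. v i = vpair (v 0) (v 1) i" by (auto simp: less_2_cases_iff split: nat.split)
  then show ?thesis using alt unfolding alternating_def by blast
qed

lemma two_form_linear_left: "linear (\<lambda>u. \<omega> (vpair u w))"
proof -
  have "linear (\<lambda>x. \<omega> ((vpair 0 w)(0 := x)))" using alt unfolding alternating_def by (metis pos2)
  moreover have "\<omega> ((vpair 0 w)(0 := x)) = \<omega> (vpair x w)" for x by (subst two_form_vpair) simp
  ultimately show ?thesis by simp
qed

lemma two_form_linear_right: "linear (\<lambda>w. \<omega> (vpair u w))"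
proof -
  have "linear (\<lambda>x. \<omega> ((vpair u 0)(1 := x)))" using alt unfolding alternating_def by (metis one_less_numeral_iff semiring_norm(76))
  moreover have "\<omega> ((vpair u 0)(1 := x)) = \<omega> (vpair u x)" for x by (subst two_form_vpair) simp
  ultimately show ?thesis by simp
qed

lemma two_form_swap: "\<omega> (vpair u v) = - \<omega> (vpair v u)"
proof -
  have "\<omega> (vpair v u \<circ> Transposition.transpose 0 1) = - \<omega> (vpair v u)"
    by (rule alt_on_swap[OF alternating_imp_alt_on[OF alt]]) auto
  then show ?thesis by (subst (asm) two_form_vpair) simp
qed

end

context
  fixes \<omega> :: "(nat \<Rightarrow> (complex, 'n::finite) vec) \<Rightarrow> real"
  assumes alt: "alternating 2 \<omega>"
    and J: "\<And>u v. \<omega> (vpair (\<i> *s u) (\<i> *s v)) = \<omega> (vpair u v)"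
begin

lemma two_form_J: "\<omega> (vpair (\<i> *s u) v) = - \<omega> (vpair u (\<i> *s v))"
proof -
  have "\<i> *s (\<i> *s u) = - u" by (simp add: vec_eq_iff)
  moreover have "\<omega> (vpair (\<i> *s (\<i> *s u)) (\<i> *s v)) = \<omega> (vpair (\<i> *s u) v)" by (rule J)
  ultimately have "\<omega> (vpair (- u) (\<i> *s v)) = \<omega> (vpair (\<i> *s u) v)" by simp
  then show ?thesis using linear_neg[OF two_form_linear_left[OF alt], of u "\<i> *s v"] by simp
qed

lemma kaehler_sym: "\<omega> (vpair u (\<i> *s v)) = \<omega> (vpair v (\<i> *s u))"
  using two_form_J[of v u] two_form_swap[OF alt, of u "\<i> *s v"] by simp

end

section \<open>Volume comparison on a Lagrangian frame and its multiple by \<i>\<close>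

context
  fixes \<omega> :: "(nat \<Rightarrow> (complex, 'n::{finite,linorder}) vec) \<Rightarrow> real" and E :: "nat \<Rightarrow> (complex, 'n) vec"
  assumes alt: "alternating 2 \<omega>"
    and J: "\<And>u v. \<omega> (vpair (\<i> *s u) (\<i> *s v)) = \<omega> (vpair u v)"
    and pos: "\<And>u. u \<noteq> 0 \<Longrightarrow> \<omega> (vpair u (\<i> *s u)) > 0"
    and E: "detform E \<noteq> 0"
    and lag: "\<And>i j. i < CARD('n) \<Longrightarrow> j < CARD('n) \<Longrightarrow> \<omega> (vpair (E i) (E j)) = 0"
begin

private lemmas lin_left = two_form_linear_left[OF alt]
private lemmas lin_right = two_form_linear_right[OF alt]

text \<open>\<open>E\<close> is a complex basis with coordinates \<open>zc\<close>. The Lagrangian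
  condition makes the Hermitian matrix of the metric in this basis real, equal to the Gram matrix
  \<open>G\<close>.\<close>

private definition "P = (\<chi> a (b :: 'n). E (index_of b) $ a)"
private definition "zc i v = (matrix_inv P *v v) $ (of_index i :: 'n)"
private definition "G i j = \<omega> (vpair (E i) (\<i> *s E j))"

private lemma P_inv: "P ** matrix_inv P = mat 1" "matrix_inv P ** P = mat 1"
proof -
  have "invertible P" using E by (simp add: invertible_det_nz P_def detform_def)
  then show "P ** matrix_inv P = mat 1" "matrix_inv P ** P = mat 1"
    unfolding invertible_def matrix_inv_def by (auto intro: someI2_ex)
qed

private lemma P_mult: "P *v y = (\<Sum>j<CARD('n). y $ of_index j *s E j)"
  unfolding matrix_mult_sum sum_index_of by (simp add: P_def column_def)

private lemma E_expansion: "(\<Sum>j<CARD('n). zc j v *s E j) = v"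
  unfolding zc_def P_mult[symmetric] by (simp add: matrix_vector_mul_assoc P_inv)

private lemma zc_E:
  assumes "i < CARD('n)" "j < CARD('n)"
  shows "zc i (E j) = (if i = j then 1 else 0)"
proof -
  have "P *v axis (of_index j) 1 = (\<Sum>k<CARD('n). if k = j then E k else 0)"
    unfolding P_mult using assms(2)
    by (intro sum.cong refl) (auto simp: axis_def, metis index_of_of_index lessThan_iff)
  also have "\<dots> = E j" using assms(2) by simp
  finally have "matrix_inv P *v E j = axis (of_index j) 1"
    by (metis P_inv(2) matrix_vector_mul_assoc matrix_vector_mul_lid)
  moreover have "of_index i = (of_index j :: 'n) \<longleftrightarrow> i = j" using assms by (metis index_of_of_index)
  ultimately show ?thesis by (simp add: zc_def axis_def)
qed

private lemma zc_scale: "zc i (c *s v) = c * zc i v"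
  by (simp add: zc_def matrix_vector_mult_def sum_distrib_left mult_ac)

private lemma G_sym: "G i j = G j i"
  unfolding G_def by (rule kaehler_sym[OF alt J])

private lemma two_form_coords:
  "\<omega> (vpair u v) = (\<Sum>i<CARD('n). \<Sum>j<CARD('n). G i j * (Re (zc i u) * Im (zc j v) - Im (zc i u) * Re (zc j v)))"
proof -
  have one: "\<omega> (vpair (c *s E i) (d *s E j)) = G i j * (Re c * Im d - Im c * Re d)"
    if "i < CARD('n)" "j < CARD('n)" for c d i j
    unfolding complex_scale_eq[of c] complex_scale_eq[of d]
    using that lag[OF that] two_form_J[OF alt J, of "E i" "E j"]
    by (simp add: linear_add[OF lin_left] linear_add[OF lin_right]
        linear_scale[OF lin_left] linear_scale[OF lin_right] J G_def algebra_simps)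
  have "\<omega> (vpair u v) = \<omega> (vpair (\<Sum>i<CARD('n). zc i u *s E i) (\<Sum>j<CARD('n). zc j v *s E j))"
    by (simp only: E_expansion)
  also have "\<dots> = (\<Sum>i<CARD('n). \<Sum>j<CARD('n). \<omega> (vpair (zc i u *s E i) (zc j v *s E j)))"
    by (subst sum.swap) (simp only: linear_sum[OF lin_left] linear_sum[OF lin_right])
  also have "\<dots> = (\<Sum>i<CARD('n). \<Sum>j<CARD('n). G i j * (Re (zc i u) * Im (zc j v) - Im (zc i u) * Re (zc j v)))"
    by (intro sum.cong refl one) auto
  finally show ?thesis .
qed

private definition "zb i v = cnj (zc i v)"
text \<open>Absorbing \<open>G\<close> into one factor makes the two-form diagonal, a multiple of
  the sum of the \<open>zc a\<close> wedge \<open>\<zeta> a\<close>, which is the shape that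
  \<open>wedge_pow2_top\<close> takes.\<close>

private definition "\<zeta> i v = (\<Sum>j<CARD('n). of_real (G i j) * zb j v)"

private lemma two_form_asym:
  "of_real (\<omega> v) = (\<i> / 2) * (\<Sum>a<CARD('n). asymform 2 (case_nat (zc a) (\<lambda>_. \<zeta> a)) v)"
proof -
  have im: "\<i> / 2 * (x * cnj y - cnj x * y) = of_real (Re x * Im y - Im x * Re y)" for x y
    by (simp add: complex_eq_iff)
  have "(\<Sum>a<CARD('n). zc a (v 1) * \<zeta> a (v 0)) = (\<Sum>a<CARD('n). \<Sum>b<CARD('n). of_real (G a b) * (cnj (zc a (v 0)) * zc b (v 1)))"
    unfolding \<zeta>_def sum_distrib_left by (subst sum.swap) (simp add: zb_def G_sym mult_ac)
  moreover have "(\<Sum>a<CARD('n). zc a (v 0) * \<zeta> a (v 1)) = (\<Sum>a<CARD('n). \<Sum>b<CARD('n). of_real (G a b) * (zc a (v 0) * cnj (zc b (v 1))))"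
    unfolding \<zeta>_def sum_distrib_left by (simp add: zb_def mult_ac)
  ultimately have "(\<i> / 2) * (\<Sum>a<CARD('n). asymform 2 (case_nat (zc a) (\<lambda>_. \<zeta> a)) v) =
      (\<Sum>a<CARD('n). \<Sum>b<CARD('n). of_real (G a b) * (\<i> / 2 * (zc a (v 0) * cnj (zc b (v 1)) - cnj (zc a (v 0)) * zc b (v 1))))"
    by (simp add: asymform_2 sum_subtractf sum_distrib_left right_diff_distrib mult_ac)
  also have "\<dots> = of_real (\<omega> v)"
    unfolding im by (subst two_form_vpair[OF alt], subst two_form_coords) simp
  finally show ?thesis ..
qed

text \<open>The expansion coefficient \<open>D\<close> is recognised as a determinant by running the
  same expansion on \<open>detform\<close> with the rows of \<open>G\<close>.\<close>

private lemma asymform_zeta: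
  "asymform CARD('n) \<zeta> v = of_real (det (\<chi> a (b :: 'n). G (index_of (a :: 'n)) (index_of b))) * asymform CARD('n) zb v"
proof -
  define D where "D = (\<Sum>\<tau> | \<tau> permutes {..<CARD('n)}. of_int (sign \<tau>) * (\<Prod>i<CARD('n). of_real (G i (\<tau> i)) :: complex))"
  have "asymform CARD('n) \<zeta> v = D * asymform CARD('n) zb v"
    unfolding \<zeta>_def D_def
    by (rule alt_on_expand[where \<alpha> = "\<lambda>\<phi>. asymform CARD('n) \<phi> v" and comb = "\<lambda>c v. \<Sum>j<CARD('n). c j * zb j v", OF alt_on_asymform asymform_lincomb])
  moreover have "detform (\<lambda>i. \<Sum>j<CARD('n). of_real (G i j) *s (sframe j :: (complex, 'n) vec)) = D * detform (sframe :: nat \<Rightarrow> (complex, 'n) vec)"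
    unfolding D_def
    by (rule alt_on_expand[where \<alpha> = "detform :: (nat \<Rightarrow> (complex, 'n) vec) \<Rightarrow> complex" and comb = "\<lambda>c. \<Sum>j<CARD('n). c j *s sframe j", OF alt_on_detform])
      (rule detform_lincomb, simp_all)
  moreover have "(\<Sum>j<CARD('n). of_real (G i j) *s (sframe j :: (complex, 'n) vec)) = (\<chi> b. of_real (G i (index_of b)))" for i
    unfolding sum_index_of by (simp add: vec_eq_iff sframe_def if_distrib cong: if_cong)
  ultimately show ?thesis using detform_sframe[where 'a = complex and 'n = 'n] by (simp add: detform_rows of_real_det)
qed

text \<open>The dual family consists of the vectors of type (1,0) and (0,1): half of
  \<open>E j\<close> minus, respectively plus, \<i> times \<open>\<i> *s E j\<close>. The
  combination is formal, since the coefficient \<i> multiplies values and not vectors; this is what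
  separates \<open>zc\<close> from \<open>zb\<close>. The Boolean selects \<open>\<i> *s E j\<close>
  or \<open>E j\<close>.\<close>

private lemma wedge_nonzero: "\<exists>v. wedge CARD('n) CARD('n) (asymform CARD('n) zc) (asymform CARD('n) zb) v \<noteq> 0"
  unfolding wedge_asymform
proof (rule asymform_nonzero[where B = "UNIV :: bool set"
      and x = "\<lambda>j b. if b then \<i> *s E (if j < CARD('n) then j else j - CARD('n)) else E (if j < CARD('n) then j else j - CARD('n))"
      and \<mu> = "\<lambda>j b. if b then (if j < CARD('n) then - \<i> / 2 else \<i> / 2) else 1 / 2"])
  fix i j assume "i < CARD('n) + CARD('n)" "j < CARD('n) + CARD('n)"
  then show "(\<Sum>b\<in>UNIV. (if b then if j < CARD('n) then - \<i> / 2 else \<i> / 2 else 1 / 2) *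
           (if i < CARD('n) then zc i else zb (i - CARD('n)))
            (if b then \<i> *s E (if j < CARD('n) then j else j - CARD('n)) else E (if j < CARD('n) then j else j - CARD('n)))) =
       (if i = j then 1 else 0)"
    by (simp add: UNIV_bool zb_def zc_scale zc_E) (auto simp: zc_E)
qed simp

lemma lagrangian_frame_det_pos:
  "det (\<chi> (a :: 'n) (b :: 'n). \<omega> (vpair (E (index_of a)) (\<i> *s E (index_of b)))) > 0"
proof (rule det_pos_definite)
  fix x :: "(real, 'n) vec" assume x: "x \<noteq> 0"
  let ?y = "\<chi> a. complex_of_real (x $ a)"
  have 1: "P *v ?y = (\<Sum>a\<in>UNIV. x $ a *\<^sub>R E (index_of a))"
    unfolding P_mult sum_index_of by (simp add: vec_eq_iff scaleR_conv_of_real[where 'a = complex])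
  have nz: "P *v ?y \<noteq> 0"
  proof
    assume "P *v ?y = 0"
    then have "?y = 0" by (metis P_inv(2) matrix_vector_mul_assoc matrix_vector_mul_lid matrix_vector_mult_0_right)
    then show False using x by (simp add: vec_eq_iff)
  qed
  have 2: "\<i> *s (P *v ?y) = (\<Sum>a\<in>UNIV. x $ a *\<^sub>R (\<i> *s E (index_of a)))"
    unfolding 1 by (simp add: vec_eq_iff scaleR_conv_of_real[where 'a = complex] sum_distrib_left mult_ac)
  have "\<omega> (vpair (P *v ?y) (\<i> *s (P *v ?y))) = (\<Sum>a\<in>UNIV. \<Sum>b\<in>UNIV. x $ a * (x $ b * \<omega> (vpair (E (index_of a)) (\<i> *s E (index_of b)))))"
    unfolding 2 unfolding 1
    by (subst sum.swap) (simp add: linear_sum[OF lin_left] linear_sum[OF lin_right]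
        linear_scale[OF lin_left] linear_scale[OF lin_right] sum_distrib_left mult_ac)
  then show "x \<bullet> ((\<chi> a b. \<omega> (vpair (E (index_of a)) (\<i> *s E (index_of b)))) *v x) > 0"
    using pos[OF nz] by (simp add: inner_vec_def matrix_vector_mult_def sum_distrib_left mult_ac)
qed

text \<open>Both sides are multiples of one nonzero form \<open>?W\<close>, so equality at all
  \<open>v\<close> means equality of the coefficients. An equivalence is needed because
  \<open>acy_rho\<close> is a definite description.\<close>

lemma top_form_ratio:
  fixes \<Omega> :: "(nat \<Rightarrow> (complex, 'n) vec) \<Rightarrow> complex"
  assumes \<Omega>: "alternating CARD('n) \<Omega>" "\<And>v i. i < CARD('n) \<Longrightarrow> \<Omega> (v(i := \<i> *s v i)) = \<i> * \<Omega> v"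
    and r: "r \<ge> 0"
  shows "(\<forall>v. of_real (r ^ CARD('n) * wedge_pow2 \<omega> CARD('n) v / fact CARD('n)) =
        (-1) ^ (CARD('n) * (CARD('n) - 1) div 2) * (\<i> / 2) ^ CARD('n) * wedge CARD('n) CARD('n) \<Omega> (\<lambda>u. cnj (\<Omega> u)) v)
    \<longleftrightarrow> r ^ CARD('n) * det (\<chi> (a :: 'n) (b :: 'n). \<omega> (vpair (E (index_of a)) (\<i> *s E (index_of b)))) = (cmod (\<Omega> E))\<^sup>2"
proof -
  let ?n = "CARD('n)"
  let ?D = "det (\<chi> (a :: 'n) (b :: 'n). \<omega> (vpair (E (index_of a)) (\<i> *s E (index_of b))))"
  let ?W = "wedge ?n ?n (asymform ?n zc) (asymform ?n zb)"
  let ?e = "(-1) ^ (?n * (?n - 1) div 2) :: complex"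
  have D: "?D = det (\<chi> a (b :: 'n). G (index_of (a :: 'n)) (index_of b))" by (simp add: G_def)
  have L: "of_real (wedge_pow2 \<omega> ?n v) = (\<i> / 2) ^ ?n * ?e * fact ?n * (of_real ?D * ?W v)" for v
  proof -
    have z: "asymform ?n \<zeta> = (\<lambda>u. of_real ?D * asymform ?n zb u)" unfolding D using asymform_zeta by blast
    have "wedge ?n ?n (asymform ?n zc) (asymform ?n \<zeta>) v = of_real ?D * ?W v"
      unfolding z using wedge_scale[of ?n ?n 1 "asymform ?n zc" "of_real ?D" "asymform ?n zb" v] by simp
    then show ?thesis
      unfolding of_real_wedge_pow2 by (simp only: wedge_pow2_top[OF two_form_asym])
  qed
  have Om: "\<Omega> v = \<Omega> E * asymform ?n zc v" for v
  proof -
    have "\<Omega> (\<lambda>i. \<Sum>j<?n. zc j (v i) *s E j) = (\<Sum>\<tau> | \<tau> permutes {..<?n}. of_int (sign \<tau>) * (\<Prod>i<?n. zc (\<tau> i) (v i))) * \<Omega> E"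
      by (rule alt_on_expand[where \<alpha> = \<Omega> and comb = "\<lambda>c. \<Sum>j<?n. c j *s E j" and z = "\<lambda>i j. zc j (v i)",
          OF alternating_imp_alt_on[OF \<Omega>(1)]])
        (rule alternating_complex_lincomb[OF \<Omega>], simp_all)
    then show ?thesis by (simp add: E_expansion asymform_transposed mult.commute)
  qed
  have "cnj (asymform ?n zc v) = asymform ?n zb v" for v by (simp add: asymform_def zb_def)
  then have cOm: "(\<lambda>u. cnj (\<Omega> u)) = (\<lambda>u. cnj (\<Omega> E) * asymform ?n zb u)" by (subst Om) simp
  have Om': "\<Omega> = (\<lambda>u. \<Omega> E * asymform ?n zc u)" using Om by blast
  have R: "wedge ?n ?n \<Omega> (\<lambda>u. cnj (\<Omega> u)) v = of_real ((cmod (\<Omega> E))\<^sup>2) * ?W v" for v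
    unfolding cOm by (subst Om', subst wedge_scale) (simp only: complex_norm_square)
  have nz: "(\<i> / 2) ^ ?n * ?e \<noteq> 0" by simp
  have "of_real (r ^ ?n * wedge_pow2 \<omega> ?n v / fact ?n) = ?e * (\<i> / 2) ^ ?n * wedge ?n ?n \<Omega> (\<lambda>u. cnj (\<Omega> u)) v
     \<longleftrightarrow> of_real (r ^ ?n * ?D) * ?W v = of_real ((cmod (\<Omega> E))\<^sup>2) * ?W v" for v
  proof -
    have "of_real (r ^ ?n * wedge_pow2 \<omega> ?n v / fact ?n) = (\<i> / 2) ^ ?n * ?e * (of_real (r ^ ?n * ?D) * ?W v)"
      using L[of v] by simp
    moreover have "?e * (\<i> / 2) ^ ?n * wedge ?n ?n \<Omega> (\<lambda>u. cnj (\<Omega> u)) v = (\<i> / 2) ^ ?n * ?e * (of_real ((cmod (\<Omega> E))\<^sup>2) * ?W v)"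
      unfolding R by simp
    ultimately show ?thesis using nz by (simp only: mult_cancel_left) simp
  qed
  then have "(\<forall>v. of_real (r ^ ?n * wedge_pow2 \<omega> ?n v / fact ?n) = ?e * (\<i> / 2) ^ ?n * wedge ?n ?n \<Omega> (\<lambda>u. cnj (\<Omega> u)) v)
     \<longleftrightarrow> (\<forall>v. of_real (r ^ ?n * ?D) * ?W v = of_real ((cmod (\<Omega> E))\<^sup>2) * ?W v)" by (simp only:)
  also have "\<dots> \<longleftrightarrow> complex_of_real (r ^ ?n * ?D) = of_real ((cmod (\<Omega> E))\<^sup>2)"
    using wedge_nonzero by (simp only: mult_cancel_right) blast
  finally show ?thesis by (simp only: of_real_eq_iff)
qed

end

lemma acy_rho_lagrangian_frame:
  fixes X :: "('x, 'n::{finite,linorder}) acy_data"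
  assumes \<omega>: "alternating 2 (symp X x)"
      "\<And>u v. symp X x (vpair (\<i> *s u) (\<i> *s v)) = symp X x (vpair u v)"
      "\<And>u. u \<noteq> 0 \<Longrightarrow> symp X x (vpair u (\<i> *s u)) > 0"
    and E: "detform E \<noteq> 0" "\<And>i j. i < CARD('n) \<Longrightarrow> j < CARD('n) \<Longrightarrow> symp X x (vpair (E i) (E j)) = 0"
    and \<Omega>: "alternating CARD('n) (hol_form X x)"
      "\<And>v i. i < CARD('n) \<Longrightarrow> hol_form X x (v(i := \<i> *s v i)) = \<i> * hol_form X x v"
    and nz: "hol_form X x E \<noteq> 0"
  shows "acy_rho X x > 0"
    and "acy_rho X x ^ CARD('n) * det (\<chi> (a :: 'n) (b :: 'n). symp X x (vpair (E (index_of a)) (\<i> *s E (index_of b))))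
      = (cmod (hol_form X x E))\<^sup>2"
proof -
  let ?n = "CARD('n)"
  let ?D = "det (\<chi> (a :: 'n) (b :: 'n). symp X x (vpair (E (index_of a)) (\<i> *s E (index_of b))))"
  have D: "?D > 0" by (rule lagrangian_frame_det_pos[OF \<omega> E])
  define q where "q = (cmod (hol_form X x E))\<^sup>2 / ?D"
  have q: "q > 0" using D nz by (simp add: q_def)
  have n: "?n > 0" by simp
  have "acy_rho X x = (THE r. r > 0 \<and> r ^ ?n * ?D = (cmod (hol_form X x E))\<^sup>2)"
    unfolding acy_rho_def Let_def
    using top_form_ratio[OF \<omega> E \<Omega>] by (intro arg_cong[where f = The] ext conj_cong refl) simp
  also have "\<dots> = root ?n q"
  proof (rule the_equality)
    show "root ?n q > 0 \<and> root ?n q ^ ?n * ?D = (cmod (hol_form X x E))\<^sup>2"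
      using q n D by (simp add: q_def)
    fix r assume r: "r > 0 \<and> r ^ ?n * ?D = (cmod (hol_form X x E))\<^sup>2"
    then have "r ^ ?n = q" using D by (simp add: q_def field_simps)
    then show "r = root ?n q" using r real_root_pos_unique[OF n, of r q] by simp
  qed
  finally have r: "acy_rho X x = root ?n q" .
  show "acy_rho X x > 0" unfolding r using q n by simp
  show "acy_rho X x ^ ?n * ?D = (cmod (hol_form X x E))\<^sup>2" unfolding r using q n D by (simp add: q_def)
qed

section \<open>The curvature in coordinates\<close>

text \<open>Jacobi's formula by columns: the product rule in each term of the Leibniz expansion.
  Passing to the transpose makes the products in \<open>det_def\<close> run over columns.\<close>

lemma det_has_derivative:
  fixes A :: "'e::real_normed_vector \<Rightarrow> (('a::real_normed_field, 'n::finite) vec, 'n) vec"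
  assumes "\<And>i j. ((\<lambda>\<xi>. A \<xi> $ i $ j) has_derivative A' i j) (at x)"
  shows "((\<lambda>\<xi>. det (A \<xi>)) has_derivative (\<lambda>v. \<Sum>k\<in>UNIV. det (\<chi> i j. if j = k then A' i k v else A x $ i $ j))) (at x)"
proof -
  have "((\<lambda>\<xi>. det (transpose (A \<xi>))) has_derivative (\<lambda>v. \<Sum>p | p permutes UNIV. of_int (sign p) *
        (\<Sum>k\<in>UNIV. A' (p k) k v * (\<Prod>i\<in>UNIV - {k}. A x $ p i $ i)))) (at x)"
    unfolding det_def transpose_def vec_lambda_beta
    by (intro has_derivative_sum has_derivative_mult_right has_derivative_prod assms)
  moreover have "(\<Sum>p | p permutes UNIV. of_int (sign p) * (\<Sum>k\<in>UNIV. A' (p k) k v * (\<Prod>i\<in>UNIV - {k}. A x $ p i $ i)))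
     = (\<Sum>k\<in>UNIV. det (\<chi> i j. if j = k then A' i k v else A x $ i $ j))" for v
  proof -
    have "det (\<chi> i j. if j = k then A' i k v else A x $ i $ j) =
      (\<Sum>p | p permutes UNIV. of_int (sign p) * (A' (p k) k v * (\<Prod>i\<in>UNIV - {k}. A x $ p i $ i)))" for k
    proof -
      have "det (\<chi> i j. if j = k then A' i k v else A x $ i $ j) =
         (\<Sum>p | p permutes UNIV. of_int (sign p) * (\<Prod>i\<in>UNIV. if i = k then A' (p i) k v else A x $ p i $ i))"
        by (subst det_transpose[symmetric]) (simp add: det_def transpose_def)
      moreover have "(\<Prod>i\<in>UNIV. if i = k then A' (p i) k v else A x $ p i $ i) = A' (p k) k v * (\<Prod>i\<in>UNIV - {k}. A x $ p i $ i)" for p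
        by (subst prod.remove[of _ k]) auto
      ultimately show ?thesis by simp
    qed
    then show ?thesis by (simp add: sum_distrib_left sum.swap[of _ UNIV])
  qed
  ultimately show ?thesis by simp
qed

text \<open>Here \<open>m \<cdot> (q + w) = \<i> r\<close> along each of the two directions, the arrays \<open>dqS, dqT, \<dots>\<close> hold partial
  derivatives, and \<open>ST\<close>, \<open>TS\<close> mark the mixed ones.\<close>
lemma complexified_curvature_identity:
  fixes m mS mT :: complex and dm qS qT wS wT rS rT qST qTS wST wTS rST rTS :: "'n::finite \<Rightarrow> complex"
    and dqS dqT dwS dwT drS drT :: "'n \<Rightarrow> 'n \<Rightarrow> complex"
  assumes m: "m \<noteq> 0"
    and S: "\<And>j. m * (qS j + wS j) = \<i> * rS j" and T: "\<And>j. m * (qT j + wT j) = \<i> * rT j"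
    and dS: "\<And>j k. dm k * (qS j + wS j) + m * (dqS j k + dwS j k) = \<i> * drS j k"
    and dT: "\<And>j k. dm k * (qT j + wT j) + m * (dqT j k + dwT j k) = \<i> * drT j k"
    and ST: "\<And>j. mS * (qT j + wT j) + m * (qST j + wST j) = \<i> * rST j"
    and TS: "\<And>j. mT * (qS j + wS j) + m * (qTS j + wTS j) = \<i> * rTS j"
    and comm: "\<And>j. qST j - qTS j = (\<Sum>k\<in>UNIV. qS k * dqT j k - qT k * dqS j k)"
    and mS: "mS = (\<Sum>k\<in>UNIV. qS k * dm k + m * dqS k k)"
    and mT: "mT = (\<Sum>k\<in>UNIV. qT k * dm k + m * dqT k k)"
  shows "m * (wST j - wTS j + (\<Sum>k\<in>UNIV. wS k * dwT j k - wT k * dwS j k)) =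
      \<i> * (rST j - rTS j + (\<Sum>k\<in>UNIV. wS k * drT j k - wT k * drS j k - (rT k * dwS j k - rS k * dwT j k) + dwS k k * rT j - dwT k k * rS j))
      + 1 / m * (\<Sum>k\<in>UNIV. rS k * drT j k - rT k * drS j k + drS k k * rT j - drT k k * rS j)
      - (\<Sum>k\<in>UNIV. dm k / m\<^sup>2 * (rS k * rT j - rT k * rS j))"
proof -
  \<comment> \<open>\<open>?Q r j\<close> is \<open>q + w\<close> solved from the horizontality
    equation. It and its derivatives remove \<open>q\<close>, after which \<open>comm\<close>,
    \<open>mS\<close> and \<open>mT\<close> leave no parameter derivative of
    \<open>m\<close>.\<close>
  let ?Q = "\<lambda>r j. \<i> * r j / m"
  have qS: "qS j = ?Q rS j - wS j" and qT: "qT j = ?Q rT j - wT j" for j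
    using S[of j] T[of j] m by (simp_all add: field_simps)
  have dqS: "dqS j k = (\<i> * drS j k - dm k * ?Q rS j) / m - dwS j k" for j k
    using dS[of k j] m unfolding qS by (simp add: field_simps)
  have dqT: "dqT j k = (\<i> * drT j k - dm k * ?Q rT j) / m - dwT j k" for j k
    using dT[of k j] m unfolding qT by (simp add: field_simps)
  have "m * (wST j - wTS j) = \<i> * (rST j - rTS j) - m * (qST j - qTS j) - mS * ?Q rT j + mT * ?Q rS j"
    using ST[of j] TS[of j] unfolding qS qT by (simp add: algebra_simps)
  also have "\<dots> = \<i> * (rST j - rTS j) + (\<Sum>k\<in>UNIV. - m * (qS k * dqT j k - qT k * dqS j k)
      - (qS k * dm k + m * dqS k k) * ?Q rT j + (qT k * dm k + m * dqT k k) * ?Q rS j)"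
    unfolding comm mS mT by (simp add: sum_subtractf sum.distrib sum_distrib_left sum_distrib_right algebra_simps sum_negf)
  finally have 1: "m * (wST j - wTS j + (\<Sum>k\<in>UNIV. wS k * dwT j k - wT k * dwS j k)) = \<i> * (rST j - rTS j) +
     (\<Sum>k\<in>UNIV. - m * (qS k * dqT j k - qT k * dqS j k)
      - (qS k * dm k + m * dqS k k) * ?Q rT j + (qT k * dm k + m * dqT k k) * ?Q rS j + m * (wS k * dwT j k - wT k * dwS j k))"
    by (simp add: distrib_left sum.distrib sum_distrib_left)
  \<comment> \<open>Field algebra separately for each \<open>k\<close>; on the right the horizontal
    components survive only in the bracket with factor \<i>.\<close>
  have 2: "- m * (qS k * dqT j k - qT k * dqS j k)
      - (qS k * dm k + m * dqS k k) * ?Q rT j + (qT k * dm k + m * dqT k k) * ?Q rS j + m * (wS k * dwT j k - wT k * dwS j k)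
    = \<i> * (wS k * drT j k - wT k * drS j k - (rT k * dwS j k - rS k * dwT j k) + dwS k k * rT j - dwT k k * rS j)
      + 1 / m * (rS k * drT j k - rT k * drS j k + drS k k * rT j - drT k k * rS j)
      - dm k / m\<^sup>2 * (rS k * rT j - rT k * rS j)" for k
  proof -
    show ?thesis
      unfolding qS qT dqS dqT using m by (simp add: field_simps power2_eq_square)
  qed
  show ?thesis unfolding 1 2
    by (simp add: sum.distrib sum_subtractf sum_distrib_left algebra_simps)
qed

lemma differentiable_bounded_linear:
  assumes "bounded_linear L" "f differentiable (at x)"
  shows "(\<lambda>y. L (f y)) differentiable (at x)"
  by (rule differentiableI[OF bounded_linear.has_derivative[OF assms(1) has_derivative_frechet_derivative[OF assms(2)]]])

lemma det_differentiable:
  fixes A :: "'e::real_normed_vector \<Rightarrow> (('a::real_normed_field, 'n::finite) vec, 'n) vec"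
  assumes "\<And>i j. (\<lambda>\<xi>. A \<xi> $ i $ j) differentiable (at x)"
  shows "(\<lambda>\<xi>. det (A \<xi>)) differentiable (at x)"
  by (rule differentiableI[OF det_has_derivative[OF has_derivative_frechet_derivative[OF assms]]])

text \<open>\<open>'e\<close> will be the product of the parameter space with the model space of
  \<open>L\<close>, so that parameter and coordinate directions are treated alike;
  \<open>\<Phi>\<close> is the family in a complex chart, \<open>a\<close> the coefficient of
  \<Omega> in that chart, and \<open>Y\<close> lists the coordinate directions of
  \<open>L\<close>.\<close>

locale lagrangian_coords =
  fixes W :: "'e::real_normed_vector set" and \<Phi> :: "'e \<Rightarrow> (complex, 'n::finite) vec"
    and a :: "(complex, 'n) vec \<Rightarrow> complex" and Y :: "'n \<Rightarrow> 'e"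
  assumes W: "open W" and smooth: "smooth_on W \<Phi>"
    and holo: "\<And>x. x \<in> W \<Longrightarrow> \<exists>D. (a has_derivative D) (at (\<Phi> x)) \<and> (\<forall>u. D (\<i> *s u) = \<i> * D u)"
    and positive: "\<And>x. x \<in> W \<Longrightarrow> Re (a (\<Phi> x) * det (\<chi> i j. dirderiv (Y j) \<Phi> x $ i)) > 0"
begin

definition P where "P x = (\<chi> i j. dirderiv (Y j) \<Phi> x $ i)"

definition m where "m x = a (\<Phi> x) * det (P x)"

text \<open>\<open>q d\<close> are the complex components of the velocity \<open>dirderiv d \<Phi>\<close> in the frame \<open>P\<close>,
  \<open>w d\<close> is the horizontal field, and \<open>\<i> r / m = q + w\<close>.\<close>
definition q where
  "q d x = (\<chi> k. det (\<chi> i j. if j = k then dirderiv d \<Phi> x $ i else P x $ i $ j) / det (P x))"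

definition w where "w d x = (\<chi> k. - Re (m x * q d x $ k) / Re (m x))"

definition r where "r d x = (\<chi> k. Im (m x * (q d x $ k + of_real (w d x $ k))))"

lemma pos: "x \<in> W \<Longrightarrow> Re (m x) > 0"
  using positive unfolding m_def P_def .

lemma m_nz: "x \<in> W \<Longrightarrow> m x \<noteq> 0" using pos by fastforce

lemma det_nz: "x \<in> W \<Longrightarrow> det (P x) \<noteq> 0" using m_nz unfolding m_def by auto

lemma deriv_\<Phi>_differentiable: "x \<in> W \<Longrightarrow> dirderiv d \<Phi> differentiable (at x)"
  by (rule smooth_on_differentiable[OF smooth_on_dirderiv[OF smooth]])

lemma dd_nth_diff: "x \<in> W \<Longrightarrow> (\<lambda>x. dirderiv d \<Phi> x $ i) differentiable (at x)"
  by (rule differentiable_bounded_linear[OF bounded_linear_vec_nth deriv_\<Phi>_differentiable])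

lemma P_diff: "x \<in> W \<Longrightarrow> (\<lambda>x. P x $ i $ j) differentiable (at x)"
  unfolding P_def by (simp add: dd_nth_diff)

text \<open>Cramer's rule; defining \<open>q\<close> by it reduces differentiability of
  \<open>q\<close> to that of determinants.\<close>

lemma P_mult_q: "x \<in> W \<Longrightarrow> P x *v q d x = dirderiv d \<Phi> x"
  unfolding q_def by (subst cramer[OF det_nz]) auto

lemma velocity_nth: "x \<in> W \<Longrightarrow> dirderiv d \<Phi> x $ i = (\<Sum>k\<in>UNIV. q d x $ k * dirderiv (Y k) \<Phi> x $ i)"
  using P_mult_q[of x d] by (auto simp: vec_eq_iff matrix_vector_mult_def P_def mult.commute)

lemma q_diff:
  assumes "x \<in> W"
  shows "(\<lambda>x. q d x $ k) differentiable (at x)"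
proof -
  have 1: "(\<lambda>x. det (P x)) differentiable (at x)" by (rule det_differentiable[OF P_diff[OF assms]])
  have 2: "(\<lambda>x. det (\<chi> i j. if j = k then dirderiv d \<Phi> x $ i else P x $ i $ j)) differentiable (at x)"
  proof (rule det_differentiable)
    fix i j show "(\<lambda>x. (\<chi> i j. if j = k then dirderiv d \<Phi> x $ i else P x $ i $ j) $ i $ j) differentiable (at x)"
      using dd_nth_diff[OF assms] P_diff[OF assms] by (cases "j = k") auto
  qed
  show ?thesis unfolding q_def vec_lambda_beta by (rule differentiable_divide[OF 2 1 det_nz[OF assms]])
qed

lemma a_diff:
  assumes "x \<in> W"
  shows "(\<lambda>x. a (\<Phi> x)) differentiable (at x)"
proof -
  obtain D where "(a has_derivative D) (at (\<Phi> x))" using holo[OF assms] by blast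
  then have "a differentiable (at (\<Phi> x))" by (rule differentiableI)
  from differentiable_chain_at[OF smooth_on_differentiable[OF smooth assms] this]
  show ?thesis by (simp add: o_def)
qed

lemma m_diff: "x \<in> W \<Longrightarrow> m differentiable (at x)"
  unfolding m_def[abs_def] by (intro differentiable_mult a_diff det_differentiable P_diff)

lemma w_diff:
  assumes "x \<in> W"
  shows "(\<lambda>x. w d x $ k) differentiable (at x)"
proof -
  have "(\<lambda>x. - Re (m x * q d x $ k)) differentiable (at x)"
    by (intro differentiable_minus differentiable_bounded_linear[OF bounded_linear_Re] differentiable_mult m_diff q_diff assms)
  moreover have "(\<lambda>x. Re (m x)) differentiable (at x)"
    by (intro differentiable_bounded_linear[OF bounded_linear_Re] m_diff assms)
  ultimately show ?thesis unfolding w_def vec_lambda_beta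
    using pos[OF assms] by (intro differentiable_divide) auto
qed

lemma of_real_w_diff: "x \<in> W \<Longrightarrow> (\<lambda>x. complex_of_real (w d x $ k)) differentiable (at x)"
  by (rule differentiable_bounded_linear[OF bounded_linear_of_real w_diff])

lemma r_diff: "x \<in> W \<Longrightarrow> (\<lambda>x. r d x $ k) differentiable (at x)"
  unfolding r_def vec_lambda_beta
  by (intro differentiable_bounded_linear[OF bounded_linear_Im] differentiable_mult differentiable_add m_diff q_diff of_real_w_diff)

lemma m_q_w: "x \<in> W \<Longrightarrow> m x * (q d x $ k + of_real (w d x $ k)) = \<i> * of_real (r d x $ k)"
  using pos[of x] by (simp add: complex_eq_iff r_def w_def field_simps)

lemma deriv_m_q_w:
  assumes "x \<in> W"
  shows "dirderiv v m x * (q d x $ k + of_real (w d x $ k))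
       + m x * (dirderiv v (\<lambda>x. q d x $ k) x + of_real (dirderiv v (\<lambda>x. w d x $ k) x))
     = \<i> * of_real (dirderiv v (\<lambda>x. r d x $ k) x)"
proof -
  have "dirderiv v (\<lambda>x. m x * (q d x $ k + of_real (w d x $ k))) x = dirderiv v (\<lambda>x. \<i> * of_real (r d x $ k)) x"
    by (rule dirderiv_cong[OF W assms m_q_w])
  moreover have "bounded_linear (\<lambda>u::real. \<i> * complex_of_real u)"
    by (intro bounded_linear_const_mult bounded_linear_of_real)
  note dirderiv_linear[OF this r_diff[OF assms, of d k], of v]
  ultimately show ?thesis
    by (simp add: dirderiv_mult dirderiv_add m_diff q_diff of_real_w_diff assms
        dirderiv_linear[OF bounded_linear_of_real w_diff] add.commute)
qed

lemma mixed_nth: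
  assumes "x \<in> W"
  shows "dirderiv v (dirderiv d \<Phi>) x $ i = (\<Sum>k\<in>UNIV. q d x $ k * dirderiv v (dirderiv (Y k) \<Phi>) x $ i
      + dirderiv v (\<lambda>x. q d x $ k) x * dirderiv (Y k) \<Phi> x $ i)"
proof -
  have "dirderiv v (dirderiv d \<Phi>) x $ i = dirderiv v (\<lambda>x. dirderiv d \<Phi> x $ i) x"
    by (rule dirderiv_linear[OF bounded_linear_vec_nth deriv_\<Phi>_differentiable[OF assms], symmetric])
  also have "\<dots> = dirderiv v (\<lambda>x. \<Sum>k\<in>UNIV. q d x $ k * dirderiv (Y k) \<Phi> x $ i) x"
    by (rule dirderiv_cong[OF W assms velocity_nth])
  also have "\<dots> = (\<Sum>k\<in>UNIV. q d x $ k * dirderiv v (\<lambda>x. dirderiv (Y k) \<Phi> x $ i) x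
      + dirderiv v (\<lambda>x. q d x $ k) x * dirderiv (Y k) \<Phi> x $ i)"
    by (subst dirderiv_sum) (simp_all add: dirderiv_mult q_diff dd_nth_diff assms)
  finally show ?thesis by (simp add: dirderiv_linear[OF bounded_linear_vec_nth deriv_\<Phi>_differentiable[OF assms]])
qed

lemma deriv_commute: "x \<in> W \<Longrightarrow> dirderiv v (dirderiv d \<Phi>) x = dirderiv d (dirderiv v \<Phi>) x"
  by (rule smooth_on_dirderiv_symmetric[OF W _ smooth])

text \<open>The complex vector fields \<open>v - q v\<close> annihilate \<open>\<Phi>\<close>, hence commute.\<close>
lemma commutator:
  assumes x: "x \<in> W"
  shows "dirderiv S (\<lambda>x. q T x $ j) x - dirderiv T (\<lambda>x. q S x $ j) x =
    (\<Sum>k\<in>UNIV. q S x $ k * dirderiv (Y k) (\<lambda>x. q T x $ j) x - q T x $ k * dirderiv (Y k) (\<lambda>x. q S x $ j) x)"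
proof -
  let ?dq = "\<lambda>v d j. dirderiv v (\<lambda>x. q d x $ j) x"
  let ?\<Phi>j = "\<lambda>j i. dirderiv (Y j) \<Phi> x $ i"
  let ?\<Phi>jk = "\<lambda>j k i. dirderiv (Y k) (dirderiv (Y j) \<Phi>) x $ i"
  \<comment> \<open>Writing both velocities in the frame \<open>P\<close> leaves a part with second
    \<open>Y\<close>-derivatives of \<open>\<Phi>\<close>, symmetric in \<open>S\<close> and
    \<open>T\<close>, and a part linear in the columns of \<open>P\<close>.\<close>
  have main: "dirderiv T (dirderiv S \<Phi>) x $ i = (\<Sum>k\<in>UNIV. \<Sum>j\<in>UNIV. q S x $ k * q T x $ j * ?\<Phi>jk j k i)
      + (\<Sum>j\<in>UNIV. (\<Sum>k\<in>UNIV. q S x $ k * ?dq (Y k) T j) * ?\<Phi>j j i) + (\<Sum>j\<in>UNIV. ?dq T S j * ?\<Phi>j j i)" for S T i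
  proof -
    have "dirderiv T (dirderiv (Y k) \<Phi>) x $ i = (\<Sum>j\<in>UNIV. q T x $ j * ?\<Phi>jk j k i + ?dq (Y k) T j * ?\<Phi>j j i)" for k
      by (subst deriv_commute[OF x]) (rule mixed_nth[OF x])
    then have "dirderiv T (dirderiv S \<Phi>) x $ i = (\<Sum>k\<in>UNIV. \<Sum>j\<in>UNIV. q S x $ k * q T x $ j * ?\<Phi>jk j k i)
      + (\<Sum>k\<in>UNIV. \<Sum>j\<in>UNIV. q S x $ k * ?dq (Y k) T j * ?\<Phi>j j i) + (\<Sum>j\<in>UNIV. ?dq T S j * ?\<Phi>j j i)"
      by (subst mixed_nth[OF x]) (simp add: sum.distrib sum_distrib_left distrib_left mult.assoc)
    also have "(\<Sum>k\<in>UNIV. \<Sum>j\<in>UNIV. q S x $ k * ?dq (Y k) T j * ?\<Phi>j j i) = (\<Sum>j\<in>UNIV. (\<Sum>k\<in>UNIV. q S x $ k * ?dq (Y k) T j) * ?\<Phi>j j i)"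
      by (subst sum.swap) (simp add: sum_distrib_right)
    finally show ?thesis .
  qed
  have sw: "(\<Sum>k\<in>UNIV. \<Sum>j\<in>UNIV. q S x $ k * q T x $ j * ?\<Phi>jk j k i) = (\<Sum>k\<in>UNIV. \<Sum>j\<in>UNIV. q T x $ k * q S x $ j * ?\<Phi>jk j k i)" for i
  proof -
    have "?\<Phi>jk j k i = ?\<Phi>jk k j i" for j k unfolding deriv_commute[OF x, of "Y k" "Y j"] ..
    then show ?thesis by (subst sum.swap, intro sum.cong refl) (simp only: mult_ac)
  qed
  \<comment> \<open>The difference of the two sides of the claim; the commuting derivatives of
    \<open>\<Phi>\<close> put it into the kernel of the invertible \<open>P x\<close>.\<close>
  define z where "z = (\<chi> j. ?dq S T j - ?dq T S j - (\<Sum>k\<in>UNIV. q S x $ k * ?dq (Y k) T j - q T x $ k * ?dq (Y k) S j))"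
  have "P x *v z = 0"
  proof -
    have "(P x *v z) $ i = 0" for i
    proof -
      have "(P x *v z) $ i = (\<Sum>j\<in>UNIV. ?dq S T j * ?\<Phi>j j i) + (\<Sum>j\<in>UNIV. (\<Sum>k\<in>UNIV. q T x $ k * ?dq (Y k) S j) * ?\<Phi>j j i)
         - (\<Sum>j\<in>UNIV. ?dq T S j * ?\<Phi>j j i) - (\<Sum>j\<in>UNIV. (\<Sum>k\<in>UNIV. q S x $ k * ?dq (Y k) T j) * ?\<Phi>j j i)"
        by (simp add: matrix_vector_mult_def P_def z_def sum_subtractf algebra_simps sum.distrib)
      also have "\<dots> = dirderiv S (dirderiv T \<Phi>) x $ i - dirderiv T (dirderiv S \<Phi>) x $ i"
        unfolding main[of S T] main[of T S] using sw[of i] by simp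
      also have "\<dots> = 0" using deriv_commute[OF x, of S T] by simp
      finally show ?thesis .
    qed
    then show ?thesis by (simp add: vec_eq_iff)
  qed
  then have "z = 0" using cramer[OF det_nz[OF x], of z 0] cramer[OF det_nz[OF x], of 0 0] by simp
  then show ?thesis by (simp add: z_def vec_eq_iff)
qed

text \<open>Closedness of \<open>\<Phi>\<^sup>* \<Omega>\<close>: the derivative of \<open>m\<close> is the divergence of \<open>m q\<close>.\<close>
lemma deriv_m:
  assumes x: "x \<in> W"
  shows "dirderiv d m x = (\<Sum>k\<in>UNIV. q d x $ k * dirderiv (Y k) m x + m x * dirderiv (Y k) (\<lambda>x. q d x $ k) x)"
proof -
  let ?dq = "\<lambda>v j. dirderiv v (\<lambda>x. q d x $ j) x"
  let ?\<Phi>jk = "\<lambda>j k i. dirderiv (Y k) (dirderiv (Y j) \<Phi>) x $ i"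
  let ?col = "\<lambda>k c. det (\<chi> i j. if j = k then c i else P x $ i $ j)"
  have dP: "((\<lambda>x. P x $ i $ j) has_derivative (\<lambda>v. dirderiv v (dirderiv (Y j) \<Phi>) x $ i)) (at x)" for i j
    unfolding P_def vec_lambda_beta
    by (rule bounded_linear.has_derivative[OF bounded_linear_vec_nth has_derivative_frechet_derivative[OF deriv_\<Phi>_differentiable[OF x]]])
  have ddet: "dirderiv v (\<lambda>x. det (P x)) x = (\<Sum>k\<in>UNIV. ?col k (\<lambda>i. dirderiv v (dirderiv (Y k) \<Phi>) x $ i))" for v
    by (rule dirderivI[OF det_has_derivative[OF dP]])
  \<comment> \<open>The \<open>k\<close>-th column of \<open>P\<close> changes by transport along
    \<open>q\<close> plus \<open>P\<close> applied to the \<open>Y k\<close>-derivative of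
    \<open>q\<close>. By Cramer's identity the latter contributes only its \<open>k\<close>-th
    component, and these sum to the divergence of \<open>q\<close>.\<close>
  have det_d: "dirderiv d (\<lambda>x. det (P x)) x = (\<Sum>k\<in>UNIV. q d x $ k * dirderiv (Y k) (\<lambda>x. det (P x)) x + det (P x) * ?dq (Y k) k)"
  proof -
    have lin: "?col k (\<lambda>i. (\<Sum>j\<in>UNIV. c j * f j i) + b i) = (\<Sum>j\<in>UNIV. c j * ?col k (f j)) + ?col k b" for k b f and c :: "'n \<Rightarrow> complex"
    proof -
      have tr: "?col k g = det (\<chi> j. if j = k then (\<chi> i. g i) else (\<chi> i. P x $ i $ j))" for g
      proof -
        have "transpose (\<chi> i j. if j = k then g i else P x $ i $ j) = (\<chi> j. if j = k then (\<chi> i. g i) else (\<chi> i. P x $ i $ j))"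
          by (simp add: transpose_def vec_eq_iff)
        then show ?thesis by (subst det_transpose[symmetric]) (simp only:)
      qed
      have "(\<chi> i. (\<Sum>j\<in>UNIV. c j * f j i) + b i) = (\<Sum>j\<in>UNIV. c j *s (\<chi> i. f j i)) + (\<chi> i. b i)"
        by (simp add: vec_eq_iff)
      moreover have "det (\<chi> j. if j = k then (\<Sum>j\<in>UNIV. c j *s (\<chi> i. f j i)) else (\<chi> i. P x $ i $ j))
          = (\<Sum>l\<in>UNIV. c l * det (\<chi> j. if j = k then (\<chi> i. f l i) else (\<chi> i. P x $ i $ j)))"
        by (rule trans[OF det_linear_row_sum[OF finite, where k = k and a = "\<lambda>_ j. c j *s (\<chi> i. f j i)" and c = "\<lambda>j. (\<chi> i. P x $ i $ j)"]])
          (simp only: det_row_mul)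
      ultimately show ?thesis by (simp only: tr det_row_add)
    qed
    have "dirderiv d (dirderiv (Y k) \<Phi>) x $ i = (\<Sum>j\<in>UNIV. q d x $ j * dirderiv (Y j) (dirderiv (Y k) \<Phi>) x $ i)
        + (P x *v (\<chi> j. ?dq (Y k) j)) $ i" for i k
    proof -
      have "dirderiv d (dirderiv (Y k) \<Phi>) x $ i = (\<Sum>j\<in>UNIV. q d x $ j * dirderiv (Y k) (dirderiv (Y j) \<Phi>) x $ i + ?dq (Y k) j * dirderiv (Y j) \<Phi> x $ i)"
        by (subst deriv_commute[OF x]) (rule mixed_nth[OF x])
      moreover have "dirderiv (Y k) (dirderiv (Y j) \<Phi>) x = dirderiv (Y j) (dirderiv (Y k) \<Phi>) x" for j by (rule deriv_commute[OF x])
      ultimately show ?thesis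
        by (simp add: sum.distrib matrix_vector_mult_def P_def mult.commute)
    qed
    then have "dirderiv d (\<lambda>x. det (P x)) x = (\<Sum>k\<in>UNIV. (\<Sum>j\<in>UNIV. q d x $ j * ?col k (\<lambda>i. dirderiv (Y j) (dirderiv (Y k) \<Phi>) x $ i))
        + ?dq (Y k) k * det (P x))"
      unfolding ddet by (simp only: lin cramer_lemma vec_lambda_beta)
    also have "\<dots> = (\<Sum>j\<in>UNIV. q d x $ j * dirderiv (Y j) (\<lambda>x. det (P x)) x) + (\<Sum>k\<in>UNIV. ?dq (Y k) k * det (P x))"
      unfolding ddet sum_distrib_left sum.distrib by (subst sum.swap) (rule refl)
    finally show ?thesis by (simp add: sum.distrib mult.commute)
  qed
  \<comment> \<open>Complex linearity of the differential of \<open>a\<close> is what allows the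
    complex coefficients \<open>q\<close> to be pulled out of the derivative.\<close>
  obtain D where D: "(a has_derivative D) (at (\<Phi> x))" "\<And>u. D (\<i> *s u) = \<i> * D u" using holo[OF x] by blast
  have linD: "linear D" using D(1) by (rule has_derivative_linear)
  have cD: "D (c *s u) = c * D u" for c u
    by (rule linear_imp_complex_linear[OF linD D(2)])
  have da: "dirderiv v (\<lambda>x. a (\<Phi> x)) x = D (dirderiv v \<Phi> x)" for v
    using dirderivI[OF diff_chain_at[OF has_derivative_frechet_derivative[OF smooth_on_differentiable[OF smooth x]] D(1)]]
    by (simp add: o_def)
  have "dirderiv d \<Phi> x = (\<Sum>k\<in>UNIV. q d x $ k *s dirderiv (Y k) \<Phi> x)"
    using velocity_nth[OF x, of d] by (simp add: vec_eq_iff)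
  then have a_d: "dirderiv d (\<lambda>x. a (\<Phi> x)) x = (\<Sum>k\<in>UNIV. q d x $ k * dirderiv (Y k) (\<lambda>x. a (\<Phi> x)) x)"
    unfolding da by (simp add: linear_sum[OF linD] cD)
  have mm: "dirderiv v m x = a (\<Phi> x) * dirderiv v (\<lambda>x. det (P x)) x + dirderiv v (\<lambda>x. a (\<Phi> x)) x * det (P x)" for v
    unfolding m_def[abs_def] by (rule dirderiv_mult[OF a_diff[OF x] det_differentiable[OF P_diff[OF x]]])
  show ?thesis
    unfolding mm[of d] det_d a_d unfolding mm
    by (simp add: m_def sum_distrib_left sum_distrib_right sum.distrib algebra_simps)
qed

lemma inverse_m_derivative:
  assumes x: "x \<in> W"
  shows "(\<lambda>x. Re (1 / m x)) differentiable (at x)"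
    and "dirderiv v (\<lambda>x. Re (1 / m x)) x = - Re (dirderiv v m x / (m x)\<^sup>2)"
proof -
  have "((\<lambda>x. 1 / m x) has_derivative (\<lambda>v. - dirderiv v m x / (m x)\<^sup>2)) (at x)"
    using m_nz[OF x] by (auto intro!: derivative_eq_intros has_derivative_frechet_derivative[OF m_diff[OF x]] simp: power2_eq_square divide_simps)
  from bounded_linear.has_derivative[OF bounded_linear_Re this]
  have *: "((\<lambda>x. Re (1 / m x)) has_derivative (\<lambda>v. - Re (dirderiv v m x / (m x)\<^sup>2))) (at x)" by simp
  show "(\<lambda>x. Re (1 / m x)) differentiable (at x)" by (rule differentiableI[OF *])
  show "dirderiv v (\<lambda>x. Re (1 / m x)) x = - Re (dirderiv v m x / (m x)\<^sup>2)" by (rule dirderivI[OF *])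
qed

lemma Re_inverse_m_pos: "x \<in> W \<Longrightarrow> Re (1 / m x) > 0"
  using pos[of x] m_nz[of x] by (simp add: Re_divide sum_power2_gt_zero_iff)

text \<open>Components along the \<open>Y k\<close> of the commutator of the lifts
  \<open>S + w S\<close> and \<open>T + w T\<close>; the constant directions \<open>S\<close> and
  \<open>T\<close> commute.\<close>

definition horizontal_curvature :: "'e \<Rightarrow> 'e \<Rightarrow> 'e \<Rightarrow> 'n \<Rightarrow> real" where
  "horizontal_curvature S T x j = dirderiv S (\<lambda>x. w T x $ j) x - dirderiv T (\<lambda>x. w S x $ j) x +
     (\<Sum>k\<in>UNIV. w S x $ k * dirderiv (Y k) (\<lambda>x. w T x $ j) x - w T x $ k * dirderiv (Y k) (\<lambda>x. w S x $ j) x)"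

lemma horizontal_curvature_formula:
  assumes x: "x \<in> W"
  shows "Re (m x) * horizontal_curvature S T x j =
     Re (1 / m x) * (\<Sum>k\<in>UNIV. r S x $ k * dirderiv (Y k) (\<lambda>x. r T x $ j) x - r T x $ k * dirderiv (Y k) (\<lambda>x. r S x $ j) x
        + dirderiv (Y k) (\<lambda>x. r S x $ k) x * r T x $ j - dirderiv (Y k) (\<lambda>x. r T x $ k) x * r S x $ j)
     + (\<Sum>k\<in>UNIV. dirderiv (Y k) (\<lambda>x. Re (1 / m x)) x * (r S x $ k * r T x $ j - r T x $ k * r S x $ j))"
proof -
  let ?c = "complex_of_real"
  let ?dw = "\<lambda>v d j. dirderiv v (\<lambda>x. w d x $ j) x"
  let ?dr = "\<lambda>v d j. dirderiv v (\<lambda>x. r d x $ j) x"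
  let ?dq = "\<lambda>v d j. dirderiv v (\<lambda>x. q d x $ j) x"
  let ?N = "\<Sum>k\<in>UNIV. r S x $ k * ?dr (Y k) T j - r T x $ k * ?dr (Y k) S j + ?dr (Y k) S k * r T x $ j - ?dr (Y k) T k * r S x $ j"
  let ?e = "\<lambda>k. r S x $ k * r T x $ j - r T x $ k * r S x $ j"
  define R where "R = ?dr S T j - ?dr T S j + (\<Sum>k\<in>UNIV. w S x $ k * ?dr (Y k) T j - w T x $ k * ?dr (Y k) S j
     - (r T x $ k * ?dw (Y k) S j - r S x $ k * ?dw (Y k) T j) + ?dw (Y k) S k * r T x $ j - ?dw (Y k) T k * r S x $ j)"
  from complexified_curvature_identity[where qS = "\<lambda>j. q S x $ j" and qT = "\<lambda>j. q T x $ j"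
          and wS = "\<lambda>j. ?c (w S x $ j)" and wT = "\<lambda>j. ?c (w T x $ j)" and rS = "\<lambda>j. ?c (r S x $ j)" and rT = "\<lambda>j. ?c (r T x $ j)"
          and qST = "?dq S T" and qTS = "?dq T S" and wST = "\<lambda>j. ?c (?dw S T j)" and wTS = "\<lambda>j. ?c (?dw T S j)"
          and rST = "\<lambda>j. ?c (?dr S T j)" and rTS = "\<lambda>j. ?c (?dr T S j)" and m = "m x" and mS = "dirderiv S m x" and mT = "dirderiv T m x"
          and dm = "\<lambda>k. dirderiv (Y k) m x" and dqS = "\<lambda>j k. ?dq (Y k) S j" and dqT = "\<lambda>j k. ?dq (Y k) T j"
          and dwS = "\<lambda>j k. ?c (?dw (Y k) S j)" and dwT = "\<lambda>j k. ?c (?dw (Y k) T j)"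
          and drS = "\<lambda>j k. ?c (?dr (Y k) S j)" and drT = "\<lambda>j k. ?c (?dr (Y k) T j)",
        OF m_nz[OF x] m_q_w[OF x] m_q_w[OF x] deriv_m_q_w[OF x] deriv_m_q_w[OF x] deriv_m_q_w[OF x] deriv_m_q_w[OF x]
           commutator[OF x] deriv_m[OF x] deriv_m[OF x], of j]
  have "m x * ?c (horizontal_curvature S T x j) = \<i> * ?c R + 1 / m x * ?c ?N - (\<Sum>k\<in>UNIV. dirderiv (Y k) m x / (m x)\<^sup>2 * ?c (?e k))"
    unfolding horizontal_curvature_def R_def by simp
  \<comment> \<open>\<open>R\<close> is real, so the summand \<open>\<i> * R\<close>, which carries
    every term on the right that involves \<open>w\<close>, has no real part.\<close>
  then have "Re (m x * ?c (horizontal_curvature S T x j)) = Re (\<i> * ?c R + 1 / m x * ?c ?N - (\<Sum>k\<in>UNIV. dirderiv (Y k) m x / (m x)\<^sup>2 * ?c (?e k)))"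
    by (rule arg_cong)
  then have "Re (m x) * horizontal_curvature S T x j = Re (1 / m x) * ?N - (\<Sum>k\<in>UNIV. Re (dirderiv (Y k) m x / (m x)\<^sup>2) * ?e k)"
    by (simp only: Re_complex_of_real Im_complex_of_real minus_complex.sel plus_complex.sel times_complex.sel Re_sum imaginary_unit.sel) simp
  then show ?thesis unfolding inverse_m_derivative(2)[OF x] by (simp add: sum_negf)
qed

text \<open>The components of the gradient of the function generating the deformation in direction \<open>d\<close>.\<close>
definition gfield where "gfield d x = - Re (1 / m x) *\<^sub>R r d x"

lemma gfield_diff:
  assumes x: "x \<in> W"
  shows "(\<lambda>x. gfield d x $ j) differentiable (at x)"
    and "dirderiv v (\<lambda>x. gfield d x $ j) x =
      - (Re (1 / m x) * dirderiv v (\<lambda>x. r d x $ j) x + dirderiv v (\<lambda>x. Re (1 / m x)) x * r d x $ j)"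
proof -
  have g: "(\<lambda>x. gfield d x $ j) = (\<lambda>x. - (Re (1 / m x) * r d x $ j))" by (simp add: gfield_def)
  have p: "(\<lambda>x. Re (1 / m x) * r d x $ j) differentiable (at x)"
    by (intro differentiable_mult inverse_m_derivative(1) r_diff x)
  show "(\<lambda>x. gfield d x $ j) differentiable (at x)" unfolding g by (rule differentiable_minus[OF p])
  have "dirderiv v (\<lambda>x. - (Re (1 / m x) * r d x $ j)) x = - dirderiv v (\<lambda>x. Re (1 / m x) * r d x $ j) x"
    by (rule dirderiv_linear[OF bounded_linear_minus[OF bounded_linear_ident] p])
  then show "dirderiv v (\<lambda>x. gfield d x $ j) x =
      - (Re (1 / m x) * dirderiv v (\<lambda>x. r d x $ j) x + dirderiv v (\<lambda>x. Re (1 / m x)) x * r d x $ j)"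
    unfolding g by (simp only: dirderiv_mult[OF inverse_m_derivative(1)[OF x] r_diff[OF x]])
qed

text \<open>In terms of \<open>gfield\<close> the identity is a Lie bracket plus divergences with
  respect to the density \<open>1 / \<psi>\<close>, whose logarithmic derivative is minus that of
  \<open>\<psi> = Re (1 / m)\<close>. The factor \<open>Re m * Re (1 / m)\<close> is the squared
  cosine of the Lagrangian angle.\<close>

lemma horizontal_curvature_gfield:
  assumes x: "x \<in> W"
  shows "Re (m x) * Re (1 / m x) * horizontal_curvature S T x j = (\<Sum>k\<in>UNIV.
      gfield S x $ k * dirderiv (Y k) (\<lambda>x. gfield T x $ j) x - gfield T x $ k * dirderiv (Y k) (\<lambda>x. gfield S x $ j) x
      + (dirderiv (Y k) (\<lambda>x. gfield S x $ k) x - dirderiv (Y k) (\<lambda>x. Re (1 / m x)) x / Re (1 / m x) * gfield S x $ k) * gfield T x $ j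
      - (dirderiv (Y k) (\<lambda>x. gfield T x $ k) x - dirderiv (Y k) (\<lambda>x. Re (1 / m x)) x / Re (1 / m x) * gfield T x $ k) * gfield S x $ j)"
proof -
  define \<psi> where "\<psi> = Re (1 / m x)"
  have \<psi>: "\<psi> \<noteq> 0" using Re_inverse_m_pos[OF x] by (simp add: \<psi>_def)
  have "Re (m x) * \<psi> * horizontal_curvature S T x j = \<psi> * (Re (m x) * horizontal_curvature S T x j)" by simp
  also have "\<dots> = (\<Sum>k\<in>UNIV. \<psi> * (\<psi> * (r S x $ k * dirderiv (Y k) (\<lambda>x. r T x $ j) x - r T x $ k * dirderiv (Y k) (\<lambda>x. r S x $ j) x
        + dirderiv (Y k) (\<lambda>x. r S x $ k) x * r T x $ j - dirderiv (Y k) (\<lambda>x. r T x $ k) x * r S x $ j)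
     + dirderiv (Y k) (\<lambda>x. Re (1 / m x)) x * (r S x $ k * r T x $ j - r T x $ k * r S x $ j)))"
    unfolding horizontal_curvature_formula[OF x] \<psi>_def[symmetric] by (simp add: sum_distrib_left sum.distrib distrib_left)
  finally show ?thesis
    unfolding gfield_diff(2)[OF x] unfolding gfield_def \<psi>_def[symmetric] using \<psi>
    by (simp add: field_simps)
qed

section \<open>Differentiation of functions along horizontal lifts\<close>

definition hderiv :: "'e \<Rightarrow> ('e \<Rightarrow> real) \<Rightarrow> 'e \<Rightarrow> real" where
  "hderiv d l x = dirderiv d l x + (\<Sum>k\<in>UNIV. w d x $ k * dirderiv (Y k) l x)"

lemma hderiv_differentiable:
  assumes l: "smooth_on W l" and x: "x \<in> W"
  shows "hderiv d l differentiable (at x)"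
  unfolding hderiv_def[abs_def]
  by (rule differentiable_add) (auto intro!: differentiable_sum differentiable_mult w_diff smooth_on_differentiable[OF smooth_on_dirderiv[OF l]] x)

text \<open>The second derivatives of \<open>l\<close> along the two lifts are symmetric and cancel,
  leaving the commutator field applied to \<open>l\<close>.\<close>

lemma hderiv_commutator:
  assumes l: "smooth_on W l" and x: "x \<in> W"
  shows "hderiv S (hderiv T l) x - hderiv T (hderiv S l) x = (\<Sum>j\<in>UNIV. horizontal_curvature S T x j * dirderiv (Y j) l x)"
proof -
  let ?dw = "\<lambda>v d j. dirderiv v (\<lambda>x. w d x $ j) x"
  let ?l = "\<lambda>v. dirderiv v l x" and ?l2 = "\<lambda>v u. dirderiv v (dirderiv u l) x"
  have ld: "dirderiv v l differentiable (at x)" for v by (rule smooth_on_differentiable[OF smooth_on_dirderiv[OF l] x])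
  have sy: "?l2 v u = ?l2 u v" for u v by (rule smooth_on_dirderiv_symmetric[OF W x l])
  have 1: "dirderiv v (hderiv d l) x = ?l2 v d + (\<Sum>j\<in>UNIV. w d x $ j * ?l2 v (Y j) + ?dw v d j * ?l (Y j))" for v d
  proof -
    have "dirderiv v (hderiv d l) x = ?l2 v d + dirderiv v (\<lambda>x. \<Sum>k\<in>UNIV. w d x $ k * dirderiv (Y k) l x) x"
      unfolding hderiv_def[abs_def] by (rule dirderiv_add) (auto intro!: ld differentiable_sum differentiable_mult w_diff x)
    also have "dirderiv v (\<lambda>x. \<Sum>k\<in>UNIV. w d x $ k * dirderiv (Y k) l x) x = (\<Sum>j\<in>UNIV. w d x $ j * ?l2 v (Y j) + ?dw v d j * ?l (Y j))"
      by (subst dirderiv_sum) (simp_all add: dirderiv_mult ld w_diff x)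
    finally show ?thesis .
  qed
  have 2: "hderiv v (hderiv d l) x = ?l2 v d + (\<Sum>j\<in>UNIV. w d x $ j * ?l2 v (Y j)) + (\<Sum>k\<in>UNIV. w v x $ k * ?l2 (Y k) d)
      + (\<Sum>k\<in>UNIV. \<Sum>j\<in>UNIV. w v x $ k * w d x $ j * ?l2 (Y k) (Y j))
      + (\<Sum>j\<in>UNIV. (?dw v d j + (\<Sum>k\<in>UNIV. w v x $ k * ?dw (Y k) d j)) * ?l (Y j))" for v d
  proof -
    have "(\<Sum>k\<in>UNIV. \<Sum>j\<in>UNIV. w v x $ k * (?dw (Y k) d j * ?l (Y j))) = (\<Sum>j\<in>UNIV. (\<Sum>k\<in>UNIV. w v x $ k * ?dw (Y k) d j) * ?l (Y j))"
      by (subst sum.swap) (simp add: sum_distrib_right mult.assoc)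
    then show ?thesis
      unfolding hderiv_def[of v "hderiv d l"] 1 by (simp add: sum.distrib sum_distrib_left algebra_simps)
  qed
  have 3: "(\<Sum>k\<in>UNIV. \<Sum>j\<in>UNIV. w S x $ k * w T x $ j * ?l2 (Y k) (Y j)) = (\<Sum>k\<in>UNIV. \<Sum>j\<in>UNIV. w T x $ k * w S x $ j * ?l2 (Y k) (Y j))"
  proof (subst sum.swap, intro sum.cong refl)
    fix j k show "w S x $ k * w T x $ j * ?l2 (Y k) (Y j) = w T x $ j * w S x $ k * ?l2 (Y j) (Y k)"
      unfolding sy[of "Y k" "Y j"] by simp
  qed
  have 4: "?l2 (Y k) T = ?l2 T (Y k)" "?l2 (Y k) S = ?l2 S (Y k)" "?l2 T S = ?l2 S T" for k by (rule sy)+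
  show ?thesis
    unfolding 2 3 4 horizontal_curvature_def
    by (simp add: sum_subtractf sum.distrib algebra_simps)
qed

end

section \<open>Changes of charts\<close>

lemma is_chartD:
  assumes "is_chart c"
  shows "open (fst c)" "open (chart_image c)" "\<And>p. p \<in> fst c \<Longrightarrow> chart_inv c (snd c p) = p"
    "\<And>p. p \<in> fst c \<Longrightarrow> snd c p \<in> chart_image c"
    "\<And>y. y \<in> chart_image c \<Longrightarrow> chart_inv c y \<in> fst c" "\<And>y. y \<in> chart_image c \<Longrightarrow> snd c (chart_inv c y) = y"
    "continuous_on (fst c) (snd c)" "continuous_on (chart_image c) (chart_inv c)"
  using assms unfolding is_chart_def homeomorphism_def by auto

lemma open_chart_vimage:
  assumes "is_chart c" "open U"
  shows "open {y \<in> chart_image c. chart_inv c y \<in> U}"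
  using continuous_open_preimage[OF is_chartD(8,2)[OF assms(1)] assms(2)]
  by (simp add: vimage_def Int_def conj_commute)

lemma smooth_atlasD:
  assumes "smooth_atlas A"
  shows "\<And>c. c \<in> A \<Longrightarrow> is_chart c" "\<exists>c\<in>A. p \<in> fst c"
    "\<And>c d. c \<in> A \<Longrightarrow> d \<in> A \<Longrightarrow> smooth_on (snd c ` (fst c \<inter> fst d)) (snd d \<circ> chart_inv c)"
  using assms unfolding smooth_atlas_def by auto

lemma chart_at_in:
  assumes "smooth_atlas A"
  shows "chart_at A p \<in> A" "p \<in> fst (chart_at A p)"
proof -
  have "\<exists>c. c \<in> A \<and> p \<in> fst c" using smooth_atlasD(2)[OF assms, of p] by blast
  from someI_ex[OF this] show "chart_at A p \<in> A" "p \<in> fst (chart_at A p)" unfolding chart_at_def by auto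
qed

text \<open>The differential at \<open>p\<close> of the change from \<open>c\<close> to
  \<open>e\<close>. As \<open>chart_at\<close> may vary without any continuity, every object defined
  through it is carried to a fixed chart by such a map.\<close>

definition transition :: "('m, 'e::real_normed_vector) chart \<Rightarrow> ('m, 'e) chart \<Rightarrow> 'm \<Rightarrow> 'e \<Rightarrow> 'e" where
  "transition c e p = frechet_derivative (snd e \<circ> chart_inv c) (at (snd c p))"

lemma transition_differentiable:
  assumes "smooth_atlas A" "c \<in> A" "e \<in> A" "p \<in> fst c" "p \<in> fst e"
  shows "(snd e \<circ> chart_inv c) differentiable (at (snd c p))"
  by (rule smooth_on_differentiable[OF smooth_atlasD(3)[OF assms(1-3)]]) (use assms in auto)

lemma linear_transition:
  assumes "smooth_atlas A" "c \<in> A" "e \<in> A" "p \<in> fst c" "p \<in> fst e"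
  shows "linear (transition c e p)"
  unfolding transition_def by (rule linear_frechet_derivative[OF transition_differentiable[OF assms]])

lemma chart_change_has_derivative:
  fixes A :: "('m::topological_space, 'e::euclidean_space) chart set" and \<phi> :: "'m \<Rightarrow> 'b::real_normed_vector"
  assumes A: "smooth_atlas A" and c: "c \<in> A" "p \<in> fst c" and e: "e \<in> A" "p \<in> fst e"
    and \<phi>: "(\<phi> \<circ> chart_inv c) differentiable (at (snd c p))"
  shows "((\<phi> \<circ> chart_inv e) has_derivative (frechet_derivative (\<phi> \<circ> chart_inv c) (at (snd c p)) \<circ> transition e c p)) (at (snd e p))"
proof -
  note C = is_chartD[OF smooth_atlasD(1)[OF A c(1)]] and E = is_chartD[OF smooth_atlasD(1)[OF A e(1)]]
  let ?V = "{y \<in> chart_image e. chart_inv e y \<in> fst c}"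
  have V: "open ?V" "snd e p \<in> ?V"
    using open_chart_vimage[OF smooth_atlasD(1)[OF A e(1)] C(1)] E(3,4)[OF e(2)] c(2) by auto
  have t: "((snd c \<circ> chart_inv e) has_derivative transition e c p) (at (snd e p))"
    unfolding transition_def
    by (rule has_derivative_frechet_derivative[OF transition_differentiable[OF A e(1) c(1) e(2) c(2)]])
  have p: "(snd c \<circ> chart_inv e) (snd e p) = snd c p" using E(3)[OF e(2)] by simp
  have "(((\<phi> \<circ> chart_inv c) \<circ> (snd c \<circ> chart_inv e)) has_derivative
     (frechet_derivative (\<phi> \<circ> chart_inv c) (at (snd c p)) \<circ> transition e c p)) (at (snd e p))"
    by (rule diff_chain_at[OF t]) (simp only: p has_derivative_frechet_derivative[OF \<phi>])
  then show ?thesis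
    by (rule has_derivative_transform_within_open[OF _ V]) (simp add: C(3))
qed

lemma transition_compose:
  assumes "smooth_atlas A" "c \<in> A" "e \<in> A" "d \<in> A" "p \<in> fst c" "p \<in> fst e" "p \<in> fst d"
  shows "transition e d p (transition c e p v) = transition c d p v"
  using dirderivI[OF chart_change_has_derivative[OF assms(1,3,6,2,5) transition_differentiable[OF assms(1,3,4,6,7)]], of v]
  unfolding transition_def by (simp only: comp_apply)

lemma transition_self:
  fixes A :: "('m::topological_space, 'e::euclidean_space) chart set"
  assumes "smooth_atlas A" "c \<in> A" "p \<in> fst c"
  shows "transition c c p v = v"
proof -
  note C = is_chartD[OF smooth_atlasD(1)[OF assms(1,2)]]
  have "((snd c \<circ> chart_inv c) has_derivative (\<lambda>v. v)) (at (snd c p))"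
    by (rule has_derivative_transform_within_open[OF has_derivative_ident C(2) C(4)[OF assms(3)]]) (simp add: C(6))
  then show ?thesis unfolding transition_def by (rule dirderivI)
qed

lemma transition_inverse:
  assumes "smooth_atlas A" "c \<in> A" "e \<in> A" "p \<in> fst c" "p \<in> fst e"
  shows "transition e c p (transition c e p v) = v"
  by (simp only: transition_compose[OF assms(1-3,2,4,5,4)] transition_self[OF assms(1,2,4)])

lemma transition_complex_linear:
  assumes "complex_atlas A" "c \<in> A" "e \<in> A" "p \<in> fst c" "p \<in> fst e"
  shows "transition c e p (\<i> *s v) = \<i> *s transition c e p v"
proof -
  obtain D where D: "((snd e \<circ> chart_inv c) has_derivative D) (at (snd c p))" "\<And>u. D (\<i> *s u) = \<i> *s D u"
    using assms unfolding complex_atlas_def holo_on_def by blast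
  show ?thesis unfolding transition_def by (simp only: dirderivI[OF D(1)] D(2))
qed

lemma transition_det_pos:
  assumes "oriented_atlas A" "c \<in> A" "e \<in> A" "p \<in> fst c" "p \<in> fst e"
  shows "det (matrix (transition c e p)) > 0"
  using assms unfolding oriented_atlas_def transition_def by blast

lemma fderiv_eq:
  assumes A: "smooth_atlas A" and c: "c \<in> A" "p \<in> fst c"
    and \<phi>: "(\<phi> \<circ> chart_inv c) differentiable (at (snd c p))"
  shows "fderiv A \<phi> p v = dirderiv (transition (chart_at A p) c p v) (\<phi> \<circ> chart_inv c) (snd c p)"
  unfolding fderiv_def
  using dirderivI[OF chart_change_has_derivative[OF A c chart_at_in[OF A] \<phi>]] by simp

lemma mderiv_eq:
  fixes A :: "('m::topological_space, 'e::euclidean_space) chart set" and B :: "('k::topological_space, 'f::euclidean_space) chart set"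
  assumes A: "smooth_atlas A" and B: "smooth_atlas B" and c: "c \<in> A" "p \<in> fst c" and d: "d \<in> B" "f p \<in> fst d"
    and f: "continuous_on UNIV f" "(snd d \<circ> f \<circ> chart_inv c) differentiable (at (snd c p))"
  shows "mderiv A B f p v = transition d (chart_at B (f p)) (f p)
     (dirderiv (transition (chart_at A p) c p v) (snd d \<circ> f \<circ> chart_inv c) (snd c p))"
proof -
  let ?e = "chart_at B (f p)"
  note C = is_chartD[OF smooth_atlasD(1)[OF A c(1)]] and D = is_chartD[OF smooth_atlasD(1)[OF B d(1)]]
  let ?V = "{y \<in> chart_image c. chart_inv c y \<in> f -` fst d}"
  have V: "open ?V" "snd c p \<in> ?V"
    using open_chart_vimage[OF smooth_atlasD(1)[OF A c(1)] open_vimage[OF D(1) f(1)]] C(3,4)[OF c(2)] d(2) by auto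
  have p: "(snd d \<circ> f \<circ> chart_inv c) (snd c p) = snd d (f p)" using C(3)[OF c(2)] by simp
  have "((snd ?e \<circ> chart_inv d) has_derivative transition d ?e (f p)) (at (snd d (f p)))"
    unfolding transition_def
    by (rule has_derivative_frechet_derivative[OF transition_differentiable[OF B d(1) chart_at_in(1)[OF B] d(2) chart_at_in(2)[OF B]]])
  then have "(((snd ?e \<circ> chart_inv d) \<circ> (snd d \<circ> f \<circ> chart_inv c)) has_derivative
     (transition d ?e (f p) \<circ> frechet_derivative (snd d \<circ> f \<circ> chart_inv c) (at (snd c p)))) (at (snd c p))"
    by (intro diff_chain_at[OF has_derivative_frechet_derivative[OF f(2)]]) (simp only: p)
  then have 1: "((snd ?e \<circ> f \<circ> chart_inv c) has_derivative
     (transition d ?e (f p) \<circ> frechet_derivative (snd d \<circ> f \<circ> chart_inv c) (at (snd c p)))) (at (snd c p))"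
    by (rule has_derivative_transform_within_open[OF _ V]) (simp add: D(3))
  have "((snd ?e \<circ> f \<circ> chart_inv (chart_at A p)) has_derivative
      (frechet_derivative (snd ?e \<circ> f \<circ> chart_inv c) (at (snd c p)) \<circ> transition (chart_at A p) c p)) (at (coord A p))"
    by (rule chart_change_has_derivative[OF A c chart_at_in[OF A] differentiableI[OF 1]])
  then show ?thesis unfolding mderiv_def
    using dirderivI[OF 1] by (simp add: dirderivI)
qed

lemma velocity_eq:
  fixes B :: "('k::topological_space, 'f::euclidean_space) chart set"
  assumes B: "smooth_atlas B" and d: "d \<in> B" "F t p \<in> fst d" and I: "open I" "t \<in> I" "continuous_on I (\<lambda>\<tau>. F \<tau> p)"
    and F: "((\<lambda>\<tau>. snd d (F \<tau> p)) has_vector_derivative u) (at t)"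
  shows "velocity B F t p = transition d (chart_at B (F t p)) (F t p) u"
proof -
  let ?e = "chart_at B (F t p)"
  note D = is_chartD[OF smooth_atlasD(1)[OF B d(1)]]
  let ?V = "{\<tau> \<in> I. F \<tau> p \<in> fst d}"
  have V: "open ?V" "t \<in> ?V"
    using continuous_open_preimage[OF I(3,1) D(1)] I(2) d(2) by (auto simp: vimage_def Int_def conj_commute)
  have "((snd ?e \<circ> chart_inv d) has_derivative transition d ?e (F t p)) (at (snd d (F t p)))"
    unfolding transition_def
    by (rule has_derivative_frechet_derivative[OF transition_differentiable[OF B d(1) chart_at_in(1)[OF B] d(2) chart_at_in(2)[OF B]]])
  from vector_derivative_diff_chain_within[OF F has_derivative_at_withinI[OF this]]
  have "(((snd ?e \<circ> chart_inv d) \<circ> (\<lambda>\<tau>. snd d (F \<tau> p))) has_vector_derivative transition d ?e (F t p) u) (at t)" .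
  then have "((\<lambda>\<tau>. snd ?e (F \<tau> p)) has_vector_derivative transition d ?e (F t p) u) (at t)"
    by (rule has_vector_derivative_transform_within_open[OF _ V]) (simp add: D(3))
  then show ?thesis unfolding velocity_def by (rule vector_derivative_at)
qed

lemma tensor_in_eq:
  assumes "smooth_atlas A" "c \<in> A" "p \<in> fst c"
  shows "tensor_in A c \<alpha> (snd c p) v = \<alpha> p (\<lambda>i. transition c (chart_at A p) p (v i))"
  using is_chartD(3)[OF smooth_atlasD(1)[OF assms(1,2)] assms(3)] by (simp add: tensor_in_def transition_def Let_def)

section \<open>Real tangent vectors inside complex ones\<close>

definition cvec :: "(real, 'n::finite) vec \<Rightarrow> (complex, 'n) vec" where
  "cvec v = (\<chi> i. of_real (v $ i))"

lemma detform_cvec: "detform (\<lambda>i. cvec (v i)) = of_real (detform (v :: nat \<Rightarrow> (real, 'n::{finite,linorder}) vec))"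
  by (simp add: detform_def of_real_det cvec_def)

text \<open>The cofactors formed from the real entries are real, so the real part acts on the
  components of the contracted vector alone. This turns the equation of forms for the horizontal
  field into one between vectors.\<close>

lemma Re_detform_contract:
  fixes z :: "(complex, 'n::{finite,linorder}) vec"
  shows "Re (c * detform (case_nat z (\<lambda>i. cvec (\<eta> i)))) = detform (case_nat (\<chi> j. Re (c * z $ j)) \<eta>)"
proof -
  have "(case_nat (sframe j) (\<lambda>i. cvec (\<eta> i)) :: nat \<Rightarrow> (complex, 'n) vec) = (\<lambda>i. cvec (case_nat (sframe j) \<eta> i))" for j
    by (auto simp: fun_eq_iff cvec_def sframe_def vec_eq_iff split: nat.split)
  then show ?thesis
    unfolding detform_case_nat_expand[of z] detform_case_nat_expand[of "\<chi> j. Re (c * z $ j)"]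
    by (simp only: detform_cvec sum_distrib_left mult.assoc[symmetric] Re_sum vec_lambda_beta)
      (simp only: times_complex.sel Re_complex_of_real Im_complex_of_real mult_zero_right diff_zero)
qed

lemma detform_contract_eq_0:
  fixes u :: "(real, 'n::{finite,linorder}) vec"
  assumes "\<And>\<eta>. detform (case_nat u \<eta>) = 0"
  shows "u = 0"
proof -
  have "u $ a = 0" for a
    using detform_contract_sframe[OF index_of_less[of a], of u] assms by simp
  then show ?thesis by (simp add: vec_eq_iff)
qed

lemma detform_linear_map:
  assumes "linear (S :: (real, 'n::{finite,linorder}) vec \<Rightarrow> (real, 'n) vec)"
  shows "detform (\<lambda>i. S (v i)) = det (matrix S) * detform v"
  using detform_mult[of "matrix S" v] unfolding fun_cong[OF matrix_vector_mul(2)[OF assms]] .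

section \<open>Families of Lagrangians in charts\<close>

lemma Ck_on_subset: "Ck_on k S f \<Longrightarrow> T \<subseteq> S \<Longrightarrow> Ck_on k T f"
  by (induction k arbitrary: f) (auto intro: continuous_on_subset)

lemma smooth_on_subset: "smooth_on S f \<Longrightarrow> T \<subseteq> S \<Longrightarrow> smooth_on T f"
  unfolding smooth_on_def using Ck_on_subset by blast

lemma vec_axis_sum: "v = (\<Sum>j\<in>UNIV. v $ j *\<^sub>R axis j (1 :: real))"
  by (simp add: vec_eq_iff axis_def if_distrib cong: if_cong)

lemma matrix_ident: "matrix (\<lambda>v :: ('a::comm_ring_1, 'n::finite) vec. v) = mat 1"
  by (simp add: matrix_def mat_def axis_def vec_eq_iff)

locale lagrangian_family_chart =
  fixes X :: "('x::{t2_space,second_countable_topology}, 'n::{finite,linorder}) acy_data"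
    and A :: "('l::{t2_space,second_countable_topology}, (real, 'n) vec) chart set"
    and \<Theta> :: "'t::euclidean_space set" and F :: "'t \<Rightarrow> 'l \<Rightarrow> 'x"
    and c :: "('l, (real, 'n) vec) chart" and d :: "('x, (complex, 'n) vec) chart"
  assumes X: "almost_calabi_yau X" and A: "oriented_atlas A"
    and \<Theta>: "open \<Theta>" and F: "smooth_family A (charts X) \<Theta> F"
    and embed: "\<And>\<theta>. \<theta> \<in> \<Theta> \<Longrightarrow> inj (F \<theta>)"
    and lagr: "\<And>\<theta>. \<theta> \<in> \<Theta> \<Longrightarrow> lagrangian A X (F \<theta>)"
    and positive: "\<And>\<theta> p. \<theta> \<in> \<Theta> \<Longrightarrow> Re (pullback A (charts X) (F \<theta>) (hol_form X) p std_frame) > 0"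
    and c: "c \<in> A" and d: "d \<in> charts X"
begin

lemma atlasX: "complex_atlas (charts X)" "smooth_atlas (charts X)"
  using X unfolding almost_calabi_yau_def complex_atlas_def by auto

lemma atlasA: "smooth_atlas A"
  using A unfolding oriented_atlas_def by auto

lemmas chart_c = is_chartD[OF smooth_atlasD(1)[OF atlasA c]]
lemmas chart_d = is_chartD[OF smooth_atlasD(1)[OF atlasX(2) d]]

definition W :: "('t \<times> (real, 'n) vec) set" where
  "W = {(\<theta>, y). \<theta> \<in> \<Theta> \<and> y \<in> chart_image c \<and> F \<theta> (chart_inv c y) \<in> fst d}"

definition \<Phi> :: "'t \<times> (real, 'n) vec \<Rightarrow> (complex, 'n) vec" where
  "\<Phi> = (\<lambda>(\<theta>, y). snd d (F \<theta> (chart_inv c y)))"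

definition a :: "(complex, 'n) vec \<Rightarrow> complex" where
  "a z = tensor_in (charts X) d (hol_form X) z sframe"

definition Y :: "'n \<Rightarrow> 't \<times> (real, 'n) vec" where
  "Y j = (0, axis j 1)"

lemma F_continuous: "continuous_on (\<Theta> \<times> UNIV) (\<lambda>(\<theta>, p). F \<theta> p)"
  using F unfolding smooth_family_def by blast

lemma open_W: "open W"
proof -
  have "continuous_on (\<Theta> \<times> chart_image c) ((\<lambda>(\<theta>, p). F \<theta> p) \<circ> (\<lambda>(\<theta>, y). (\<theta>, chart_inv c y)))"
    unfolding case_prod_unfold
    by (intro continuous_on_compose continuous_intros continuous_on_compose2[OF chart_c(8)]
        continuous_on_subset[OF F_continuous[unfolded case_prod_unfold]]) auto
  from continuous_open_preimage[OF this open_Times[OF \<Theta> chart_c(2)] chart_d(1)]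
  have "open ((\<Theta> \<times> chart_image c) \<inter> ((\<lambda>(\<theta>, p). F \<theta> p) \<circ> (\<lambda>(\<theta>, y). (\<theta>, chart_inv c y))) -` fst d)" .
  moreover have "W = (\<Theta> \<times> chart_image c) \<inter> ((\<lambda>(\<theta>, p). F \<theta> p) \<circ> (\<lambda>(\<theta>, y). (\<theta>, chart_inv c y))) -` fst d"
    unfolding W_def by auto
  ultimately show ?thesis by simp
qed

lemma smooth_\<Phi>: "smooth_on W \<Phi>"
  using F c d unfolding smooth_family_def W_def \<Phi>_def by blast

lemma W_point:
  assumes "(\<theta>, y) \<in> W"
  shows "\<theta> \<in> \<Theta>" "y \<in> chart_image c" "chart_inv c y \<in> fst c" "snd c (chart_inv c y) = y"
    "F \<theta> (chart_inv c y) \<in> fst d" "\<Phi> (\<theta>, y) = snd d (F \<theta> (chart_inv c y))" "\<Phi> (\<theta>, y) \<in> chart_image d"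
  using assms chart_c(5,6) chart_d(4) unfolding W_def \<Phi>_def by auto

lemma slice_derivative:
  assumes g: "g differentiable (at (\<theta>, y))"
  shows "((\<lambda>y. g (\<theta>, y)) has_derivative (\<lambda>v. dirderiv (0, v) g (\<theta>, y))) (at y)"
proof -
  have "((\<lambda>y. (\<theta>, y)) has_derivative (\<lambda>v. (0, v))) (at y)"
    by (auto intro!: derivative_eq_intros)
  from diff_chain_at[OF this, of g] has_derivative_frechet_derivative[OF g]
  show ?thesis by (simp add: o_def)
qed

lemma axis_sum: "(0, v) = (\<Sum>j\<in>UNIV. v $ j *\<^sub>R Y j)"
  using vec_axis_sum[of v] by (simp add: Y_def prod_eq_iff fst_sum snd_sum)

lemma slice_dirderiv:
  assumes g: "g differentiable (at (\<theta>, y))"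
  shows "dirderiv (0, v) g (\<theta>, y) = (\<Sum>j\<in>UNIV. v $ j *\<^sub>R dirderiv (Y j) g (\<theta>, y))"
  unfolding axis_sum by (rule dirderiv_sum_dir[OF g])

abbreviation "P \<equiv> \<lambda>\<xi>. (\<chi> i j. dirderiv (Y j) \<Phi> \<xi> $ i)"

lemma P_cvec:
  assumes "\<xi> \<in> W"
  shows "P \<xi> *v cvec v = dirderiv (0, v) \<Phi> \<xi>"
proof -
  obtain \<theta> y where \<xi>: "\<xi> = (\<theta>, y)" by force
  show ?thesis
    using slice_dirderiv[OF smooth_on_differentiable[OF smooth_\<Phi> assms[unfolded \<xi>]], of v] unfolding \<xi>
    by (simp add: vec_eq_iff matrix_vector_mult_def cvec_def mult.commute scaleR_conv_of_real[where 'a = complex])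
qed

abbreviation "toX x \<equiv> transition d (chart_at (charts X) x) x"
abbreviation "toC p \<equiv> transition (chart_at A p) c p"

lemma F_slice: "\<theta> \<in> \<Theta> \<Longrightarrow> continuous_on UNIV (F \<theta>)"
  using continuous_on_compose2[OF F_continuous, of UNIV "\<lambda>p. (\<theta>, p)"]
  by (simp add: image_subset_iff continuous_on_Pair continuous_on_const)

lemma F_slice2: "continuous_on \<Theta> (\<lambda>\<theta>. F \<theta> p)"
  using continuous_on_compose2[OF F_continuous, of \<Theta> "\<lambda>\<theta>. (\<theta>, p)"]
  by (simp add: image_subset_iff continuous_on_Pair continuous_on_const)

lemma local_rep_derivative:
  assumes "(\<theta>, y) \<in> W"
  shows "((snd d \<circ> F \<theta> \<circ> chart_inv c) has_derivative (\<lambda>v. dirderiv (0, v) \<Phi> (\<theta>, y))) (at y)"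
  using slice_derivative[OF smooth_on_differentiable[OF smooth_\<Phi> assms]] by (simp add: \<Phi>_def o_def)

lemma mderiv_F:
  assumes W: "(\<theta>, y) \<in> W" and p: "p = chart_inv c y" and x: "x = F \<theta> p"
  shows "mderiv A (charts X) (F \<theta>) p \<eta> = toX x (P (\<theta>, y) *v cvec (toC p \<eta>))"
proof -
  note w = W_point[OF W, folded p]
  show ?thesis
    unfolding x mderiv_eq[OF atlasA atlasX(2) c w(3) d w(5) F_slice[OF w(1)] differentiableI[OF local_rep_derivative[OF W, folded w(4)]]] w(4)
    unfolding dirderivI[OF local_rep_derivative[OF W]] P_cvec[OF W] ..
qed

text \<open>A form of type (n,0) is complex multilinear and the chart change is complex linear, so
  the value on the frame determines the form.\<close>

lemma hol_form_toX:
  assumes "x \<in> fst d"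
  shows "hol_form X x (\<lambda>i. toX x (u i)) = a (snd d x) * detform u"
proof -
  let ?\<alpha> = "\<lambda>u. hol_form X x (\<lambda>i. toX x (u i))"
  have H: "alternating CARD('n) (hol_form X x)"
    "\<And>v i. i < CARD('n) \<Longrightarrow> hol_form X x (v(i := \<i> *s v i)) = \<i> * hol_form X x v"
    using X unfolding almost_calabi_yau_def holomorphic_top_form_def by auto
  have lin: "linear (toX x)" by (rule linear_transition[OF atlasX(2) d chart_at_in(1)[OF atlasX(2)] assms chart_at_in(2)[OF atlasX(2)]])
  have cl: "toX x (\<i> *s v) = \<i> *s toX x v" for v
    by (rule transition_complex_linear[OF atlasX(1) d chart_at_in(1)[OF atlasX(2)] assms chart_at_in(2)[OF atlasX(2)]])
  have cl': "toX x (k *s v) = k *s toX x v" for k v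
    by (simp only: complex_scale_eq[of k] linear_add[OF lin] linear_scale[OF lin] cl)
  have upd: "(\<lambda>i. toX x ((v(j := w)) i)) = (\<lambda>i. toX x (v i))(j := toX x w)" for v j w by auto
  have alt: "alt_on CARD('n) ?\<alpha>"
    unfolding alt_on_def
  proof (intro conjI allI impI)
    fix v w :: "nat \<Rightarrow> (complex, 'n) vec" assume "\<forall>i<CARD('n). v i = w i"
    then show "?\<alpha> v = ?\<alpha> w" by (intro alt_on_cong[OF alternating_imp_alt_on[OF H(1)]]) simp
  next
    fix v :: "nat \<Rightarrow> (complex, 'n) vec" and i j assume "i < CARD('n)" "j < CARD('n)" "i \<noteq> j"
    from alt_on_swap[OF alternating_imp_alt_on[OF H(1)] this, of "\<lambda>i. toX x (v i)"]
    show "?\<alpha> (v \<circ> Transposition.transpose i j) = - ?\<alpha> v" by (simp add: o_def)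
  qed
  have "?\<alpha> u = detform u * ?\<alpha> sframe"
  proof (rule alt_on_eq_detform[OF alt])
    fix v :: "nat \<Rightarrow> (complex, 'n) vec" and i k assume i: "i < CARD('n)"
    show "?\<alpha> (v(i := \<Sum>j<CARD('n). k j *s sframe j)) = (\<Sum>j<CARD('n). k j * ?\<alpha> (v(i := sframe j)))"
      unfolding upd linear_sum[OF lin] cl'
      by (rule alternating_complex_lincomb[OF H i]) auto
  qed
  moreover have "?\<alpha> sframe = a (snd d x)"
    unfolding a_def tensor_in_eq[OF atlasX(2) d assms] ..
  ultimately show ?thesis by simp
qed

abbreviation "m \<equiv> \<lambda>\<xi>. a (\<Phi> \<xi>) * det (P \<xi>)"

lemma toC_linear:
  assumes "p \<in> fst c"
  shows "linear (toC p)" "det (matrix (toC p)) > 0"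
  using linear_transition[OF atlasA chart_at_in(1)[OF atlasA] c chart_at_in(2)[OF atlasA] assms]
    transition_det_pos[OF A chart_at_in(1)[OF atlasA] c chart_at_in(2)[OF atlasA] assms] by auto

lemma toC_inverse:
  assumes "p \<in> fst c"
  shows "toC p (transition c (chart_at A p) p v) = v"
  using transition_inverse[OF atlasA c chart_at_in(1)[OF atlasA] assms chart_at_in(2)[OF atlasA]] .

lemma toC_inverse':
  assumes "p \<in> fst c"
  shows "transition c (chart_at A p) p (toC p v) = v"
  using transition_inverse[OF atlasA chart_at_in(1)[OF atlasA] c chart_at_in(2)[OF atlasA] assms] .

lemma pullback_hol_form:
  assumes W: "(\<theta>, y) \<in> W" and p: "p = chart_inv c y"
  shows "pullback A (charts X) (F \<theta>) (hol_form X) p v = m (\<theta>, y) * of_real (detform (\<lambda>i. toC p (v i)))"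
proof -
  note w = W_point[OF W, folded p]
  show ?thesis
    unfolding pullback_def mderiv_F[OF W p refl] hol_form_toX[OF w(5)] detform_mult detform_cvec
    by (simp add: w(6))
qed

text \<open>Positivity is given on the standard frame of \<open>chart_at A p\<close>; the
  orientation of the atlas transfers it to \<open>c\<close>.\<close>

lemma Re_m_pos:
  assumes "\<xi> \<in> W"
  shows "Re (m \<xi>) > 0"
proof -
  obtain \<theta> y where \<xi>: "\<xi> = (\<theta>, y)" by force
  note W = assms[unfolded \<xi>]
  let ?p = "chart_inv c y"
  have "Re (m (\<theta>, y)) * det (matrix (toC ?p)) > 0"
    using positive[OF W_point(1)[OF W], of ?p] unfolding pullback_hol_form[OF W refl] std_frame_eq
      detform_linear_map[OF toC_linear(1)[OF W_point(3)[OF W]]] detform_sframe by simp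
  then show ?thesis using toC_linear(2)[OF W_point(3)[OF W]] unfolding \<xi> by (simp add: zero_less_mult_iff)
qed

lemma a_holo:
  assumes "\<xi> \<in> W"
  shows "\<exists>D. (a has_derivative D) (at (\<Phi> \<xi>)) \<and> (\<forall>u. D (\<i> *s u) = \<i> * D u)"
proof -
  obtain \<theta> y where \<xi>: "\<xi> = (\<theta>, y)" by force
  have "holo_on ((*) \<i>) (chart_image d) a"
    using X d unfolding almost_calabi_yau_def holomorphic_top_form_def a_def[abs_def] by blast
  then show ?thesis using W_point(7)[OF assms[unfolded \<xi>]] unfolding holo_on_def \<xi> by blast
qed

sublocale C: lagrangian_coords W \<Phi> a Y
  by unfold_locales (use open_W smooth_\<Phi> a_holo Re_m_pos in auto)

text \<open>The paths are affine lines \<open>b + \<tau> *\<^sub>R \<delta>\<close> in the parameter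
  space, so that one statement serves both parameter directions and every base point.\<close>

lemma velocity_F:
  assumes \<theta>: "\<theta> = b + t *\<^sub>R \<delta>" and W: "(\<theta>, y) \<in> W" and p: "p = chart_inv c y" and x: "x = F \<theta> p"
  shows "velocity (charts X) (\<lambda>\<tau>. F (b + \<tau> *\<^sub>R \<delta>)) t p = toX x (dirderiv (\<delta>, 0) \<Phi> (\<theta>, y))"
proof -
  note w = W_point[OF W, folded p]
  let ?I = "(\<lambda>\<tau>. b + \<tau> *\<^sub>R \<delta>) -` \<Theta>"
  have "open ?I" by (intro open_vimage \<Theta> continuous_intros)
  moreover have "t \<in> ?I" using w(1) \<theta> by simp
  moreover have "continuous_on ?I (\<lambda>\<tau>. F (b + \<tau> *\<^sub>R \<delta>) p)"
    by (rule continuous_on_compose2[OF F_slice2]) (auto intro!: continuous_intros)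
  moreover have "((\<lambda>\<tau>. snd d (F (b + \<tau> *\<^sub>R \<delta>) p)) has_vector_derivative dirderiv (\<delta>, 0) \<Phi> (\<theta>, y)) (at t)"
    using dirderiv_real_line[of \<Phi> "(b, y)" t "(\<delta>, 0)"] smooth_on_differentiable[OF smooth_\<Phi> W]
    by (simp add: \<theta> \<Phi>_def p)
  ultimately show ?thesis
    using velocity_eq[OF atlasX(2) d, of "\<lambda>\<tau>. F (b + \<tau> *\<^sub>R \<delta>)" t p ?I] w(5) \<theta> x by simp
qed

lemma horizontal_field_F:
  assumes \<theta>: "\<theta> = b + t *\<^sub>R \<delta>" and W: "(\<theta>, y) \<in> W" and p: "p = chart_inv c y"
  shows "toC p (horizontal_field A X (\<lambda>\<tau>. F (b + \<tau> *\<^sub>R \<delta>)) t p) = C.w (\<delta>, 0) (\<theta>, y)"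
proof -
  note w = W_point[OF W, folded p]
  let ?x = "F \<theta> p" and ?\<xi> = "(\<theta>, y)" and ?S = "toC p"
  let ?q = "C.q (\<delta>, 0) ?\<xi>"
  have linS: "linear ?S" by (rule toC_linear(1)[OF w(3)])
  \<comment> \<open>\<open>u v\<close> is the real part of \<open>m (q + ?S v)\<close>;
    nondegeneracy of the determinant makes the defining equation of the horizontal field equivalent
    to \<open>u v = 0\<close>.\<close>
  define u where "u v = (\<chi> j. Re (C.m ?\<xi>) * ?S v $ j + Re (C.m ?\<xi> * ?q $ j))" for v
  have m: "m ?\<xi> = C.m ?\<xi>" by (simp add: C.m_def C.P_def)
  have cn: "(\<lambda>i. f (case_nat x \<eta> i)) = case_nat (f x) (\<lambda>i. f (\<eta> i))" for f :: "'a \<Rightarrow> 'b" and x \<eta>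
    by (auto simp: fun_eq_iff split: nat.split)
  have L: "Re (pullback A (charts X) (F \<theta>) (hol_form X) p (case_nat v \<eta>)) = Re (C.m ?\<xi>) * detform (case_nat (?S v) (\<lambda>i. ?S (\<eta> i)))" for v \<eta>
    unfolding pullback_hol_form[OF W p] cn m by simp
  have "hol_form X ?x (case_nat (toX ?x (dirderiv (\<delta>, 0) \<Phi> ?\<xi>)) (\<lambda>i. mderiv A (charts X) (F \<theta>) p (\<eta> i)))
      = C.m ?\<xi> * detform (case_nat ?q (\<lambda>i. cvec (?S (\<eta> i))))" for \<eta>
  proof -
    have P: "P ?\<xi> = C.P ?\<xi>" by (simp add: C.P_def)
    have "hol_form X ?x (case_nat (toX ?x (dirderiv (\<delta>, 0) \<Phi> ?\<xi>)) (\<lambda>i. mderiv A (charts X) (F \<theta>) p (\<eta> i)))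
       = hol_form X ?x (\<lambda>i. toX ?x (C.P ?\<xi> *v case_nat ?q (\<lambda>i. cvec (?S (\<eta> i))) i))"
      unfolding mderiv_F[OF W p refl] P C.P_mult_q[OF W, of "(\<delta>, 0)", symmetric]
      by (rule arg_cong[where f = "hol_form X ?x"]) (auto simp: fun_eq_iff split: nat.split)
    also have "\<dots> = C.m ?\<xi> * detform (case_nat ?q (\<lambda>i. cvec (?S (\<eta> i))))"
      unfolding hol_form_toX[OF w(5)] detform_mult by (simp add: C.m_def w(6))
    finally show ?thesis .
  qed
  then have R: "Re (hol_form X ?x (case_nat (toX ?x (dirderiv (\<delta>, 0) \<Phi> ?\<xi>)) (\<lambda>i. mderiv A (charts X) (F \<theta>) p (\<eta> i))))
      = detform (case_nat (\<chi> j. Re (C.m ?\<xi> * ?q $ j)) (\<lambda>i. ?S (\<eta> i)))" for \<eta>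
    by (simp only: Re_detform_contract)
  have LR: "Re (C.m ?\<xi>) * detform (case_nat (?S v) \<eta>) = - detform (case_nat (\<chi> j. Re (C.m ?\<xi> * ?q $ j)) \<eta>) \<longleftrightarrow> detform (case_nat (u v) \<eta>) = 0"
    for v and \<eta> :: "nat \<Rightarrow> (real, 'n) vec"
    unfolding detform_case_nat_expand[of "u v"] detform_case_nat_expand[of "?S v"] detform_case_nat_expand[of "\<chi> j. Re (C.m ?\<xi> * ?q $ j)"]
    by (simp add: u_def sum_distrib_left distrib_right sum.distrib mult.assoc eq_neg_iff_add_eq_0)
  have "(\<forall>\<eta>. Re (pullback A (charts X) (F \<theta>) (hol_form X) p (case_nat v \<eta>)) =
     - Re (hol_form X ?x (case_nat (toX ?x (dirderiv (\<delta>, 0) \<Phi> ?\<xi>)) (\<lambda>i. mderiv A (charts X) (F \<theta>) p (\<eta> i))))) \<longleftrightarrow> u v = 0"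
    (is "?eq \<longleftrightarrow> _") for v
  proof
    assume *: ?eq
    show "u v = 0"
    proof (rule detform_contract_eq_0)
      fix \<eta> :: "nat \<Rightarrow> (real, 'n) vec"
      have "(\<lambda>i. ?S (transition c (chart_at A p) p (\<eta> i))) = \<eta>" using toC_inverse[OF w(3)] by simp
      then show "detform (case_nat (u v) \<eta>) = 0"
        using *[rule_format, of "\<lambda>i. transition c (chart_at A p) p (\<eta> i)"] unfolding L R LR[symmetric] by simp
    qed
  next
    assume u: "u v = 0"
    have "detform (case_nat (0 :: (real, 'n) vec) \<eta>) = 0" for \<eta> by (subst detform_case_nat_expand) simp
    then show ?eq unfolding L R LR u by blast
  qed
  moreover have "u v = 0 \<longleftrightarrow> ?S v = C.w (\<delta>, 0) ?\<xi>" for v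
    using C.pos[OF W] by (auto simp: u_def C.w_def vec_eq_iff field_simps)
  ultimately have "horizontal_field A X (\<lambda>\<tau>. F (b + \<tau> *\<^sub>R \<delta>)) t p = (THE v. ?S v = C.w (\<delta>, 0) ?\<xi>)"
    unfolding horizontal_field_def velocity_F[OF \<theta> W p refl] \<theta>[symmetric] by simp
  also have "\<dots> = transition c (chart_at A p) p (C.w (\<delta>, 0) ?\<xi>)"
  proof (rule the_equality)
    fix v assume "?S v = C.w (\<delta>, 0) ?\<xi>"
    then show "v = transition c (chart_at A p) p (C.w (\<delta>, 0) ?\<xi>)" using toC_inverse'[OF w(3), of v] by simp
  qed (rule toC_inverse[OF w(3)])
  finally show ?thesis using toC_inverse[OF w(3)] by simp
qed

text \<open>\<open>g\<close> is the family \<open>h\<close> in coordinates. Requiring agreement only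
  on \<open>W\<close> allows a second application, to covariant derivatives that are known only
  there.\<close>

lemma cov_deriv_F:
  assumes \<theta>: "\<theta> = b + t *\<^sub>R \<delta>" and W: "(\<theta>, y) \<in> W"
    and g: "g differentiable (at (\<theta>, y))"
    and h: "\<And>\<tau> y. (b + \<tau> *\<^sub>R \<delta>, y) \<in> W \<Longrightarrow> h \<tau> (F (b + \<tau> *\<^sub>R \<delta>) (chart_inv c y)) = g (b + \<tau> *\<^sub>R \<delta>, y)"
  shows "cov_deriv A X (\<lambda>\<tau>. F (b + \<tau> *\<^sub>R \<delta>)) h t (F \<theta> (chart_inv c y)) = C.hderiv (\<delta>, 0) g (\<theta>, y)"
proof -
  define p where p: "p = chart_inv c y"
  note w = W_point[OF W, folded p]
  have inv: "inv (F \<theta>) (F \<theta> p) = p" using embed[OF w(1)] by simp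
  have "((\<lambda>\<tau>. g ((b, y) + \<tau> *\<^sub>R (\<delta>, 0))) has_vector_derivative dirderiv (\<delta>, 0) g (\<theta>, y)) (at t)"
    using dirderiv_real_line[of g "(b, y)" t "(\<delta>, 0)"] g by (simp add: \<theta>)
  moreover have "open ((\<lambda>\<tau>. (b, y) + \<tau> *\<^sub>R (\<delta>, 0)) -` W)"
    by (intro open_vimage open_W continuous_intros)
  ultimately have "((\<lambda>\<tau>. h \<tau> (F (b + \<tau> *\<^sub>R \<delta>) p)) has_vector_derivative dirderiv (\<delta>, 0) g (\<theta>, y)) (at t)"
    by (rule has_vector_derivative_transform_within_open) (use W \<theta> h in \<open>auto simp: p\<close>)
  then have 1: "vector_derivative (\<lambda>\<tau>. h \<tau> (F (b + \<tau> *\<^sub>R \<delta>) p)) (at t) = dirderiv (\<delta>, 0) g (\<theta>, y)"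
    by (rule vector_derivative_at)
  have "open ((\<lambda>y. (\<theta>, y)) -` W)" by (intro open_vimage open_W continuous_intros)
  from has_derivative_transform_within_open[OF slice_derivative[OF g] this, of "h t \<circ> F \<theta> \<circ> chart_inv c"]
  have 2: "((h t \<circ> F \<theta> \<circ> chart_inv c) has_derivative (\<lambda>v. dirderiv (0, v) g (\<theta>, y))) (at y)"
    using W h[of t] \<theta> by auto
  have "fderiv A (h t \<circ> F \<theta>) p (horizontal_field A X (\<lambda>\<tau>. F (b + \<tau> *\<^sub>R \<delta>)) t p) = dirderiv (0, C.w (\<delta>, 0) (\<theta>, y)) g (\<theta>, y)"
    using fderiv_eq[OF atlasA c w(3), of "h t \<circ> F \<theta>"] differentiableI[OF 2] w(4)
    by (simp add: dirderivI[OF 2] horizontal_field_F[OF \<theta> W p])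
  then show ?thesis
    unfolding cov_deriv_def Let_def p[symmetric] C.hderiv_def \<theta>[symmetric] inv 1
    by (simp add: slice_dirderiv[OF g])
qed

end

locale lagrangian_surface_chart = lagrangian_family_chart X A \<Theta> F c d
  for X :: "('x::{t2_space,second_countable_topology}, 'n::{finite,linorder}) acy_data"
    and A :: "('l::{t2_space,second_countable_topology}, (real, 'n) vec) chart set"
    and \<Theta> :: "(real \<times> real) set" and F :: "real \<times> real \<Rightarrow> 'l \<Rightarrow> 'x"
    and c :: "('l, (real, 'n) vec) chart" and d :: "('x, (complex, 'n) vec) chart" +
  fixes ll :: "real \<times> real \<Rightarrow> 'x \<Rightarrow> real"
  assumes ll: "smooth_fun_family A \<Theta> (\<lambda>\<theta>. ll \<theta> \<circ> F \<theta>)"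
begin

definition lc :: "(real \<times> real) \<times> (real, 'n) vec \<Rightarrow> real" where
  "lc = (\<lambda>(\<theta>, y). ll \<theta> (F \<theta> (chart_inv c y)))"

lemma smooth_lc: "smooth_on W lc"
proof -
  have "smooth_on (\<Theta> \<times> chart_image c) lc"
    using ll c unfolding smooth_fun_family_def lc_def by simp
  then show ?thesis by (rule smooth_on_subset) (auto simp: W_def)
qed

abbreviation "dS \<equiv> ((1, 0), 0) :: (real \<times> real) \<times> (real, 'n) vec"
abbreviation "dT \<equiv> ((0, 1), 0) :: (real \<times> real) \<times> (real, 'n) vec"

lemma curvature_F:
  assumes W: "((0, 0), y) \<in> W"
  shows "curvature A X F ll (F (0, 0) (chart_inv c y)) =
    (\<Sum>j\<in>UNIV. C.horizontal_curvature dS dT ((0, 0), y) j * dirderiv (Y j) lc ((0, 0), y))"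
proof -
  have lcd: "lc differentiable (at \<xi>)" if "\<xi> \<in> W" for \<xi> by (rule smooth_on_differentiable[OF smooth_lc that])
  \<comment> \<open>The inner derivative is computed at all points of \<open>W\<close> and not just
    at the origin, because the outer one differentiates it.\<close>
  have T: "cov_deriv A X (\<lambda>t. F (s, t)) (\<lambda>t. ll (s, t)) t (F (s, t) (chart_inv c y)) = C.hderiv dT lc ((s, t), y)"
    if "((s, t), y) \<in> W" for s t y
    using cov_deriv_F[of "(s, t)" "(s, 0)" t "(0, 1)" y lc "\<lambda>t. ll (s, t)"] that lcd by (simp add: lc_def)
  have S: "cov_deriv A X (\<lambda>s. F (s, t)) (\<lambda>s. ll (s, t)) s (F (s, t) (chart_inv c y)) = C.hderiv dS lc ((s, t), y)"
    if "((s, t), y) \<in> W" for s t y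
    using cov_deriv_F[of "(s, t)" "(0, t)" s "(1, 0)" y lc "\<lambda>s. ll (s, t)"] that lcd by (simp add: lc_def)
  note hd = C.hderiv_differentiable[OF smooth_lc]
  have ST: "cov_deriv A X (\<lambda>s. F (s, 0)) (\<lambda>s. cov_deriv A X (\<lambda>t. F (s, t)) (\<lambda>t. ll (s, t)) 0) 0 (F (0, 0) (chart_inv c y))
      = C.hderiv dS (C.hderiv dT lc) ((0, 0), y)"
    using cov_deriv_F[of "(0, 0)" "(0, 0)" 0 "(1, 0)" y "C.hderiv dT lc" "\<lambda>s. cov_deriv A X (\<lambda>t. F (s, t)) (\<lambda>t. ll (s, t)) 0", OF _ W hd[OF W]] T
    by simp
  have TS: "cov_deriv A X (\<lambda>t. F (0, t)) (\<lambda>t. cov_deriv A X (\<lambda>s. F (s, t)) (\<lambda>s. ll (s, t)) 0) 0 (F (0, 0) (chart_inv c y))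
      = C.hderiv dT (C.hderiv dS lc) ((0, 0), y)"
    using cov_deriv_F[of "(0, 0)" "(0, 0)" 0 "(0, 1)" y "C.hderiv dS lc" "\<lambda>t. cov_deriv A X (\<lambda>s. F (s, t)) (\<lambda>s. ll (s, t)) 0", OF _ W hd[OF W]] S
    by simp
  show ?thesis unfolding curvature_def ST TS by (rule C.hderiv_commutator[OF smooth_lc W])
qed

end

section \<open>The Riemannian geometry of a Lagrangian in a chart\<close>

context lagrangian_family_chart
begin

lemma symp_props:
  shows "alternating 2 (symp X x)"
    and "symp X x (vpair (\<i> *s u) (\<i> *s v)) = symp X x (vpair u v)"
    and "u \<noteq> 0 \<Longrightarrow> symp X x (vpair u (\<i> *s u)) > 0"
  using X unfolding almost_calabi_yau_def symplectic_form_def compatible_def by auto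

lemma hol_form_props:
  shows "alternating CARD('n) (hol_form X x)"
    and "i < CARD('n) \<Longrightarrow> hol_form X x (v(i := \<i> *s v i)) = \<i> * hol_form X x v"
  using X unfolding almost_calabi_yau_def holomorphic_top_form_def by auto

text \<open>The differential of \<open>F \<theta>\<close> in the chart \<open>c\<close>, complexified, with values in the tangent space of
  \<open>X\<close>.\<close>
definition frame :: "'t \<times> (real, 'n) vec \<Rightarrow> (complex, 'n) vec \<Rightarrow> (complex, 'n) vec" where
  "frame = (\<lambda>(\<theta>, y) v. toX (F \<theta> (chart_inv c y)) (C.P (\<theta>, y) *v v))"

text \<open>The induced metric in the chart \<open>c\<close>, whereas \<open>lag_riem\<close> is
  read in the varying \<open>chart_at\<close>.\<close>

definition kform :: "'t \<times> (real, 'n) vec \<Rightarrow> (real, 'n) vec \<Rightarrow> (real, 'n) vec \<Rightarrow> real" where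
  "kform = (\<lambda>(\<theta>, y) u v. symp X (F \<theta> (chart_inv c y)) (vpair (frame (\<theta>, y) (cvec u)) (\<i> *s frame (\<theta>, y) (cvec v))))"

lemma toX_props:
  assumes "x \<in> fst d"
  shows "linear (toX x)" "toX x (\<i> *s v) = \<i> *s toX x v" "transition (chart_at (charts X) x) d x (toX x v) = v"
  by (rule linear_transition[OF atlasX(2) d chart_at_in(1)[OF atlasX(2)] assms chart_at_in(2)[OF atlasX(2)]]
    transition_complex_linear[OF atlasX(1) d chart_at_in(1)[OF atlasX(2)] assms chart_at_in(2)[OF atlasX(2)]]
    transition_inverse[OF atlasX(2) d chart_at_in(1)[OF atlasX(2)] assms chart_at_in(2)[OF atlasX(2)]])+

lemma frame_props:
  assumes W: "\<xi> \<in> W"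
  shows "linear (frame \<xi>)" "frame \<xi> (\<i> *s v) = \<i> *s frame \<xi> v" "frame \<xi> v = 0 \<longleftrightarrow> v = 0"
proof -
  obtain \<theta> y where \<xi>: "\<xi> = (\<theta>, y)" by force
  note w = W_point[OF W[unfolded \<xi>]]
  let ?x = "F \<theta> (chart_inv c y)"
  note T = toX_props[OF w(5)]
  have linP: "linear ((*v) (C.P \<xi>))"
    by (rule linearI, rule matrix_vector_right_distrib) (simp add: vec_eq_iff matrix_vector_mult_def scaleR_sum_right)
  have f: "frame \<xi> = toX ?x \<circ> (*v) (C.P \<xi>)" by (auto simp: frame_def \<xi>)
  show lin: "linear (frame \<xi>)" unfolding f by (rule linear_compose[OF linP T(1)])
  show "frame \<xi> (\<i> *s v) = \<i> *s frame \<xi> v" unfolding f by (simp add: vector_scalar_commute T(2))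
  show "frame \<xi> v = 0 \<longleftrightarrow> v = 0"
  proof
    assume "frame \<xi> v = 0"
    then have "transition (chart_at (charts X) ?x) d ?x (toX ?x (C.P \<xi> *v v)) = transition (chart_at (charts X) ?x) d ?x (toX ?x 0)"
      unfolding f by (simp add: linear_0[OF T(1)])
    then have "C.P \<xi> *v v = 0" unfolding T(3) .
    then show "v = 0" using cramer[OF C.det_nz[OF W], of v 0] cramer[OF C.det_nz[OF W], of 0 0] by simp
  qed (simp add: linear_0[OF lin])
qed

lemma linear_cvec: "linear (cvec :: (real, 'n) vec \<Rightarrow> (complex, 'n) vec)"
  by (rule linearI) (simp_all add: cvec_def vec_eq_iff scaleR_conv_of_real[where 'a = complex])

lemma cvec_eq_0: "cvec v = 0 \<longleftrightarrow> v = 0"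
  by (simp add: cvec_def vec_eq_iff)

lemma mderiv_frame:
  assumes W: "(\<theta>, y) \<in> W" and p: "p = chart_inv c y"
  shows "mderiv A (charts X) (F \<theta>) p \<eta> = frame (\<theta>, y) (cvec (toC p \<eta>))"
  using mderiv_F[OF W p refl] by (simp add: frame_def p C.P_def)

lemma hol_form_frame:
  assumes W: "(\<theta>, y) \<in> W"
  shows "hol_form X (F \<theta> (chart_inv c y)) (\<lambda>i. frame (\<theta>, y) (v i)) = C.m (\<theta>, y) * detform v"
  using hol_form_toX[OF W_point(5)[OF W]] by (simp add: frame_def detform_mult C.m_def W_point(6)[OF W])

lemma lagrangian_frame:
  assumes W: "(\<theta>, y) \<in> W"
  shows "symp X (F \<theta> (chart_inv c y)) (vpair (frame (\<theta>, y) (cvec u)) (frame (\<theta>, y) (cvec v))) = 0"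
proof -
  let ?p = "chart_inv c y"
  note w = W_point[OF W]
  let ?S' = "transition c (chart_at A ?p) ?p"
  have "(\<lambda>i. mderiv A (charts X) (F \<theta>) ?p (vpair (?S' u) (?S' v) i)) = vpair (frame (\<theta>, y) (cvec u)) (frame (\<theta>, y) (cvec v))"
    unfolding mderiv_frame[OF W refl] using toC_inverse[OF w(3)] by (auto simp: fun_eq_iff split: nat.split)
  then show ?thesis
    using lagr[OF w(1)] unfolding lagrangian_def pullback_def by metis
qed

lemma kform_props:
  assumes W: "\<xi> \<in> W"
  shows "linear (\<lambda>u. kform \<xi> u v)" "linear (kform \<xi> u)" "kform \<xi> u v = kform \<xi> v u" "u \<noteq> 0 \<Longrightarrow> kform \<xi> u u > 0"
proof -
  obtain \<theta> y where \<xi>: "\<xi> = (\<theta>, y)" by force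
  have fc: "linear (\<lambda>u. frame \<xi> (cvec u))"
    using linear_compose[OF linear_cvec frame_props(1)[OF W]] by (simp add: o_def)
  have li: "linear (\<lambda>u :: (complex, 'n) vec. \<i> *s u)" by (rule linearI) (simp_all add: vec_eq_iff)
  show "linear (\<lambda>u. kform \<xi> u v)"
    using linear_compose[OF fc two_form_linear_left[OF symp_props(1)]] by (simp add: kform_def \<xi> o_def)
  show "linear (kform \<xi> u)"
    using linear_compose[OF linear_compose[OF fc li] two_form_linear_right[OF symp_props(1)]]
    by (simp add: kform_def \<xi> o_def)
  show "kform \<xi> u v = kform \<xi> v u"
    unfolding kform_def \<xi> by (simp add: kaehler_sym[OF symp_props(1,2)])
  show "kform \<xi> u u > 0" if "u \<noteq> 0"
    using symp_props(3) frame_props(3)[OF W] that unfolding kform_def \<xi> by (simp add: cvec_eq_0)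
qed

lemma lag_riem_kform:
  assumes W: "(\<theta>, y) \<in> W" and p: "p = chart_inv c y"
  shows "lag_riem A X (F \<theta>) p v = kform (\<theta>, y) (toC p (v 0)) (toC p (v 1))"
  unfolding lag_riem_def pullback_def kmetric_def mderiv_frame[OF W p] kform_def by (simp add: p)

lemma lag_riem_sym: "lag_riem A X (F \<theta>) p (vpair u v) = lag_riem A X (F \<theta>) p (vpair v u)"
  unfolding lag_riem_def pullback_def kmetric_def by (simp add: kaehler_sym[OF symp_props(1,2)])

text \<open>Positive definiteness of the metric; this gives the uniqueness behind the definite
  description in \<open>gradient\<close>.\<close>

lemma riem_unique:
  assumes W: "(\<theta>, y) \<in> W" and p: "p = chart_inv c y"
    and "\<And>u. lag_riem A X (F \<theta>) p (vpair v u) = lag_riem A X (F \<theta>) p (vpair v' u)"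
  shows "v = v'"
proof -
  let ?S = "toC p"
  note K = kform_props[OF W]
  have linS: "linear ?S" using toC_linear W_point(3)[OF W] p by blast
  have "kform (\<theta>, y) (?S v) (?S (v - v')) = kform (\<theta>, y) (?S v') (?S (v - v'))"
    using assms(3)[of "v - v'"] by (simp add: lag_riem_kform[OF W p])
  then have "kform (\<theta>, y) (?S (v - v')) (?S (v - v')) = 0"
    by (simp add: linear_diff[OF linS] linear_diff[OF K(1)])
  then have "?S (v - v') = 0" using K(4) by force
  then have "?S v = ?S v'" by (simp add: linear_diff[OF linS])
  then show "v = v'" using toC_inverse' W_point(3)[OF W] p by metis
qed

lemma gradientI:
  assumes W: "(\<theta>, y) \<in> W" and p: "p = chart_inv c y"
    and v: "\<And>u. kform (\<theta>, y) v (toC p u) = fderiv A \<phi> p u"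
  shows "toC p (gradient A (lag_riem A X (F \<theta>)) \<phi> p) = v"
    and "lag_riem A X (F \<theta>) p (vpair (gradient A (lag_riem A X (F \<theta>)) \<phi> p) u) = fderiv A \<phi> p u"
proof -
  have pc: "p \<in> fst c" using W_point(3)[OF W] p by simp
  let ?g = "transition c (chart_at A p) p v"
  have g: "lag_riem A X (F \<theta>) p (vpair ?g u) = fderiv A \<phi> p u" for u
    using v by (simp add: lag_riem_kform[OF W p] toC_inverse[OF pc])
  have "gradient A (lag_riem A X (F \<theta>)) \<phi> p = ?g"
    unfolding gradient_def by (rule the_equality) (use g riem_unique[OF W p] in auto)
  then show "toC p (gradient A (lag_riem A X (F \<theta>)) \<phi> p) = v"
    "lag_riem A X (F \<theta>) p (vpair (gradient A (lag_riem A X (F \<theta>)) \<phi> p) u) = fderiv A \<phi> p u"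
    using g toC_inverse[OF pc] by auto
qed

text \<open>Existence is a matter of dimension: pairing with the metric is an injective linear map
  of a finite-dimensional space into itself, hence surjective.\<close>

lemma gradient_works:
  assumes W: "(\<theta>, y) \<in> W" and p: "p = chart_inv c y"
    and \<phi>: "(\<phi> \<circ> chart_inv c) differentiable (at y)"
  shows "lag_riem A X (F \<theta>) p (vpair (gradient A (lag_riem A X (F \<theta>)) \<phi> p) u) = fderiv A \<phi> p u"
proof -
  note K = kform_props[OF W] and w = W_point[OF W, folded p]
  define T where "T v = (\<chi> j. kform (\<theta>, y) v (axis j 1))" for v
  have Tk: "kform (\<theta>, y) v u = (\<Sum>j\<in>UNIV. u $ j * T v $ j)" for v u
    by (subst vec_axis_sum[of u]) (simp add: linear_sum[OF K(2)] linear_scale[OF K(2)] T_def)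
  have linT: "linear T"
    by (rule linearI) (simp_all add: T_def vec_eq_iff linear_add[OF K(1)] linear_scale[OF K(1)])
  have "inj T"
    unfolding linear_injective_0[OF linT]
  proof (intro allI impI)
    fix v assume "T v = 0"
    then have "kform (\<theta>, y) v v = 0" by (simp add: Tk)
    then show "v = 0" using K(4) by force
  qed
  then have "surj T" by (intro eucl.linear_injective_imp_surjective[OF linT] refl)
  let ?D = "\<lambda>u. dirderiv u (\<phi> \<circ> chart_inv c) y"
  obtain v where v: "T v = (\<chi> j. ?D (axis j 1))" using \<open>surj T\<close> by (metis surjD)
  have "kform (\<theta>, y) v u = ?D u" for u
    by (subst (2) vec_axis_sum[of u]) (simp add: Tk v dirderiv_sum_dir[OF \<phi>])
  then have "kform (\<theta>, y) v (toC p u) = fderiv A \<phi> p u" for u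
    using fderiv_eq[OF atlasA c w(3), of \<phi> u] \<phi> w(4) by simp
  from gradientI(2)[OF W p this] show ?thesis .
qed

text \<open>Both the frame of the chart \<open>c\<close> and that of \<open>chart_at A p\<close> are needed; they are covered by a linear
  bijection \<open>S\<close>.\<close>
lemma rho_frame:
  assumes W: "(\<theta>, y) \<in> W" and S: "linear S" "det (matrix S) \<noteq> 0"
  shows "acy_rho X (F \<theta> (chart_inv c y)) > 0"
    and "acy_rho X (F \<theta> (chart_inv c y)) ^ CARD('n) * det (\<chi> (a :: 'n) (b :: 'n). kform (\<theta>, y) (S (axis a 1)) (S (axis b 1)))
      = (cmod (C.m (\<theta>, y)) * \<bar>det (matrix S)\<bar>)\<^sup>2"
proof -
  let ?x = "F \<theta> (chart_inv c y)"
  define E where "E i = frame (\<theta>, y) (cvec (S (sframe i)))" for i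
  have h: "hol_form X ?x E = C.m (\<theta>, y) * of_real (det (matrix S))"
    unfolding E_def hol_form_frame[OF W] detform_cvec detform_linear_map[OF S(1)] detform_sframe by simp
  then have nz: "hol_form X ?x E \<noteq> 0" using C.m_nz[OF W] S(2) by simp
  have "hol_form X ?x E = detform E * hol_form X ?x sframe"
    by (rule alt_on_eq_detform[OF alternating_imp_alt_on[OF hol_form_props(1)]])
      (rule alternating_complex_lincomb[OF hol_form_props], simp_all)
  then have E: "detform E \<noteq> 0" using nz by auto
  have lag: "symp X ?x (vpair (E i) (E j)) = 0" for i j unfolding E_def by (rule lagrangian_frame[OF W])
  note R = acy_rho_lagrangian_frame[of X ?x E, OF symp_props E lag hol_form_props nz]
  show "acy_rho X ?x > 0" using R(1) .
  have "symp X ?x (vpair (E (index_of a)) (\<i> *s E (index_of b))) = kform (\<theta>, y) (S (axis a 1)) (S (axis b 1))" for a b :: 'n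
    by (simp add: E_def kform_def sframe_index_of)
  then show "acy_rho X ?x ^ CARD('n) * det (\<chi> (a :: 'n) (b :: 'n). kform (\<theta>, y) (S (axis a 1)) (S (axis b 1)))
      = (cmod (C.m (\<theta>, y)) * \<bar>det (matrix S)\<bar>)\<^sup>2"
    using R(2) h by (simp add: norm_mult)
qed

text \<open>The Riemannian volume density in the chart \<open>c\<close>, written through
  \<open>m\<close> and \<rho> so that its logarithmic derivative can be read off.\<close>

definition density :: "'t \<times> (real, 'n) vec \<Rightarrow> real" where
  "density = (\<lambda>(\<theta>, y). cmod (C.m (\<theta>, y)) / acy_rho X (F \<theta> (chart_inv c y)) powr (real CARD('n) / 2))"

text \<open>The square root of the identity in \<open>rho_frame\<close>; the positive determinant of
  \<open>toC\<close> fixes its sign.\<close>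

lemma vol_form_density:
  assumes W: "(\<theta>, y) \<in> W" and p: "p = chart_inv c y"
  shows "vol_form (lag_riem A X (F \<theta>)) p v = density (\<theta>, y) * detform (\<lambda>i. toC p (v i))"
proof -
  have pc: "p \<in> fst c" using W_point(3)[OF W] p by simp
  note S = toC_linear[OF pc]
  let ?\<rho> = "acy_rho X (F \<theta> p)"
  let ?D = "det (\<chi> (a :: 'n) (b :: 'n). lag_riem A X (F \<theta>) p (vpair (axis a 1) (axis b 1)))"
  have r: "?\<rho> > 0" "?\<rho> ^ CARD('n) * ?D = (cmod (C.m (\<theta>, y)) * det (matrix (toC p)))\<^sup>2"
    using rho_frame[OF W S(1), folded p] S(2) by (simp_all add: lag_riem_kform[OF W p])
  have "?\<rho> ^ CARD('n) = (?\<rho> powr (real CARD('n) / 2))\<^sup>2"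
    using r(1) by (simp add: power2_eq_square powr_add[symmetric] powr_realpow)
  then have "?D = (cmod (C.m (\<theta>, y)) * det (matrix (toC p)) / ?\<rho> powr (real CARD('n) / 2))\<^sup>2"
    using r by (simp add: power_divide field_simps)
  then have "sqrt ?D = density (\<theta>, y) * det (matrix (toC p))"
    using S(2) by (simp add: density_def p[symmetric])
  moreover have "det (\<chi> a b. v (card {..<b}) $ a) = detform v"
    by (simp add: detform_def index_of_def)
  ultimately show ?thesis
    unfolding vol_form_def detform_linear_map[OF S(1)] by simp
qed

text \<open>The volume form is a positive multiple of the determinant that \<open>m\<close>
  multiplies, so the phase of the pulled back \<Omega> is that of \<open>m\<close>; the range of
  \<open>Arg\<close> is the one in the definition of the angle.\<close>

lemma lag_angle_Arg:
  assumes W: "(\<theta>, y) \<in> W" and p: "p = chart_inv c y"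
  shows "lag_angle A X (F \<theta>) p = Arg (C.m (\<theta>, y))"
proof -
  have pc: "p \<in> fst c" using W_point(3)[OF W] p by simp
  note S = toC_linear[OF pc]
  let ?\<rho> = "acy_rho X (F \<theta> p)" and ?m = "C.m (\<theta>, y)"
  have m: "?m \<noteq> 0" by (rule C.m_nz[OF W])
  have r: "?\<rho> > 0" using rho_frame(1)[OF W S(1)] S(2) p by simp
  have "?\<rho> powr (real CARD('n) / 2) * vol_form (lag_riem A X (F \<theta>)) p v = cmod ?m * detform (\<lambda>i. toC p (v i))" for v
    using r by (simp add: vol_form_density[OF W p] density_def p[symmetric])
  moreover have "pullback A (charts X) (F \<theta>) (hol_form X) p v = ?m * of_real (detform (\<lambda>i. toC p (v i)))" for v
    using pullback_hol_form[OF W p] by (simp add: C.m_def C.P_def)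
  moreover have "(\<forall>v :: nat \<Rightarrow> (real, 'n) vec. ?m * of_real (detform (\<lambda>i. toC p (v i))) =
      cis t * of_real (cmod ?m * detform (\<lambda>i. toC p (v i)))) \<longleftrightarrow> sgn ?m = cis t" (is "?all \<longleftrightarrow> _") for t
  proof -
    have "detform (\<lambda>i. toC p (sframe i)) \<noteq> 0" using S(2) by (simp add: detform_linear_map[OF S(1)] detform_sframe)
    then have "?all \<longleftrightarrow> ?m = cis t * of_real (cmod ?m)"
      unfolding of_real_mult mult.assoc[symmetric] by (metis mult_cancel_right of_real_eq_0_iff)
    also have "\<dots> \<longleftrightarrow> sgn ?m = cis t" using m by (auto simp: sgn_eq field_simps)
    finally show ?thesis .
  qed
  ultimately have "lag_angle A X (F \<theta>) p = (THE t. - pi < t \<and> t \<le> pi \<and> sgn ?m = cis t)"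
    unfolding lag_angle_def by (simp only:)
  also have "\<dots> = Arg ?m"
    by (rule the_equality) (use Arg_bounded cis_Arg[OF m] cis_Arg_unique in auto)
  finally show ?thesis .
qed

lemma slice_axis:
  assumes "g differentiable (at (\<theta>, y))"
  shows "(\<lambda>y. g (\<theta>, y)) differentiable (at y)"
    and "dirderiv v (\<lambda>y. g (\<theta>, y)) y = dirderiv (0, v) g (\<theta>, y)"
    and "dirderiv (axis k 1) (\<lambda>y. g (\<theta>, y)) y = dirderiv (Y k) g (\<theta>, y)"
  using differentiableI[OF slice_derivative[OF assms]] dirderivI[OF slice_derivative[OF assms]] by (auto simp: Y_def)

lemma open_slice: "open {y. (\<theta>, y) \<in> W}"
proof -
  have "open ((\<lambda>y. (\<theta>, y)) -` W)" by (intro open_vimage open_W continuous_intros)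
  then show ?thesis by (simp add: vimage_def)
qed

lemma kform_tensor:
  assumes W: "(\<theta>, y) \<in> W"
  shows "kform (\<theta>, y) u v = tensor_in (charts X) d (symp X) (\<Phi> (\<theta>, y))
     (vpair (dirderiv (0, u) \<Phi> (\<theta>, y)) (\<i> *s dirderiv (0, v) \<Phi> (\<theta>, y)))"
proof -
  note w = W_point[OF W]
  let ?x = "F \<theta> (chart_inv c y)"
  have "frame (\<theta>, y) (cvec u) = toX ?x (dirderiv (0, u) \<Phi> (\<theta>, y))" for u
    using P_cvec[OF W] by (simp add: frame_def C.P_def)
  moreover have "\<i> *s toX ?x z = toX ?x (\<i> *s z)" for z using toX_props(2)[OF w(5)] by simp
  moreover have "(\<lambda>i. toX ?x (vpair z z' i)) = vpair (toX ?x z) (toX ?x z')" for z z' by (auto simp: fun_eq_iff split: nat.split)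
  ultimately show ?thesis unfolding w(6) tensor_in_eq[OF atlasX(2) d w(5)] by (simp add: kform_def)
qed

lemma kform_differentiable:
  assumes W: "(\<theta>, y) \<in> W"
  shows "(\<lambda>y. kform (\<theta>, y) u v) differentiable (at y)"
proof -
  let ?\<omega> = "\<lambda>z a b. tensor_in (charts X) d (symp X) z (vpair a b)"
  let ?B = "Basis :: (complex, 'n) vec set"
  have lin: "linear (\<lambda>a. ?\<omega> z a b)" "linear (?\<omega> z b)" if "z \<in> chart_image d" for z b
  proof -
    define x where "x = chart_inv d z"
    have x: "x \<in> fst d" "snd d x = z" using chart_d(5,6)[OF that] by (auto simp: x_def)
    have e: "?\<omega> z a b = symp X x (vpair (toX x a) (toX x b))" for a b
      unfolding x(2)[symmetric] tensor_in_eq[OF atlasX(2) d x(1)]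
      by (rule arg_cong[where f = "symp X x"]) (auto simp: fun_eq_iff split: nat.split)
    show "linear (\<lambda>a. ?\<omega> z a b)" "linear (?\<omega> z b)" unfolding e
      using linear_compose[OF toX_props(1)[OF x(1)] two_form_linear_left[OF symp_props(1)]]
        linear_compose[OF toX_props(1)[OF x(1)] two_form_linear_right[OF symp_props(1)]] by (auto simp: o_def)
  qed
  \<comment> \<open>\<open>smooth_tensor\<close> speaks of constant arguments only, so the varying
    ones are first expanded in a real basis.\<close>
  have expand: "?\<omega> z a b = (\<Sum>i\<in>?B. \<Sum>j\<in>?B. (a \<bullet> i) * ((b \<bullet> j) * ?\<omega> z i j))" if "z \<in> chart_image d" for z a b
  proof -
    have "?\<omega> z a b = ?\<omega> z (\<Sum>i\<in>?B. (a \<bullet> i) *\<^sub>R i) b" by (simp only: euclidean_representation)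
    also have "\<dots> = (\<Sum>i\<in>?B. (a \<bullet> i) * ?\<omega> z i b)"
      by (simp add: linear_sum[OF lin(1)[OF that]] linear_scale[OF lin(1)[OF that]])
    also have "\<dots> = (\<Sum>i\<in>?B. (a \<bullet> i) * ?\<omega> z i (\<Sum>j\<in>?B. (b \<bullet> j) *\<^sub>R j))" by (simp only: euclidean_representation)
    finally show ?thesis
      by (simp add: linear_sum[OF lin(2)[OF that]] linear_scale[OF lin(2)[OF that]] sum_distrib_left)
  qed
  have \<omega>: "(\<lambda>y. ?\<omega> (\<Phi> (\<theta>, y)) i j) differentiable (at y)" for i j
  proof -
    have "smooth_on (chart_image d) (\<lambda>z. ?\<omega> z i j)"
      using X d unfolding almost_calabi_yau_def symplectic_form_def smooth_tensor_def by blast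
    then have "(\<lambda>z. ?\<omega> z i j) differentiable (at (\<Phi> (\<theta>, y)))" by (rule smooth_on_differentiable) (rule W_point(7)[OF W])
    from differentiable_chain_at[OF slice_axis(1)[OF smooth_on_differentiable[OF smooth_\<Phi> W]] this]
    show ?thesis by (simp add: o_def)
  qed
  have D: "(\<lambda>y. L (dirderiv (0, u) \<Phi> (\<theta>, y))) differentiable (at y)" if "bounded_linear L" for L :: "(complex, 'n) vec \<Rightarrow> real" and u
    by (rule differentiable_bounded_linear[OF that slice_axis(1)[OF C.deriv_\<Phi>_differentiable[OF W]]])
  have bi: "bounded_linear (\<lambda>z :: (complex, 'n) vec. (\<i> *s z) \<bullet> j)" for j
    unfolding linear_conv_bounded_linear[symmetric] by (rule linearI) (simp_all add: inner_vec_def sum.distrib algebra_simps sum_distrib_left)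
  have "(\<lambda>y. \<Sum>i\<in>?B. \<Sum>j\<in>?B. (dirderiv (0, u) \<Phi> (\<theta>, y) \<bullet> i) * (((\<i> *s dirderiv (0, v) \<Phi> (\<theta>, y)) \<bullet> j) * ?\<omega> (\<Phi> (\<theta>, y)) i j)) differentiable (at y)"
    by (intro differentiable_sum differentiable_mult \<omega> D bi bounded_linear_inner_left ballI finite_Basis)
  moreover have "kform (\<theta>, y) u v = (\<Sum>i\<in>?B. \<Sum>j\<in>?B. (dirderiv (0, u) \<Phi> (\<theta>, y) \<bullet> i) * (((\<i> *s dirderiv (0, v) \<Phi> (\<theta>, y)) \<bullet> j) * ?\<omega> (\<Phi> (\<theta>, y)) i j))"
    if "y \<in> {y. (\<theta>, y) \<in> W}" for y
    using that by (simp add: kform_tensor expand[OF W_point(7)])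
  ultimately show ?thesis
    using differentiable_cong_open[OF open_slice, of y \<theta> _ "\<lambda>y. kform (\<theta>, y) u v"] W by simp
qed

text \<open>The definite description shows no regularity; the function is recovered as the n-th root
  of \<open>|m|\<^sup>2\<close> over the Gram determinant, both of them differentiable and
  positive.\<close>

lemma rho_differentiable:
  assumes W: "(\<theta>, y) \<in> W"
  shows "(\<lambda>y. acy_rho X (F \<theta> (chart_inv c y))) differentiable (at y)"
proof -
  let ?D = "\<lambda>y. det (\<chi> (a :: 'n) (b :: 'n). kform (\<theta>, y) (axis a 1) (axis b 1))"
  let ?M = "\<lambda>y. (Re (C.m (\<theta>, y)))\<^sup>2 + (Im (C.m (\<theta>, y)))\<^sup>2"
  let ?\<rho> = "\<lambda>y. acy_rho X (F \<theta> (chart_inv c y))"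
  have R: "?\<rho> y > 0" "?\<rho> y ^ CARD('n) * ?D y = ?M y" "?M y > 0" if "(\<theta>, y) \<in> W" for y
  proof -
    have id: "linear (\<lambda>v :: (real, 'n) vec. v)" by (rule linear_ident)
    show "?\<rho> y > 0" "?\<rho> y ^ CARD('n) * ?D y = ?M y"
      using rho_frame[OF that id] by (simp_all add: matrix_ident cmod_power2)
    show "?M y > 0" using C.pos[OF that] by (simp add: sum_power2_gt_zero_iff)
  qed
  have D: "?D y > 0" using R[OF W] by (metis zero_less_mult_pos zero_less_power)
  have eq: "(?M y / ?D y) powr (1 / real CARD('n)) = ?\<rho> y" if "y \<in> {y. (\<theta>, y) \<in> W}" for y
  proof -
    have W: "(\<theta>, y) \<in> W" using that by simp
    have "?D y \<noteq> 0" using R[OF W] by auto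
    then have "?M y / ?D y = ?\<rho> y ^ CARD('n)" using R(2)[OF W] by (simp add: field_simps)
    also have "\<dots> = ?\<rho> y powr real CARD('n)" using R(1)[OF W] by (simp add: powr_realpow)
    finally show ?thesis using R(1)[OF W] by (simp add: powr_powr)
  qed
  have dm: "(\<lambda>y. C.m (\<theta>, y)) differentiable (at y)" by (rule slice_axis(1)[OF C.m_diff[OF W]])
  have "?D differentiable (at y)" by (rule det_differentiable) (simp add: kform_differentiable[OF W])
  moreover have "?M differentiable (at y)" unfolding power2_eq_square
    by (intro differentiable_add differentiable_mult differentiable_bounded_linear[OF bounded_linear_Re dm]
        differentiable_bounded_linear[OF bounded_linear_Im dm])
  ultimately have "(\<lambda>y. ?M y / ?D y) differentiable (at y)" using D by (intro differentiable_divide) auto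
  then have "(\<lambda>y. (?M y / ?D y) powr (1 / real CARD('n))) differentiable (at y)"
    using has_derivative_powr[OF has_derivative_frechet_derivative has_derivative_const[of "1 / real CARD('n)"]] R(3)[OF W] D
    by (force intro: differentiableI)
  from differentiable_cong_open[OF open_slice _ eq this] show ?thesis using W by simp
qed

text \<open>\<open>Re m > 0\<close> keeps \<open>m\<close> off the cut of the logarithm, so the
  angle is locally \<open>Im (Ln m)\<close>.\<close>

lemma angle_derivative:
  assumes W: "(\<theta>, y) \<in> W"
  shows "(\<lambda>y. lag_angle A X (F \<theta>) (chart_inv c y)) differentiable (at y)"
    and "dirderiv v (\<lambda>y. lag_angle A X (F \<theta>) (chart_inv c y)) y = Im (dirderiv (0, v) C.m (\<theta>, y) / C.m (\<theta>, y))"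
proof -
  have m: "C.m (\<theta>, y) \<notin> \<real>\<^sub>\<le>\<^sub>0" using C.pos[OF W] by (auto simp: complex_nonpos_Reals_iff)
  have "((\<lambda>y. Ln (C.m (\<theta>, y))) has_derivative (\<lambda>v. inverse (C.m (\<theta>, y)) * dirderiv (0, v) C.m (\<theta>, y))) (at y)"
    using diff_chain_at[OF slice_derivative[OF C.m_diff[OF W]] has_field_derivative_imp_has_derivative[OF has_field_derivative_Ln[OF m]]]
    by (simp add: o_def)
  from bounded_linear.has_derivative[OF bounded_linear_Im this]
  have "((\<lambda>y. Im (Ln (C.m (\<theta>, y)))) has_derivative (\<lambda>v. Im (dirderiv (0, v) C.m (\<theta>, y) / C.m (\<theta>, y)))) (at y)"
    by (simp only: divide_inverse mult.commute)
  then have *: "((\<lambda>y. lag_angle A X (F \<theta>) (chart_inv c y)) has_derivative (\<lambda>v. Im (dirderiv (0, v) C.m (\<theta>, y) / C.m (\<theta>, y)))) (at y)"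
    by (rule has_derivative_transform_within_open[OF _ open_slice])
      (use W in \<open>auto simp: lag_angle_Arg Arg_eq_Im_Ln[OF C.m_nz]\<close>)
  show "(\<lambda>y. lag_angle A X (F \<theta>) (chart_inv c y)) differentiable (at y)" by (rule differentiableI[OF *])
  show "dirderiv v (\<lambda>y. lag_angle A X (F \<theta>) (chart_inv c y)) y = Im (dirderiv (0, v) C.m (\<theta>, y) / C.m (\<theta>, y))"
    by (rule dirderivI[OF *])
qed

text \<open>The logarithmic derivative of \<open>cmod m\<close> is the real part of that of
  \<open>m\<close>, the counterpart of the imaginary part in
  \<open>angle_derivative\<close>.\<close>

lemma density_derivative:
  fixes \<theta> y
  defines "\<rho> \<equiv> \<lambda>y. acy_rho X (F \<theta> (chart_inv c y))"
  assumes W: "(\<theta>, y) \<in> W"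
  shows "density (\<theta>, y) > 0" and "(\<lambda>y. density (\<theta>, y)) differentiable (at y)"
    and "dirderiv v (\<lambda>y. density (\<theta>, y)) y =
      density (\<theta>, y) * (Re (dirderiv (0, v) C.m (\<theta>, y) / C.m (\<theta>, y)) - real CARD('n) / (2 * \<rho> y) * dirderiv v \<rho> y)"
proof -
  let ?m = "C.m (\<theta>, y)" and ?s = "real CARD('n) / 2"
  have m: "?m \<noteq> 0" by (rule C.m_nz[OF W])
  have r: "\<rho> y > 0"
    using rho_frame(1)[OF W linear_ident] by (simp add: matrix_ident \<rho>_def)
  have dens: "(\<lambda>y. density (\<theta>, y)) = (\<lambda>y. cmod (C.m (\<theta>, y)) * \<rho> y powr (- ?s))"
    by (simp add: density_def \<rho>_def powr_minus field_simps)
  show "density (\<theta>, y) > 0" using fun_cong[OF dens, of y] m r by simp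
  have "(cmod has_derivative (\<lambda>h. h \<bullet> sgn ?m)) (at ?m)" by (rule has_derivative_norm[OF m])
  from diff_chain_at[OF slice_derivative[OF C.m_diff[OF W]] this]
  have 1: "((\<lambda>y. cmod (C.m (\<theta>, y))) has_derivative (\<lambda>v. dirderiv (0, v) C.m (\<theta>, y) \<bullet> sgn ?m)) (at y)" by (simp add: o_def)
  have 2: "((\<lambda>y. \<rho> y powr (- ?s)) has_derivative (\<lambda>v. \<rho> y powr (- ?s) * (0 * ln (\<rho> y) + dirderiv v \<rho> y * (- ?s) / \<rho> y))) (at y)"
    by (rule has_derivative_powr[OF has_derivative_frechet_derivative has_derivative_const])
      (use r rho_differentiable[OF W] in \<open>auto simp: \<rho>_def\<close>)
  have ip: "w \<bullet> sgn ?m = cmod ?m * Re (w / ?m)" for w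
  proof -
    have "cmod ?m * Re (w / ?m) = cmod ?m * (w \<bullet> ?m) / (cmod ?m)\<^sup>2"
      by (simp add: Re_divide inner_complex_def cmod_power2)
    also have "\<dots> = w \<bullet> sgn ?m" using m by (simp add: power2_eq_square sgn_div_norm field_simps)
    finally show ?thesis ..
  qed
  have *: "((\<lambda>y. density (\<theta>, y)) has_derivative (\<lambda>v. density (\<theta>, y) *
     (Re (dirderiv (0, v) C.m (\<theta>, y) / C.m (\<theta>, y)) - real CARD('n) / (2 * \<rho> y) * dirderiv v \<rho> y))) (at y)"
    unfolding dens fun_cong[OF dens, of y]
    by (rule has_derivative_eq_rhs[OF has_derivative_mult[OF 1 2]]) (use r in \<open>auto simp: ip fun_eq_iff field_simps\<close>)
  show "(\<lambda>y. density (\<theta>, y)) differentiable (at y)" by (rule differentiableI[OF *])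
  show "dirderiv v (\<lambda>y. density (\<theta>, y)) y =
      density (\<theta>, y) * (Re (dirderiv (0, v) C.m (\<theta>, y) / C.m (\<theta>, y)) - real CARD('n) / (2 * \<rho> y) * dirderiv v \<rho> y)"
    by (rule dirderivI[OF *])
qed

section \<open>Laplacian and generating functions in the chart\<close>

lemma vector_in_toC:
  assumes "y \<in> chart_image c"
  shows "vector_in A c Z y = toC (chart_inv c y) (Z (chart_inv c y))"
  by (simp add: vector_in_def transition_def Let_def)

text \<open>The Hodge star of the differential is the coordinate volume contracted with
  \<open>density * U\<close>, so its exterior derivative is the divergence of that field. The
  gradient enters through \<open>toC\<close> because at neighbouring points \<open>chart_at\<close>
  may differ from \<open>c\<close>.\<close>

lemma laplace_beltrami_coords:
  assumes W: "(\<theta>, y) \<in> W" and p: "p = chart_inv c y" and cp: "chart_at A p = c"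
    and U: "\<And>y. (\<theta>, y) \<in> W \<Longrightarrow> toC (chart_inv c y) (gradient A (lag_riem A X (F \<theta>)) \<phi> (chart_inv c y)) = U y"
    and dU: "\<And>k. (\<lambda>y. U y $ k) differentiable (at y)"
  shows "laplace_beltrami A (lag_riem A X (F \<theta>)) \<phi> p =
    - (\<Sum>k\<in>UNIV. dirderiv (axis k 1) (\<lambda>y. U y $ k) y + dirderiv (axis k 1) (\<lambda>y. density (\<theta>, y)) y / density (\<theta>, y) * U y $ k)"
proof -
  let ?G = "lag_riem A X (F \<theta>)" and ?k = "\<lambda>y. density (\<theta>, y)" and ?n = "CARD('n)"
  note w = W_point[OF W]
  have coord: "coord A p = y" unfolding cp unfolding p by (rule w(4))
  have star: "tensor_in A c (hodge_star_d A ?G \<phi>) z v = ?k z * detform (case_nat (U z) v)"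
    if "z \<in> {z. (\<theta>, z) \<in> W}" for z v
  proof -
    have W: "(\<theta>, z) \<in> W" using that by simp
    let ?p = "chart_inv c z"
    have pc: "?p \<in> fst c" by (rule W_point(3)[OF W])
    have "tensor_in A c (hodge_star_d A ?G \<phi>) (snd c ?p) v =
       ?k z * detform (\<lambda>i. toC ?p (case_nat (gradient A ?G \<phi> ?p) (\<lambda>i. transition c (chart_at A ?p) ?p (v i)) i))"
      unfolding tensor_in_eq[OF atlasA c pc] hodge_star_d_def vol_form_density[OF W refl] ..
    also have "(\<lambda>i. toC ?p (case_nat (gradient A ?G \<phi> ?p) (\<lambda>i. transition c (chart_at A ?p) ?p (v i)) i)) = case_nat (U z) v"
      by (auto simp: fun_eq_iff U[OF W] toC_inverse[OF pc] split: nat.split)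
    finally show ?thesis by (simp add: W_point(4)[OF W])
  qed
  have dk: "?k differentiable (at y)" by (rule density_derivative(2)[OF W])
  have summand: "dirderiv (sframe i) (\<lambda>z. tensor_in A c (hodge_star_d A ?G \<phi>) z (\<lambda>j. if j < i then sframe j else sframe (Suc j))) y
      = (-1) ^ i * (?k y * dirderiv (sframe i) (\<lambda>y. U y $ of_index i) y + dirderiv (sframe i) ?k y * U y $ of_index i)"
    if i: "i < ?n" for i
  proof -
    have "(\<lambda>j. if j < i then sframe j else sframe (Suc j)) = (\<lambda>j. sframe (if j < i then j else Suc j) :: (real, 'n) vec)" by auto
    then have "tensor_in A c (hodge_star_d A ?G \<phi>) z (\<lambda>j. if j < i then sframe j else sframe (Suc j)) = (-1) ^ i * (?k z * U z $ of_index i)"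
      if "z \<in> {z. (\<theta>, z) \<in> W}" for z
      using star[OF that] detform_contract_sframe[OF i, of "U z"] by simp
    then have "dirderiv (sframe i) (\<lambda>z. tensor_in A c (hodge_star_d A ?G \<phi>) z (\<lambda>j. if j < i then sframe j else sframe (Suc j))) y
       = dirderiv (sframe i) (\<lambda>z. (-1) ^ i * (?k z * U z $ of_index i)) y"
      by (intro dirderiv_cong[OF open_slice[of \<theta>]]) (use W in auto)
    also have "\<dots> = (-1) ^ i * dirderiv (sframe i) (\<lambda>z. ?k z * U z $ of_index i) y"
      by (rule dirderiv_linear[OF bounded_linear_mult_right differentiable_mult[OF dk dU]])
    finally show ?thesis by (simp add: dirderiv_mult[OF dk dU])
  qed
  have "ext_deriv (?n - 1) (tensor_in A c (hodge_star_d A ?G \<phi>)) y sframe =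
     (\<Sum>i<?n. ?k y * dirderiv (sframe i) (\<lambda>y. U y $ of_index i) y + dirderiv (sframe i) ?k y * U y $ of_index i)"
  proof -
    have s: "{..?n - 1} = {..<?n}" by (metis lessThan_Suc_atMost Suc_pred' zero_less_card_finite)
    \<comment> \<open>The sign of the contraction meets the equal sign in
      \<open>ext_deriv\<close>.\<close>
    have e: "(-1) ^ i * ((-1) ^ i * x) = (x :: real)" for i x by (simp add: mult.assoc[symmetric] power_mult_distrib[symmetric])
    show ?thesis unfolding ext_deriv_def s by (intro sum.cong refl) (simp add: summand e)
  qed
  also have "\<dots> = (\<Sum>k\<in>UNIV. ?k y * dirderiv (axis k 1) (\<lambda>y. U y $ k) y + dirderiv (axis k 1) ?k y * U y $ k)"
    unfolding sum_index_of sframe_index_of by simp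
  finally have ext: "ext_deriv (?n - 1) (tensor_in A c (hodge_star_d A ?G \<phi>)) y sframe =
    (\<Sum>k\<in>UNIV. ?k y * dirderiv (axis k 1) (\<lambda>y. U y $ k) y + dirderiv (axis k 1) ?k y * U y $ k)" .
  have "toC p v = v" for v
    unfolding cp by (rule transition_self[OF atlasA c]) (use w(3) p in simp)
  then have vol: "vol_form ?G p sframe = ?k y" unfolding vol_form_density[OF W p] by (simp add: detform_sframe)
  show ?thesis
    unfolding laplace_beltrami_def cp coord std_frame_eq vol ext[folded cp, unfolded cp]
    using density_derivative(1)[OF W] ext coord cp by (simp add: sum_divide_distrib add_divide_distrib)
qed

text \<open>Up to a real, hence tangential, part \<open>u'\<close> the velocity is
  \<open>?\<psi>\<close> times \<open>\<i> r\<close>. The Lagrangian condition removes the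
  tangential part, and pairing \<open>\<i> r\<close> with a tangent vector under the symplectic form
  gives minus the metric; this explains sign and factor in \<open>gfield\<close>.\<close>

lemma path_derivative_gradient:
  assumes \<theta>: "\<theta> = b + t *\<^sub>R \<delta>" and W: "(\<theta>, y) \<in> W" and p: "p = chart_inv c y"
    and h: "path_derivative A X (\<lambda>\<tau>. F (b + \<tau> *\<^sub>R \<delta>)) t h"
  shows "toC p (gradient A (lag_riem A X (F \<theta>)) (h \<circ> F \<theta>) p) = C.gfield (\<delta>, 0) (\<theta>, y)"
proof (rule gradientI(1)[OF W p])
  fix u
  let ?x = "F \<theta> (chart_inv c y)" and ?\<xi> = "(\<theta>, y)"
  let ?r = "C.r (\<delta>, 0) ?\<xi>" and ?\<psi> = "Re (1 / C.m ?\<xi>)" and ?q = "C.q (\<delta>, 0) ?\<xi>"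
  let ?v = "toC p u"
  define z where "z = 1 / C.m ?\<xi>"
  \<comment> \<open>The real part of \<open>\<i> r / m - w\<close>, which equals
    \<open>q\<close>.\<close>
  define u' where "u' = (\<chi> k. - Im z * ?r $ k - C.w (\<delta>, 0) ?\<xi> $ k)"
  note f = frame_props[OF W]
  have "?q $ k = ?\<psi> *\<^sub>R (\<i> * of_real (?r $ k)) + of_real (u' $ k)" for k
  proof -
    have "?q $ k = \<i> * of_real (?r $ k) * z - of_real (C.w (\<delta>, 0) ?\<xi> $ k)"
      using C.m_q_w[OF W, of "(\<delta>, 0)" k] C.m_nz[OF W] by (simp add: z_def field_simps)
    then show ?thesis unfolding z_def[symmetric] by (simp add: complex_eq_iff u'_def)
  qed
  then have "?q = ?\<psi> *\<^sub>R (\<i> *s cvec ?r) + cvec u'" by (simp add: vec_eq_iff cvec_def)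
  then have fq: "frame ?\<xi> ?q = ?\<psi> *\<^sub>R (\<i> *s frame ?\<xi> (cvec ?r)) + frame ?\<xi> (cvec u')"
    by (simp only: linear_add[OF f(1)] linear_scale[OF f(1)] f(2))
  have vel: "velocity (charts X) (\<lambda>\<tau>. F (b + \<tau> *\<^sub>R \<delta>)) t p = frame ?\<xi> ?q"
    unfolding velocity_F[OF \<theta> W p refl] frame_def using C.P_mult_q[OF W] by (simp add: p)
  have "fderiv A (h \<circ> F \<theta>) p u = symp X ?x (vpair (frame ?\<xi> ?q) (frame ?\<xi> (cvec ?v)))"
  proof -
    have "fderiv A (h \<circ> F \<theta>) p u = symp X (F \<theta> p)
        (vpair (velocity (charts X) (\<lambda>\<tau>. F (b + \<tau> *\<^sub>R \<delta>)) t p) (mderiv A (charts X) (F \<theta>) p u))"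
      using h unfolding path_derivative_def \<theta>[symmetric] by simp
    then show ?thesis unfolding vel mderiv_frame[OF W p] unfolding p .
  qed
  also have "\<dots> = ?\<psi> * symp X ?x (vpair (\<i> *s frame ?\<xi> (cvec ?r)) (frame ?\<xi> (cvec ?v)))"
    unfolding fq by (simp add: linear_add[OF two_form_linear_left[OF symp_props(1)]]
        linear_scale[OF two_form_linear_left[OF symp_props(1)]] lagrangian_frame[OF W])
  also have "\<dots> = kform ?\<xi> (C.gfield (\<delta>, 0) ?\<xi>) ?v"
    unfolding two_form_J[OF symp_props(1,2)] C.gfield_def linear_scale[OF kform_props(1)[OF W]]
    by (simp add: kform_def)
  finally show "kform ?\<xi> (C.gfield (\<delta>, 0) ?\<xi>) (toC p u) = fderiv A (h \<circ> F \<theta>) p u" ..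
qed

end

section \<open>The curvature formula\<close>

lemma dirderiv_vec:
  fixes V :: "'e::real_normed_vector \<Rightarrow> (real, 'n::finite) vec"
  assumes "\<And>j. (\<lambda>y. V y $ j) differentiable (at x)"
  shows "dirderiv u V x = (\<chi> j. dirderiv u (\<lambda>y. V y $ j) x)"
proof -
  have "((\<lambda>y. \<Sum>j\<in>UNIV. V y $ j *\<^sub>R axis j (1 :: real)) has_derivative
     (\<lambda>u. \<Sum>j\<in>UNIV. dirderiv u (\<lambda>y. V y $ j) x *\<^sub>R axis j 1)) (at x)"
    by (intro has_derivative_sum has_derivative_scaleR_left has_derivative_frechet_derivative assms)
  then have "(V has_derivative (\<lambda>u. \<Sum>j\<in>UNIV. dirderiv u (\<lambda>y. V y $ j) x *\<^sub>R axis j 1)) (at x)"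
    by (simp only: vec_axis_sum[symmetric])
  moreover have "(\<Sum>j\<in>UNIV. b j *\<^sub>R axis j (1 :: real)) = (\<chi> j :: 'n. b j)" for b
    by (simp add: vec_eq_iff axis_def if_distrib cong: if_cong)
  ultimately show ?thesis by (simp only: dirderivI)
qed

text \<open>Since \<open>Re (1 / m) = cos \<theta> / |m|\<close>, minus its logarithmic derivative
  is that of \<open>|m|\<close> plus \<open>tan \<theta>\<close> times the derivative of the angle.
  Here \<open>z\<close> stands for a derivative of \<open>m\<close>, and the double minus matches
  \<open>inverse_m_derivative\<close>.\<close>

lemma Re_inverse_log_derivative:
  assumes "Re m > 0"
  shows "- (- Re (z / m\<^sup>2)) / Re (1 / m) = Re (z / m) + tan (Arg m) * Im (z / m)"
    and "(cos (Arg m))\<^sup>2 = Re m * Re (1 / m)"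
proof -
  have m: "m \<noteq> 0" using assms by auto
  have c: "cmod m > 0" using m by simp
  have s: "(cmod m)\<^sup>2 = (Re m)\<^sup>2 + (Im m)\<^sup>2" by (rule cmod_power2)
  have i: "Re (1 / m) = Re m / (cmod m)\<^sup>2" "Im (1 / m) = - Im m / (cmod m)\<^sup>2"
    by (simp_all add: Re_divide Im_divide s)
  have t: "tan (Arg m) = Im m / Re m"
    using c by (simp add: tan_def cos_Arg[OF m] sin_Arg[OF m])
  have "z / m\<^sup>2 = (z / m) * (1 / m)" by (simp add: power2_eq_square)
  then have "Re (z / m\<^sup>2) = Re ((z / m) * (1 / m))" by (rule arg_cong)
  then have "Re (z / m\<^sup>2) = Re (z / m) * Re (1 / m) - Im (z / m) * Im (1 / m)" by (simp only: times_complex.sel)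
  then show "- (- Re (z / m\<^sup>2)) / Re (1 / m) = Re (z / m) + tan (Arg m) * Im (z / m)"
    unfolding t i using assms c by (simp add: field_simps)
  show "(cos (Arg m))\<^sup>2 = Re m * Re (1 / m)"
    unfolding i cos_Arg[OF m] by (simp add: power2_eq_square)
qed

text \<open>\<open>C\<close> is the squared cosine, \<open>B\<close> the bracket term, and
  \<open>x\<close>, \<open>y\<close> are the derivatives of \<open>l\<close> along the gradients of
  \<open>h\<close> and \<open>k\<close>; \<open>s\<close> and \<open>t\<close> are
  \<open>n / (2 \<rho>)\<close> and \<open>tan \<theta>\<close>.\<close>

lemma divide_curvature_terms:
  fixes C :: real
  assumes "C \<noteq> 0" and "C * R = B + (- a + s * u + t * v) * y - (- b + s * w + t * z) * x"
  shows "R = - (1 / C) * ((a - s * u) * y - (b - s * w) * x) + 1 / C * B + t * (1 / C) * (v * y - z * x)"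
proof -
  have "R = (B + (- a + s * u + t * v) * y - (- b + s * w + t * z) * x) / C"
    using assms by (simp add: field_simps)
  then show ?thesis by (simp add: add_divide_distrib diff_divide_distrib algebra_simps)
qed

lemma sum_collect_coefficients:
  fixes e u v :: "'j \<Rightarrow> real" and a b :: "'i \<Rightarrow> real"
  shows "(\<Sum>j\<in>J. (\<Sum>i\<in>I. x i j - y i j + a i * v j - b i * u j) * e j) =
    (\<Sum>j\<in>J. (\<Sum>i\<in>I. x i j - y i j) * e j) + (\<Sum>i\<in>I. a i) * (\<Sum>j\<in>J. v j * e j) - (\<Sum>i\<in>I. b i) * (\<Sum>j\<in>J. u j * e j)"
  by (simp add: sum.distrib sum_subtractf distrib_right left_diff_distrib sum_distrib_right[symmetric] sum_distrib_left mult.assoc)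

text \<open>The defining Koszul equation is symmetric in \<open>u\<close> and \<open>v\<close>. This
  lets the Christoffel terms cancel in a difference of covariant derivatives without being
  evaluated.\<close>

lemma christoffel_sym:
  assumes "\<And>p u v. G p (vpair u v) = G p (vpair v u)"
    and "\<And>y u v. tensor_in A (chart_at A p) G y (vpair u v) = tensor_in A (chart_at A p) G y (vpair v u)"
  shows "christoffel A G p u v = christoffel A G p v u"
  unfolding christoffel_def Let_def using assms(2)[of _ u v] by (simp add: add.commute)

context lagrangian_surface_chart
begin

lemma curvature_formula:
  fixes f p h k l y
  defines "f \<equiv> F (0, 0)"
  assumes W: "((0, 0), y) \<in> W" and p: "p = chart_inv c y" and cp: "chart_at A p = c"
    and h: "path_derivative A X (\<lambda>s. F (s, 0)) 0 h" and k: "path_derivative A X (\<lambda>t. F (0, t)) 0 k"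
    and l: "\<And>p. ll (0, 0) (f p) = l (f p)"
  shows "curvature A X F ll (f p) = (
    let n = real CARD('n); \<rho> = acy_rho X \<circ> f; \<theta> = lag_angle A X f; G = lag_riem A X f;
        H = h \<circ> f; K = k \<circ> f; L = l \<circ> f;
        \<Delta> = (\<lambda>\<phi>. laplace_beltrami A G \<phi> p);
        grad = gradient A G;
        ip = (\<lambda>u v. G p (vpair u v));
        ipd = (\<lambda>\<phi> \<psi>. inner_d A G \<phi> \<psi> p);
        nabla = levi_civita A G p;
        sec2 = 1 / (cos (\<theta> p))\<^sup>2
    in - sec2 * ((\<Delta> H - n / (2 * \<rho> p) * ipd H \<rho>) * ipd K L
               - (\<Delta> K - n / (2 * \<rho> p) * ipd K \<rho>) * ipd H L)
       + sec2 * (ip (nabla (grad H p) (grad K)) (grad L p)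
               - ip (nabla (grad K p) (grad H)) (grad L p))
       + tan (\<theta> p) * sec2 * (ip (grad H p) (grad \<theta> p) * ip (grad K p) (grad L p)
               - ip (grad K p) (grad \<theta> p) * ip (grad H p) (grad L p)))"
proof -
  let ?G = "lag_riem A X f" and ?\<xi> = "((0, 0), y) :: (real \<times> real) \<times> (real, 'n) vec"
  let ?grad = "gradient A ?G"
  let ?\<rho> = "acy_rho X \<circ> f" and ?\<theta> = "lag_angle A X f" and ?n = "real CARD('n)"
  define U where "U y = C.gfield dS ((0, 0), y)" for y
  define V where "V y = C.gfield dT ((0, 0), y)" for y
  have coord: "snd c p = y" unfolding p by (rule W_point(4)[OF W])
  have fp: "f p = F (0, 0) (chart_inv c y)" by (simp add: f_def p)
  \<comment> \<open>At \<open>p\<close> itself the change to \<open>c\<close> is the identity; at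
    nearby points it need not be, which is why \<open>gH\<close> and \<open>gK\<close> retain
    it.\<close>
  have toC: "toC p v = v" for v unfolding cp by (rule transition_self[OF atlasA c]) (use W_point(3)[OF W] p in simp)
  have gH: "toC (chart_inv c y) (?grad (h \<circ> f) (chart_inv c y)) = U y" if "((0, 0), y) \<in> W" for y
    unfolding U_def f_def by (rule path_derivative_gradient[of "(0, 0)" "(0, 0)" 0, OF _ that refl]) (use h in simp_all)
  have gK: "toC (chart_inv c y) (?grad (k \<circ> f) (chart_inv c y)) = V y" if "((0, 0), y) \<in> W" for y
    unfolding V_def f_def by (rule path_derivative_gradient[of "(0, 0)" "(0, 0)" 0, OF _ that refl]) (use k in simp_all)
  have H: "?grad (h \<circ> f) p = U y" and K: "?grad (k \<circ> f) p = V y"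
    using gH[OF W] gK[OF W] toC unfolding p[symmetric] by simp_all
  have dU: "(\<lambda>y. U y $ j) differentiable (at y)" "dirderiv (axis i 1) (\<lambda>y. U y $ j) y = dirderiv (Y i) (\<lambda>\<xi>. C.gfield dS \<xi> $ j) ?\<xi>" for i j
    unfolding U_def by (rule slice_axis[OF C.gfield_diff(1)[OF W]])+
  have dV: "(\<lambda>y. V y $ j) differentiable (at y)" "dirderiv (axis i 1) (\<lambda>y. V y $ j) y = dirderiv (Y i) (\<lambda>\<xi>. C.gfield dT \<xi> $ j) ?\<xi>" for i j
    unfolding V_def by (rule slice_axis[OF C.gfield_diff(1)[OF W]])+
  have dsum: "dirderiv u g y = (\<Sum>j\<in>UNIV. u $ j * dirderiv (axis j 1) g y)" if "g differentiable (at y)" for u and g :: "(real, 'n) vec \<Rightarrow> real"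
    by (subst vec_axis_sum[of u]) (simp add: dirderiv_sum_dir[OF that])
  have ipg: "?G p (vpair u (?grad \<phi> p)) = dirderiv u (\<phi> \<circ> chart_inv c) y" if "(\<phi> \<circ> chart_inv c) differentiable (at y)" for \<phi> u
  proof -
    have "?G p (vpair u (?grad \<phi> p)) = fderiv A \<phi> p u"
      unfolding f_def lag_riem_sym[of "(0, 0)" p u] by (rule gradient_works[OF W p that])
    also have "\<dots> = dirderiv u (\<phi> \<circ> chart_inv c) y"
      using fderiv_eq[OF atlasA c, of p \<phi> u] W_point(3,4)[OF W] that toC by (simp add: p)
    finally show ?thesis .
  qed
  have L: "(l \<circ> f) \<circ> chart_inv c = (\<lambda>y. lc ((0, 0), y))" using l by (auto simp: fun_eq_iff lc_def f_def)
  have lcd: "lc differentiable (at ?\<xi>)" by (rule smooth_on_differentiable[OF smooth_lc W])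
  have Ld: "((l \<circ> f) \<circ> chart_inv c) differentiable (at y)" unfolding L by (rule slice_axis(1)[OF lcd])
  have \<rho>: "?\<rho> \<circ> chart_inv c = (\<lambda>y. acy_rho X (F (0, 0) (chart_inv c y)))" by (auto simp: f_def)
  have \<rho>d: "(?\<rho> \<circ> chart_inv c) differentiable (at y)" unfolding \<rho> by (rule rho_differentiable[OF W])
  have \<theta>: "?\<theta> \<circ> chart_inv c = (\<lambda>y. lag_angle A X (F (0, 0)) (chart_inv c y))" by (auto simp: f_def)
  have \<theta>d: "(?\<theta> \<circ> chart_inv c) differentiable (at y)" unfolding \<theta> by (rule angle_derivative(1)[OF W])
  let ?D = "\<lambda>\<phi> u. dirderiv u (\<phi> \<circ> chart_inv c) y"
  have inner: "inner_d A ?G \<phi> \<phi>' p = ?D \<phi>' (?grad \<phi> p)" if "(\<phi>' \<circ> chart_inv c) differentiable (at y)" for \<phi> \<phi>'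
    unfolding inner_d_def by (rule ipg[OF that])
  let ?m = "C.m ?\<xi>" and ?\<psi> = "Re (1 / C.m ?\<xi>)"
  let ?\<kappa> = "\<lambda>y. density ((0, 0), y)"
  let ?t = "tan (?\<theta> p)"
  have ang: "?\<theta> p = Arg ?m" unfolding f_def by (rule lag_angle_Arg[OF W p])
  \<comment> \<open>The logarithmic derivative of \<open>1 / \<psi>\<close>. It splits into the
    parts of the volume density, of \<rho> and of \<theta>, which yield the Laplacian, the
    \<open>n / (2 \<rho>)\<close> terms and the \<open>tan \<theta>\<close> terms.\<close>
  define \<alpha> where "\<alpha> i = - dirderiv (Y i) (\<lambda>\<xi>. Re (1 / C.m \<xi>)) ?\<xi> / ?\<psi>" for i
  have \<alpha>: "\<alpha> i = dirderiv (axis i 1) ?\<kappa> y / ?\<kappa> y + ?n / (2 * ?\<rho> p) * ?D ?\<rho> (axis i 1) + ?t * ?D ?\<theta> (axis i 1)" for i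
  proof -
    have "?\<kappa> y > 0" by (rule density_derivative(1)[OF W])
    then have "dirderiv (axis i 1) ?\<kappa> y / ?\<kappa> y = Re (dirderiv (Y i) C.m ?\<xi> / ?m) - ?n / (2 * ?\<rho> p) * ?D ?\<rho> (axis i 1)"
      unfolding density_derivative(3)[OF W] \<rho> by (simp add: fp Y_def)
    moreover have "?D ?\<theta> (axis i 1) = Im (dirderiv (Y i) C.m ?\<xi> / ?m)"
      unfolding \<theta> angle_derivative(2)[OF W] by (simp add: Y_def)
    ultimately show ?thesis
      unfolding \<alpha>_def C.inverse_m_derivative(2)[OF W] Re_inverse_log_derivative(1)[OF C.pos[OF W]] ang by simp
  qed
  have lap: "(\<Sum>i\<in>UNIV. dirderiv (axis i 1) (\<lambda>y. Z y $ i) y + \<alpha> i * Z y $ i)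
      = - laplace_beltrami A ?G \<phi> p + ?n / (2 * ?\<rho> p) * ?D ?\<rho> (Z y) + ?t * ?D ?\<theta> (Z y)"
    if Z: "\<And>y. ((0, 0), y) \<in> W \<Longrightarrow> toC (chart_inv c y) (?grad \<phi> (chart_inv c y)) = Z y" "\<And>j. (\<lambda>y. Z y $ j) differentiable (at y)" for Z \<phi>
  proof -
    have "laplace_beltrami A ?G \<phi> p = - (\<Sum>i\<in>UNIV. dirderiv (axis i 1) (\<lambda>y. Z y $ i) y + dirderiv (axis i 1) ?\<kappa> y / ?\<kappa> y * Z y $ i)"
      unfolding f_def by (rule laplace_beltrami_coords[OF W p cp]) (use Z in \<open>simp_all add: f_def\<close>)
    then show ?thesis
      unfolding dsum[OF \<rho>d, of "Z y"] dsum[OF \<theta>d, of "Z y"] \<alpha>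
      by (simp add: sum.distrib sum_distrib_left algebra_simps)
  qed
  have nab: "levi_civita A ?G p u (?grad \<phi>) = (\<chi> j. \<Sum>i\<in>UNIV. u $ i * dirderiv (axis i 1) (\<lambda>y. Z y $ j) y) + christoffel A ?G p u (Z y)"
    if Z: "\<And>y. ((0, 0), y) \<in> W \<Longrightarrow> toC (chart_inv c y) (?grad \<phi> (chart_inv c y)) = Z y" "\<And>j. (\<lambda>y. Z y $ j) differentiable (at y)" for Z \<phi> u
  proof -
    have "dirderiv u (vector_in A c (?grad \<phi>)) y = dirderiv u Z y"
      by (rule dirderiv_cong[OF open_slice[of "(0, 0)"]]) (use W Z(1) W_point(2) in \<open>auto simp: vector_in_toC\<close>)
    also have "\<dots> = (\<chi> j. \<Sum>i\<in>UNIV. u $ i * dirderiv (axis i 1) (\<lambda>y. Z y $ j) y)"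
      unfolding dirderiv_vec[OF Z(2)] dsum[OF Z(2), where u = u] ..
    finally show ?thesis
      unfolding levi_civita_def cp coord using Z(1)[OF W, folded p] by (simp only: toC)
  qed
  have chr: "christoffel A ?G p u v = christoffel A ?G p v u" for u v
  proof (rule christoffel_sym)
    fix q z and u v :: "(real, 'n) vec"
    have c2: "(\<lambda>i. g (vpair u v i)) = vpair (g u) (g v)" for g :: "(real, 'n) vec \<Rightarrow> (real, 'n) vec" and u v
      by (auto simp: fun_eq_iff split: nat.split)
    show "?G q (vpair u v) = ?G q (vpair v u)" unfolding f_def by (rule lag_riem_sym)
    show "tensor_in A (chart_at A p) ?G z (vpair u v) = tensor_in A (chart_at A p) ?G z (vpair v u)"
      unfolding tensor_in_def Let_def c2 f_def by (rule lag_riem_sym)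
  qed
  have linG: "?G p (vpair (u + w) v) - ?G p (vpair (u' + w) v) = ?G p (vpair (u - u') v)" for u u' v w
    unfolding f_def lag_riem_kform[OF W p]
    by (simp add: toC linear_add[OF kform_props(1)[OF W]] linear_diff[OF kform_props(1)[OF W]])
  have lH: "(\<Sum>i\<in>UNIV. dirderiv (axis i 1) (\<lambda>y. U y $ i) y + \<alpha> i * U y $ i)
      = - laplace_beltrami A ?G (h \<circ> f) p + ?n / (2 * ?\<rho> p) * ?D ?\<rho> (U y) + ?t * ?D ?\<theta> (U y)"
    by (rule lap[OF gH dU(1)])
  have lK: "(\<Sum>i\<in>UNIV. dirderiv (axis i 1) (\<lambda>y. V y $ i) y + \<alpha> i * V y $ i)
      = - laplace_beltrami A ?G (k \<circ> f) p + ?n / (2 * ?\<rho> p) * ?D ?\<rho> (V y) + ?t * ?D ?\<theta> (V y)"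
    by (rule lap[OF gK dV(1)])
  let ?dir = "\<lambda>X Z. \<chi> j. \<Sum>i\<in>UNIV. X $ i * dirderiv (axis i 1) (\<lambda>y. Z y $ j) y"
  have nK: "levi_civita A ?G p (U y) (?grad (k \<circ> f)) = ?dir (U y) V + christoffel A ?G p (U y) (V y)"
    by (rule nab[OF gK dV(1)])
  have nH: "levi_civita A ?G p (V y) (?grad (h \<circ> f)) = ?dir (V y) U + christoffel A ?G p (U y) (V y)"
    unfolding chr[of "U y" "V y"] by (rule nab[OF gH dU(1)])
  \<comment> \<open>The Lie bracket of the two gradients applied to \<open>l\<close>; coordinate
    derivatives suffice because \<open>nK\<close> and \<open>nH\<close> have the same Christoffel
    term.\<close>
  define Br where "Br = (\<Sum>j\<in>UNIV. (\<Sum>i\<in>UNIV. U y $ i * dirderiv (axis i 1) (\<lambda>y. V y $ j) y - V y $ i * dirderiv (axis i 1) (\<lambda>y. U y $ j) y) * ?D (l \<circ> f) (axis j 1))"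
  have br: "?G p (vpair (levi_civita A ?G p (?grad (h \<circ> f) p) (?grad (k \<circ> f))) (?grad (l \<circ> f) p))
      - ?G p (vpair (levi_civita A ?G p (?grad (k \<circ> f) p) (?grad (h \<circ> f))) (?grad (l \<circ> f) p)) = Br"
    unfolding H K nK nH linG unfolding ipg[OF Ld]
    unfolding Br_def by (subst dsum[OF Ld]) (simp add: sum_subtractf)
  have "Re ?m * ?\<psi> * curvature A X F ll (f p) = (\<Sum>j\<in>UNIV. (Re ?m * ?\<psi> * C.horizontal_curvature dS dT ?\<xi> j) * ?D (l \<circ> f) (axis j 1))"
    unfolding fp curvature_F[OF W] L slice_axis(3)[OF lcd] by (simp add: sum_distrib_left mult.assoc)
  also have "\<dots> = (\<Sum>j\<in>UNIV. (\<Sum>i\<in>UNIV. U y $ i * dirderiv (axis i 1) (\<lambda>y. V y $ j) y - V y $ i * dirderiv (axis i 1) (\<lambda>y. U y $ j) y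
      + (dirderiv (axis i 1) (\<lambda>y. U y $ i) y + \<alpha> i * U y $ i) * V y $ j - (dirderiv (axis i 1) (\<lambda>y. V y $ i) y + \<alpha> i * V y $ i) * U y $ j) * ?D (l \<circ> f) (axis j 1))"
    unfolding C.horizontal_curvature_gfield[OF W] dU(2) dV(2) \<alpha>_def unfolding U_def V_def by simp
  also have "\<dots> = Br + (\<Sum>i\<in>UNIV. dirderiv (axis i 1) (\<lambda>y. U y $ i) y + \<alpha> i * U y $ i) * ?D (l \<circ> f) (V y)
      - (\<Sum>i\<in>UNIV. dirderiv (axis i 1) (\<lambda>y. V y $ i) y + \<alpha> i * V y $ i) * ?D (l \<circ> f) (U y)"
    unfolding Br_def dsum[OF Ld, of "U y"] dsum[OF Ld, of "V y"]
    by (rule sum_collect_coefficients)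
  finally have main: "(cos (?\<theta> p))\<^sup>2 * curvature A X F ll (f p) = Br
      + (- laplace_beltrami A ?G (h \<circ> f) p + ?n / (2 * ?\<rho> p) * ?D ?\<rho> (U y) + ?t * ?D ?\<theta> (U y)) * ?D (l \<circ> f) (V y)
      - (- laplace_beltrami A ?G (k \<circ> f) p + ?n / (2 * ?\<rho> p) * ?D ?\<rho> (V y) + ?t * ?D ?\<theta> (V y)) * ?D (l \<circ> f) (U y)"
    unfolding lH lK ang Re_inverse_log_derivative(2)[OF C.pos[OF W]] .
  have cos: "(cos (?\<theta> p))\<^sup>2 \<noteq> 0"
    unfolding ang Re_inverse_log_derivative(2)[OF C.pos[OF W]] using C.pos[OF W] C.Re_inverse_m_pos[OF W] by simp
  show ?thesis
    unfolding Let_def br unfolding inner[OF Ld] inner[OF \<rho>d] ipg[OF Ld] ipg[OF \<theta>d] H K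
    by (rule divide_curvature_terms[OF cos main])
qed

end

text \<open>Puts a parametrization into its own class, so that positivity of the class applies to
  it.\<close>

lemma id_in_diffeos:
  fixes A :: "('l::topological_space, (real, 'n::finite) vec) chart set"
  assumes "smooth_atlas A"
  shows "id \<in> diffeos A"
proof -
  have sm: "smooth_map A A id"
    using assms smooth_atlasD(3)[OF assms] unfolding smooth_map_def by (simp add: continuous_on_id)
  have "mderiv A A id p = (\<lambda>v. v)" for p
    using transition_self[OF assms chart_at_in[OF assms]] by (simp add: mderiv_def transition_def fun_eq_iff)
  then have "det (matrix (mderiv A A id p)) > 0" for p by (simp add: matrix_ident)
  then show ?thesis using sm unfolding diffeos_def by (auto intro!: exI[of _ "{}"])
qed

theorem theorem6p1:
  fixes X :: "('x::{t2_space,second_countable_topology}, 'n::{finite,linorder}) acy_data"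
    and A :: "('l::{t2_space,second_countable_topology}, real^'n::{finite,linorder}) chart set"
    and f0 f :: "'l \<Rightarrow> 'x"
    and \<O> :: "('l \<Rightarrow> 'x) set set" and \<Gamma> :: "('l \<Rightarrow> 'x) set"
    and h k l :: "'x \<Rightarrow> real"
  assumes "almost_calabi_yau X"
    and "oriented_atlas A" and "connected (UNIV :: 'l set)"
    and "f0 \<in> lag_embeddings A X f0"
    and "exact_isotopy_class A X f0 \<O>"
    and "\<Gamma> \<in> \<O>" and "f \<in> \<Gamma>"
    and "h \<in> ham_functions A X \<Gamma>" and "k \<in> ham_functions A X \<Gamma>" and "l \<in> ham_functions A X \<Gamma>"
  shows "has_curvature A X f0 \<O> f h k l (\<lambda>p.
    let n = real CARD('n); \<rho> = acy_rho X \<circ> f; \<theta> = lag_angle A X f; G = lag_riem A X f;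
        H = h \<circ> f; K = k \<circ> f; L = l \<circ> f;
        \<Delta> = (\<lambda>\<phi>. laplace_beltrami A G \<phi> p);
        grad = gradient A G;
        ip = (\<lambda>u v. G p (vpair u v));
        ipd = (\<lambda>\<phi> \<psi>. inner_d A G \<phi> \<psi> p);
        nabla = levi_civita A G p;
        sec2 = 1 / (cos (\<theta> p))\<^sup>2
    in - sec2 * ((\<Delta> H - n / (2 * \<rho> p) * ipd H \<rho>) * ipd K L
               - (\<Delta> K - n / (2 * \<rho> p) * ipd K \<rho>) * ipd H L)
       + sec2 * (ip (nabla (grad H p) (grad K)) (grad L p)
               - ip (nabla (grad K p) (grad H)) (grad L p))
       + tan (\<theta> p) * sec2 * (ip (grad H p) (grad \<theta> p) * ip (grad K p) (grad L p)
               - ip (grad K p) (grad \<theta> p) * ip (grad H p) (grad L p)))"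
  unfolding has_curvature_def
proof (intro allI impI, goal_cases)
  case family: (1 \<Theta> F ll p)
  \<comment> \<open>This choice of \<open>c\<close> provides the hypothesis
    \<open>chart_at A p = c\<close> of \<open>curvature_formula\<close>, where the connection and
    the Laplacian at \<open>p\<close> are read in \<open>c\<close>.\<close>
  define c where "c = chart_at A p"
  define d where "d = chart_at (charts X) (f p)"
  have atlases: "smooth_atlas A" "smooth_atlas (charts X)"
    using assms(1,2) unfolding almost_calabi_yau_def complex_atlas_def oriented_atlas_def by auto
  note f = family[unfolded curvature_family_def lag_family_def]
  have pos: "Re (pullback A (charts X) (F \<theta>) (hol_form X) p std_frame) > 0" if "\<theta> \<in> \<Theta>" for \<theta> p
  proof -
    have "lag_class A (F \<theta>) \<in> pos_lag_space A X f0"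
      using f that assms(5) unfolding exact_isotopy_class_def by blast
    moreover have "F \<theta> \<in> lag_class A (F \<theta>)"
      unfolding lag_class_def by (rule image_eqI[OF _ id_in_diffeos[OF atlases(1)]]) simp
    ultimately show ?thesis unfolding pos_lag_space_def by blast
  qed
  have emb: "F \<theta> \<in> lag_embeddings A X f0" if "\<theta> \<in> \<Theta>" for \<theta> using f that by blast
  have inj: "inj (F \<theta>)" if "\<theta> \<in> \<Theta>" for \<theta>
    using emb[OF that] unfolding lag_embeddings_def embedding_def homeomorphism_def by (auto intro: inj_on_inverseI)
  interpret lagrangian_surface_chart X A \<Theta> F c d ll
  proof unfold_locales
    show "almost_calabi_yau X" "oriented_atlas A" by (rule assms)+
    show "open \<Theta>" "smooth_family A (charts X) \<Theta> F" "smooth_fun_family A \<Theta> (\<lambda>\<theta>. ll \<theta> \<circ> F \<theta>)" using f by auto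
    show "c \<in> A" "d \<in> charts X" unfolding c_def d_def by (rule chart_at_in(1)[OF atlases(1)] chart_at_in(1)[OF atlases(2)])+
    show "lagrangian A X (F \<theta>)" if "\<theta> \<in> \<Theta>" for \<theta> using emb[OF that] unfolding lag_embeddings_def by blast
  qed (use pos inj in auto)
  have p: "p \<in> fst c" "f p \<in> fst d" unfolding c_def d_def by (rule chart_at_in(2)[OF atlases(1)] chart_at_in(2)[OF atlases(2)])+
  have F0: "F (0, 0) = f" using f by blast
  have W: "((0, 0), snd c p) \<in> W"
    using f p chart_c(3,4)[OF p(1)] F0 unfolding W_def by simp
  show ?case
    by (rule curvature_formula[OF W, unfolded F0]) (use f chart_c(3)[OF p(1)] in \<open>auto simp: c_def\<close>)
qed

end
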